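(* Let $Y_1,\dots,Y_n$ be i.i.d. with the folded normal density $f_{\theta_0}$, where for $\theta=(\mu,\sigma)\in(0,\infty)\times(0,\infty)$ $$f_{\mu,\sigma}(y)=\frac1\sigma\Big\{\phi\Big(\frac{y-\mu}{\sigma}\Big)+\phi\Big(\frac{y+\mu}{\sigma}\Big)\Big\}\mathbf 1\{y\ge0\},$$ and $\phi$ is the standard normal density. Assume the true parameter $\theta_0=(\mu_0,\sigma_0)$ satisfies $\mu_0>0$, $\sigma_0>0$, and that the parameter space $\Theta$ is a compact subset of $(0,\infty)\times(0,\infty)$ with $\theta_0$ in its interior. Let $\hat\theta_n=(\hat\mu_n,\hat\sigma_n)\in\arg\max_{\theta\in\Theta}\ell_n(\theta)$, with $\ell_n(\theta):=\sum_{i=1}^n\log f_\theta(Y_i)$, be any measurable MLE. Let $s_\theta(y):=\nabla_\theta\log f_\theta(y)$ be the score and $I(\theta):=\mathbb{E}_\theta[s_\theta(Y)s_\theta(Y)^\top]$ the Fisher information matrix. Then, as $n\to\infty$: (i) $\hat\theta_n\to\theta_0$ in probability. (ii) $\displaystyle\sqrt n(\hat\theta_n-\theta_0)=I(\theta_0)^{-1}\frac1{\sqrt n}\sum_{i=1}^n s_{\theta_0}(Y_i)+o_p(1).$ (iii) $\sqrt n(\hat\theta_n-\theta_0)\Rightarrow N(0,I(\theta_0)^{-1})$ in distribution. Moreover, writing $a=(y-\mu)/\sigma$ and $b=(y+\mu)/\sigma$, the score $s_\theta=(s_\mu,s_\sigma)^\top$ is given for $y\ge0$ by $$s_\mu(y;\mu,\sigma)=\frac1\sigma\,\frac{a\phi(a)-b\phi(b)}{\phi(a)+\phi(b)},\qquad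 s_\sigma(y;\mu,\sigma)=\frac1\sigma\Big(-1+\frac{a^2\phi(a)+b^2\phi(b)}{\phi(a)+\phi(b)}\Big),$$ so that $I(\theta_0)=\mathbb{E}_{\theta_0}\Big[\begin{pmatrix}s_\mu\\ s_\sigma\end{pmatrix}\begin{pmatrix}s_\mu\\ s_\sigma\end{pmatrix}^{\top}\Big]$.
   Context: $\mathbb{E}_\theta$ denotes expectation when $Y$ has density $f_\theta$; $o_p(1)$ denotes a random sequence converging to $0$ in probability under $\theta_0$. *)

theory Defs
  imports "HOL-Probability.Probability"
begin

text \<open>A parameter \<open>\<theta> = (\<mu>, \<sigma>)\<close> is a vector in \<open>real^2\<close> with \<open>\<theta>$1 = \<mu>\<close> and \<open>\<theta>$2 = \<sigma>\<close>.\<close>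

definition folded_normal_density :: "real^2 \<Rightarrow> real \<Rightarrow> real" where
  "folded_normal_density \<theta> y =
     1 / \<theta>$2 * (std_normal_density ((y - \<theta>$1) / \<theta>$2) + std_normal_density ((y + \<theta>$1) / \<theta>$2))
       * indicator {0..} y"

definition folded_normal :: "real^2 \<Rightarrow> real measure" where
  "folded_normal \<theta> = density lborel (\<lambda>y. ennreal (folded_normal_density \<theta> y))"

text \<open>For \<open>y < 0\<close> the density vanishes and \<open>ln 0 = 0\<close>; such observations have probability zero.\<close>

definition log_lik :: "(nat \<Rightarrow> real) \<Rightarrow> nat \<Rightarrow> real^2 \<Rightarrow> real" where
  "log_lik y n \<theta> = (\<Sum>i<n. ln (folded_normal_density \<theta> (y i)))"

definition score :: "real^2 \<Rightarrow> real \<Rightarrow> real^2" where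
  "score \<theta> y = (THE D. GDERIV (\<lambda>t. ln (folded_normal_density t y)) \<theta> :> D)"

text \<open>The outer product \<open>v v\<^sup>T\<close> as a column times a row.\<close>

definition outer_square :: "real^'n \<Rightarrow> real^'n^'n" where
  "outer_square v = (columnvector v :: real^1^'n) ** (rowvector v :: real^'n^1)"

definition fisher_info :: "real^2 \<Rightarrow> real^2^2" where
  "fisher_info \<theta> = (\<integral>y. outer_square (score \<theta> y) \<partial>folded_normal \<theta>)"

definition score_mu :: "real \<Rightarrow> real \<Rightarrow> real \<Rightarrow> real" where
  "score_mu \<mu> \<sigma> y =
     (let a = (y - \<mu>) / \<sigma>; b = (y + \<mu>) / \<sigma> in
      1 / \<sigma> * ((a * std_normal_density a - b * std_normal_density b)
        / (std_normal_density a + std_normal_density b)))"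

definition score_sigma :: "real \<Rightarrow> real \<Rightarrow> real \<Rightarrow> real" where
  "score_sigma \<mu> \<sigma> y =
     (let a = (y - \<mu>) / \<sigma>; b = (y + \<mu>) / \<sigma> in
      1 / \<sigma> * (- 1 + (a\<^sup>2 * std_normal_density a + b\<^sup>2 * std_normal_density b)
        / (std_normal_density a + std_normal_density b)))"

text \<open>Measurability is part of both modes of convergence: \<open>measure\<close> and \<open>distr\<close> take
  default values on non-measurable arguments.\<close>

definition tendsto_in_prob ::
  "'a measure \<Rightarrow> (nat \<Rightarrow> 'a \<Rightarrow> 'b::euclidean_space) \<Rightarrow> 'b \<Rightarrow> bool" where
  "tendsto_in_prob M X c \<longleftrightarrow>
     (\<forall>n. X n \<in> borel_measurable M) \<and>
     (\<forall>\<epsilon>>0. (\<lambda>n. measure M {\<omega> \<in> space M. dist (X n \<omega>) c > \<epsilon>}) \<longlonglongrightarrow> 0)"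

definition tendsto_in_distr ::
  "'a measure \<Rightarrow> (nat \<Rightarrow> 'a \<Rightarrow> 'b::euclidean_space) \<Rightarrow> 'b measure \<Rightarrow> bool" where
  "tendsto_in_distr M X N \<longleftrightarrow>
     (\<forall>n. X n \<in> borel_measurable M) \<and>
     (\<forall>g :: 'b \<Rightarrow> real. continuous_on UNIV g \<longrightarrow> bounded (range g) \<longrightarrow>
        (\<lambda>n. \<integral>x. g x \<partial>distr M borel (X n)) \<longlonglongrightarrow> (\<integral>x. g x \<partial>N))"

text \<open>Meaningful for a symmetric positive definite covariance matrix \<open>S\<close>.\<close>

definition multivariate_normal :: "real^'n \<Rightarrow> real^'n^'n \<Rightarrow> (real^'n) measure" where
  "multivariate_normal m S = density lborel (\<lambda>x. ennreal
     (exp (- ((x - m) \<bullet> (matrix_inv S *v (x - m))) / 2) / sqrt ((2 * pi) ^ CARD('n) * det S)))"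

end

(* The proof is Cramer's. The relative entropy of f_theta with respect to f_theta0 is positive for
   theta distinct from theta0, because second and fourth moments determine the parameter, and the
   log-likelihood is Lipschitz in theta with a constant that grows polynomially in y. A finite cover
   of the parameters away from theta0 and the weak law of large numbers then give consistency.
   Expanding the score of the maximizer around theta0, and inverting the Hessian, whose mean converges
   to -I(theta0), gives the linear representation. The information identity and the moments of the
   score come from writing the density as a Gaussian factor times cosh(mu y / sigma^2): every
   expectation that occurs reduces to Gaussian moments and one common integral. The limit law in two
   dimensions follows from the one-dimensional central limit theorem for all linear combinations,
   since on compact sets continuous functions are approximated by trigonometric polynomials. *)

theory Submission
  imports Defs
begin

section \<open>Convergence in probability as convergence along a filter\<close>

text \<open>Two features of the model shape the proof. The functions of y that are averaged are
  unbounded, so every estimate uniform in \<theta> carries an envelope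
  \<open>C * (1 + y\<^sup>2) ^ k\<close>; as all Gaussian moments are finite, a law of large numbers
  from Chebyshev's inequality suffices. And quotients of normal densities are awkward to bound and
  to differentiate, but after the Gaussian factor is pulled out they become \<open>tanh\<close>,
  which is bounded and has Lipschitz constant 1. The condition \<mu> > 0 is essential: (\<mu>,
  \<sigma>) and (-\<mu>, \<sigma>) give the same law, and at \<mu> = 0 the first score component
  vanishes identically, so the information matrix is singular there. The estimator is known only
  through the inequality that defines a maximizer, and consistency gives no rate. The rate comes out
  of the expansion: its error is a factor tending to zero times the norm of the estimation error,
  and is absorbed once that factor is small.\<close>

context prob_space
begin

text \<open>A statement about \<open>(n, \<omega>)\<close> holds eventually along this filter iff it holds with
  probability tending to one. A sequence of random variables converges in probability iff it
  converges along this filter, so that the rules for limits along a filter become available.\<close>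

definition in_prob :: "(nat \<times> 'a) filter" where
  "in_prob = Abs_filter (\<lambda>P. \<forall>e>0. \<forall>\<^sub>F n in sequentially.
     \<exists>A\<in>events. prob A \<ge> 1 - e \<and> (\<forall>\<omega>\<in>A. P (n, \<omega>)))"

text \<open>The measurable set \<open>A\<close> inside the event makes the filter meaningful for
  predicates that are not known to be measurable, such as maximality over an uncountable parameter
  set. For a conjunction, each conjunct is given half of the allowed probability.\<close>

lemma eventually_in_prob:
  "eventually P in_prob \<longleftrightarrow> (\<forall>e>0. \<forall>\<^sub>F n in sequentially.
     \<exists>A\<in>events. prob A \<ge> 1 - e \<and> (\<forall>\<omega>\<in>A. P (n, \<omega>)))"
  unfolding in_prob_def
proof (rule eventually_Abs_filter, rule is_filter.intro)
  show "\<forall>e>0::real. \<forall>\<^sub>F n::nat in sequentially. \<exists>A\<in>events. prob A \<ge> 1 - e \<and> (\<forall>\<omega>\<in>A. True)"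
    by (auto intro!: always_eventually bexI[of _ "space M"] simp: prob_space)
next
  fix P Q :: "nat \<times> 'a \<Rightarrow> bool"
  assume P: "\<forall>e>0. \<forall>\<^sub>F n in sequentially. \<exists>A\<in>events. prob A \<ge> 1 - e \<and> (\<forall>\<omega>\<in>A. P (n, \<omega>))"
    and Q: "\<forall>e>0. \<forall>\<^sub>F n in sequentially. \<exists>A\<in>events. prob A \<ge> 1 - e \<and> (\<forall>\<omega>\<in>A. Q (n, \<omega>))"
  show "\<forall>e>0. \<forall>\<^sub>F n in sequentially.
      \<exists>A\<in>events. prob A \<ge> 1 - e \<and> (\<forall>\<omega>\<in>A. P (n, \<omega>) \<and> Q (n, \<omega>))"
  proof (intro allI impI)
    fix e :: real assume "e > 0"
    then have "\<forall>\<^sub>F n in sequentially. \<exists>A\<in>events. prob A \<ge> 1 - e/2 \<and> (\<forall>\<omega>\<in>A. P (n, \<omega>))"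
      "\<forall>\<^sub>F n in sequentially. \<exists>A\<in>events. prob A \<ge> 1 - e/2 \<and> (\<forall>\<omega>\<in>A. Q (n, \<omega>))"
      using P Q half_gt_zero by blast+
    then show "\<forall>\<^sub>F n in sequentially.
      \<exists>A\<in>events. prob A \<ge> 1 - e \<and> (\<forall>\<omega>\<in>A. P (n, \<omega>) \<and> Q (n, \<omega>))"
    proof eventually_elim
      case (elim n)
      then obtain A B where A: "A \<in> events" "prob A \<ge> 1 - e/2" "\<forall>\<omega>\<in>A. P (n, \<omega>)"
        and B: "B \<in> events" "prob B \<ge> 1 - e/2" "\<forall>\<omega>\<in>B. Q (n, \<omega>)" by blast
      have "prob A - prob B \<le> 1 - prob B" using A by simp
      have "prob (A - B) \<le> prob (space M - B)"
        using A B sets.sets_into_space[OF A(1)] by (intro finite_measure_mono) auto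
      also have "\<dots> = 1 - prob B" using B by (simp add: prob_compl)
      finally have "prob A - prob (A \<inter> B) \<le> 1 - prob B"
        using A B finite_measure_Diff'[of A B] by simp
      then show ?case using A B by (intro bexI[of _ "A \<inter> B"]) auto
    qed
  qed
next
  fix P Q :: "nat \<times> 'a \<Rightarrow> bool"
  assume PQ: "\<forall>x. P x \<longrightarrow> Q x"
    and P: "\<forall>e>0. \<forall>\<^sub>F n in sequentially. \<exists>A\<in>events. prob A \<ge> 1 - e \<and> (\<forall>\<omega>\<in>A. P (n, \<omega>))"
  show "\<forall>e>0. \<forall>\<^sub>F n in sequentially. \<exists>A\<in>events. prob A \<ge> 1 - e \<and> (\<forall>\<omega>\<in>A. Q (n, \<omega>))"
  proof (intro allI impI)
    fix e :: real assume "e > 0"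
    with P have "\<forall>\<^sub>F n in sequentially. \<exists>A\<in>events. prob A \<ge> 1 - e \<and> (\<forall>\<omega>\<in>A. P (n, \<omega>))"
      by blast
    then show "\<forall>\<^sub>F n in sequentially. \<exists>A\<in>events. prob A \<ge> 1 - e \<and> (\<forall>\<omega>\<in>A. Q (n, \<omega>))"
      by (rule eventually_mono) (use PQ in blast)
  qed
qed

text \<open>The exceptional null set may depend on \<open>n\<close>. Almost sure statements, such as
  maximality of the estimator, enter the filter here.\<close>

lemma eventually_in_prob_AE:
  assumes "\<forall>\<^sub>F n in sequentially. AE \<omega> in M. P n \<omega>"
  shows "\<forall>\<^sub>F (n, \<omega>) in in_prob. P n \<omega>"
  unfolding eventually_in_prob
proof (intro allI impI)
  fix e :: real assume "e > 0"
  show "\<forall>\<^sub>F n in sequentially. \<exists>A\<in>events. prob A \<ge> 1 - e \<and> (\<forall>\<omega>\<in>A. case (n, \<omega>) of (n, \<omega>) \<Rightarrow> P n \<omega>)"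
    using assms
  proof eventually_elim
    case (elim n)
    then obtain N where N: "{\<omega>\<in>space M. \<not> P n \<omega>} \<subseteq> N" "emeasure M N = 0" "N \<in> events"
      by (rule AE_E)
    from N have "prob N = 0" by (simp add: measure_def)
    with N have "prob (space M - N) = 1" by (simp add: prob_compl)
    then show ?case using N \<open>e > 0\<close> by (intro bexI[of _ "space M - N"]) auto
  qed
qed

lemma tendsto_in_prob_iff:
  fixes X :: "nat \<Rightarrow> 'a \<Rightarrow> 'b::euclidean_space"
  assumes [measurable]: "\<And>n. X n \<in> borel_measurable M"
  shows "tendsto_in_prob M X c \<longleftrightarrow> ((\<lambda>(n, \<omega>). X n \<omega>) \<longlongrightarrow> c) in_prob"
proof
  assume X: "tendsto_in_prob M X c"
  show "((\<lambda>(n, \<omega>). X n \<omega>) \<longlongrightarrow> c) in_prob"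
    unfolding tendsto_iff eventually_in_prob
  proof (intro allI impI)
    fix d e :: real assume "d > 0" "e > 0"
    \<comment> \<open>Half of \<open>d\<close>, because outside this event the distance is only
      known to be at most the threshold, while the filter asks for less than
      \<open>d\<close>.\<close>
    then have "(\<lambda>n. prob {\<omega>\<in>space M. dist (X n \<omega>) c > d/2}) \<longlonglongrightarrow> 0"
      using X half_gt_zero[OF \<open>d > 0\<close>] unfolding tendsto_in_prob_def by blast
    then have "\<forall>\<^sub>F n in sequentially. prob {\<omega>\<in>space M. dist (X n \<omega>) c > d/2} < e"
      using \<open>e > 0\<close> by (rule order_tendstoD)
    then show "\<forall>\<^sub>F n in sequentially. \<exists>A\<in>events. 1 - e \<le> prob A \<and>
       (\<forall>\<omega>\<in>A. dist (case (n, \<omega>) of (n, \<omega>) \<Rightarrow> X n \<omega>) c < d)"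
    proof eventually_elim
      case (elim n)
      let ?A = "{\<omega>\<in>space M. dist (X n \<omega>) c > d/2}"
      have "prob (space M - ?A) = 1 - prob ?A" by (intro prob_compl) measurable
      then show ?case using elim \<open>d > 0\<close>
        by (intro bexI[of _ "space M - ?A"]) (auto simp: not_less)
    qed
  qed
next
  assume X: "((\<lambda>(n, \<omega>). X n \<omega>) \<longlongrightarrow> c) in_prob"
  show "tendsto_in_prob M X c"
    unfolding tendsto_in_prob_def
  proof (intro conjI allI impI, use assms in simp)
    fix d :: real assume "d > 0"
    show "(\<lambda>n. prob {\<omega>\<in>space M. dist (X n \<omega>) c > d}) \<longlonglongrightarrow> 0"
    proof (rule order_tendstoI)
      fix e :: real assume "0 < e"
      have "\<forall>\<^sub>F n in sequentially. \<exists>A\<in>events. 1 - e/2 \<le> prob A \<and>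
          (\<forall>\<omega>\<in>A. dist (case (n, \<omega>) of (n, \<omega>) \<Rightarrow> X n \<omega>) c < d)"
        using tendstoD[OF X \<open>d > 0\<close>] half_gt_zero[OF \<open>0 < e\<close>] unfolding eventually_in_prob by blast
      then show "\<forall>\<^sub>F n in sequentially. prob {\<omega>\<in>space M. dist (X n \<omega>) c > d} < e"
      proof eventually_elim
        case (elim n)
        then obtain A where A: "A \<in> events" "1 - e/2 \<le> prob A" "\<forall>\<omega>\<in>A. dist (X n \<omega>) c < d"
          by auto
        have "prob {\<omega>\<in>space M. dist (X n \<omega>) c > d} \<le> prob (space M - A)"
          using A by (intro finite_measure_mono) auto
        also have "\<dots> = 1 - prob A" using A by (intro prob_compl)
        finally show ?case using A \<open>0 < e\<close> by simp
      qed
    qed (simp add: always_eventually less_le_trans[OF _ measure_nonneg])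
  qed
qed

text \<open>The rule o_p(1) O_p(1) = o_p(1), with boundedness in probability supplied by Chebyshev's
  inequality.\<close>

lemma tendsto_mult_bounded_second_moment:
  fixes R :: "nat \<Rightarrow> 'a \<Rightarrow> real" and L :: "nat \<Rightarrow> 'a \<Rightarrow> 'b::euclidean_space"
  assumes R: "((\<lambda>(n, \<omega>). R n \<omega>) \<longlongrightarrow> 0) in_prob"
    and [measurable]: "\<And>n. L n \<in> borel_measurable M"
    and L: "\<And>n. integrable M (\<lambda>\<omega>. (norm (L n \<omega>))\<^sup>2)"
      "\<And>n. expectation (\<lambda>\<omega>. (norm (L n \<omega>))\<^sup>2) \<le> C"
  shows "((\<lambda>(n, \<omega>). R n \<omega> * norm (L n \<omega>)) \<longlongrightarrow> 0) in_prob"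
  unfolding tendsto_iff eventually_in_prob
proof (intro allI impI)
  fix d e :: real assume "d > 0" "e > 0"
  have "C \<ge> 0" using L(2)[of 0] by (rule order_trans[rotated]) (simp add: integral_nonneg)
  \<comment> \<open>Chosen so that Chebyshev's bound \<open>C / K\<^sup>2\<close> is at most
    \<open>e / 2\<close>; the summand 1 keeps \<open>K\<close> positive when
    \<open>C = 0\<close>.\<close>
  define K where "K = sqrt (2 * (C + 1) / e)"
  have K: "K > 0" "C / K\<^sup>2 \<le> e / 2"
    using \<open>e > 0\<close> \<open>C \<ge> 0\<close> by (auto simp: K_def field_simps)
  have "\<forall>\<^sub>F n in sequentially. \<exists>A\<in>events. 1 - e/2 \<le> prob A \<and>
      (\<forall>\<omega>\<in>A. dist (case (n, \<omega>) of (n, \<omega>) \<Rightarrow> R n \<omega>) 0 < d / K)"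
    using tendstoD[OF R divide_pos_pos[OF \<open>d > 0\<close> K(1)]] half_gt_zero[OF \<open>e > 0\<close>]
    unfolding eventually_in_prob by blast
  then show "\<forall>\<^sub>F n in sequentially. \<exists>A\<in>events. 1 - e \<le> prob A \<and>
      (\<forall>\<omega>\<in>A. dist (case (n, \<omega>) of (n, \<omega>) \<Rightarrow> R n \<omega> * norm (L n \<omega>)) 0 < d)"
  proof eventually_elim
    case (elim n)
    then obtain A where A: "A \<in> events" "1 - e/2 \<le> prob A" "\<forall>\<omega>\<in>A. \<bar>R n \<omega>\<bar> < d / K"
      by auto
    let ?B = "{\<omega>\<in>space M. \<bar>norm (L n \<omega>)\<bar> \<ge> K}"
    have "prob ?B \<le> expectation (\<lambda>\<omega>. (norm (L n \<omega>))\<^sup>2) / K\<^sup>2"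
      using L K by (intro second_moment_method) auto
    also have "\<dots> \<le> C / K\<^sup>2" by (intro divide_right_mono L) auto
    also have "\<dots> \<le> e/2" by fact
    finally have B: "prob ?B \<le> e/2" .
    have "prob (A \<inter> ?B) \<le> prob ?B" using A by (intro finite_measure_mono) auto
    then have "prob (A - ?B) \<ge> 1 - e"
      using A B finite_measure_Diff'[of A ?B] by auto
    moreover have "\<bar>R n \<omega>\<bar> * norm (L n \<omega>) < d" if "\<omega> \<in> A - ?B" for \<omega>
    proof -
      have "norm (L n \<omega>) < K" "\<bar>R n \<omega>\<bar> < d / K"
        using that A sets.sets_into_space by force+
      then have "\<bar>R n \<omega>\<bar> * norm (L n \<omega>) \<le> d / K * norm (L n \<omega>)"
        by (intro mult_right_mono) auto
      also have "\<dots> < d / K * K"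
        using \<open>norm (L n \<omega>) < K\<close> \<open>d > 0\<close> K by (intro mult_strict_left_mono) auto
      finally show ?thesis using K by simp
    qed
    ultimately show ?case using A by (intro bexI[of _ "A - ?B"]) (auto simp: abs_mult)
  qed
qed

end

section \<open>Averages of independent observations\<close>

locale iid_sample = prob_space M for M :: "'a measure" +
  fixes Y :: "nat \<Rightarrow> 'a \<Rightarrow> real" and N :: "real measure"
  assumes indep: "indep_vars (\<lambda>_. borel) Y UNIV"
    and distr_Y: "\<And>i. distr M borel (Y i) = N"
begin

lemma measurable_Y [measurable]: "Y i \<in> borel_measurable M"
  using indep by (auto simp: indep_vars_def)

lemma sets_N [measurable_cong]: "sets N = sets borel"
  using distr_Y[of 0] by auto

lemma integrable_Y:
  fixes g :: "real \<Rightarrow> 'b::{banach, second_countable_topology}"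
  assumes [measurable]: "g \<in> borel_measurable borel" and "integrable N g"
  shows "integrable M (\<lambda>\<omega>. g (Y i \<omega>))"
  using assms distr_Y[of i] by (metis integrable_distr measurable_Y)

lemma expectation_Y:
  fixes g :: "real \<Rightarrow> 'b::{banach, second_countable_topology}"
  assumes [measurable]: "g \<in> borel_measurable borel"
  shows "expectation (\<lambda>\<omega>. g (Y i \<omega>)) = (\<integral>y. g y \<partial>N)"
  unfolding distr_Y[of i, symmetric] by (subst integral_distr) auto

lemma prob_space_N: "prob_space N"
  unfolding distr_Y[of 0, symmetric] by (rule prob_space_distr) simp

text \<open>Expanding the square leaves only the diagonal: by independence an off-diagonal product
  has the product of the means as expectation, which is 0.\<close>

lemma second_moment_sum:
  fixes g :: "real \<Rightarrow> real"
  assumes [measurable]: "g \<in> borel_measurable borel"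
    and g2: "integrable N (\<lambda>y. (g y)\<^sup>2)" and g0: "(\<integral>y. g y \<partial>N) = 0"
  shows "integrable M (\<lambda>\<omega>. (\<Sum>i<n. g (Y i \<omega>))\<^sup>2)"
    and "expectation (\<lambda>\<omega>. (\<Sum>i<n. g (Y i \<omega>))\<^sup>2) = real n * (\<integral>y. (g y)\<^sup>2 \<partial>N)"
proof -
  interpret N: prob_space N by (rule prob_space_N)
  have gi: "integrable N g"
    by (rule N.square_integrable_imp_integrable[OF _ g2]) simp
  have ii: "integrable M (\<lambda>\<omega>. g (Y i \<omega>) * g (Y i \<omega>))" for i
    using integrable_Y[of "\<lambda>y. (g y)\<^sup>2" i] g2 by (simp add: power2_eq_square)
  have Ei: "expectation (\<lambda>\<omega>. g (Y i \<omega>) * g (Y i \<omega>)) = (\<integral>y. (g y)\<^sup>2 \<partial>N)" for i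
    using expectation_Y[of "\<lambda>y. (g y)\<^sup>2" i] by (simp add: power2_eq_square)
  have ij: "integrable M (\<lambda>\<omega>. g (Y i \<omega>) * g (Y j \<omega>)) \<and>
      expectation (\<lambda>\<omega>. g (Y i \<omega>) * g (Y j \<omega>)) = 0" if "i \<noteq> j" for i j
  proof -
    have ind: "indep_vars (\<lambda>_. borel) (\<lambda>i \<omega>. g (Y i \<omega>)) {i, j}"
      by (rule indep_vars_compose2[OF indep_vars_subset[OF indep, of "{i, j}"], of "\<lambda>_. g"]) auto
    have "expectation (\<lambda>\<omega>. \<Prod>k\<in>{i, j}. g (Y k \<omega>)) = (\<Prod>k\<in>{i, j}. expectation (\<lambda>\<omega>. g (Y k \<omega>)))"
      by (rule indep_vars_lebesgue_integral[OF _ ind]) (auto intro!: integrable_Y gi)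
    moreover have "integrable M (\<lambda>\<omega>. \<Prod>k\<in>{i, j}. g (Y k \<omega>))"
      by (rule indep_vars_integrable[OF _ ind]) (auto intro!: integrable_Y gi)
    ultimately show ?thesis
      using that by (simp add: expectation_Y g0)
  qed
  have int: "integrable M (\<lambda>\<omega>. g (Y i \<omega>) * g (Y j \<omega>))" for i j
    using ii ij by (cases "i = j") auto
  have sq: "(\<Sum>i<n. g (Y i \<omega>))\<^sup>2 = (\<Sum>i<n. \<Sum>j<n. g (Y i \<omega>) * g (Y j \<omega>))" for \<omega>
    by (simp add: power2_eq_square sum_product)
  show "integrable M (\<lambda>\<omega>. (\<Sum>i<n. g (Y i \<omega>))\<^sup>2)"
    unfolding sq by (intro Bochner_Integration.integrable_sum int)
  have "expectation (\<lambda>\<omega>. (\<Sum>i<n. g (Y i \<omega>))\<^sup>2)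
      = (\<Sum>i<n. \<Sum>j<n. expectation (\<lambda>\<omega>. g (Y i \<omega>) * g (Y j \<omega>)))"
    unfolding sq using int by simp
  also have "\<dots> = (\<Sum>i<n. \<Sum>j<n. if i = j then \<integral>y. (g y)\<^sup>2 \<partial>N else 0)"
    using ij Ei by (intro sum.cong refl) auto
  finally show "expectation (\<lambda>\<omega>. (\<Sum>i<n. g (Y i \<omega>))\<^sup>2) = real n * (\<integral>y. (g y)\<^sup>2 \<partial>N)"
    by simp
qed

text \<open>Chebyshev for the centred function \<open>h\<close>. Square integrability is available
  for every function of polynomial growth under the folded normal law.\<close>

lemma weak_law_of_large_numbers:
  fixes g :: "real \<Rightarrow> real"
  assumes [measurable]: "g \<in> borel_measurable borel"
    and g2: "integrable N (\<lambda>y. (g y)\<^sup>2)"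
  shows "((\<lambda>(n, \<omega>). (\<Sum>i<n. g (Y i \<omega>)) / real n) \<longlongrightarrow> (\<integral>y. g y \<partial>N)) in_prob"
proof -
  interpret N: prob_space N by (rule prob_space_N)
  have gi: "integrable N g"
    by (rule N.square_integrable_imp_integrable[OF _ g2]) simp
  define m where "m = (\<integral>y. g y \<partial>N)"
  define h where "h = (\<lambda>y. g y - m)"
  have [measurable]: "h \<in> borel_measurable borel" unfolding h_def by measurable
  have h2: "integrable N (\<lambda>y. (h y)\<^sup>2)"
    using g2 gi by (auto simp: h_def power2_diff intro!: Bochner_Integration.integrable_diff)
  have h0: "(\<integral>y. h y \<partial>N) = 0"
    using gi by (simp add: h_def m_def N.prob_space)
  define V where "V = (\<integral>y. (h y)\<^sup>2 \<partial>N)"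
  have "tendsto_in_prob M (\<lambda>n \<omega>. (\<Sum>i<n. g (Y i \<omega>)) / real n) m"
    unfolding tendsto_in_prob_def
  proof (intro conjI allI impI)
    fix e :: real assume "e > 0"
    show "(\<lambda>n. prob {\<omega>\<in>space M. dist ((\<Sum>i<n. g (Y i \<omega>)) / real n) m > e}) \<longlonglongrightarrow> 0"
    proof (rule tendsto_sandwich[of "\<lambda>_. 0" _ _ "\<lambda>n. V / e\<^sup>2 / real n"])
      show "(\<lambda>n. V / e\<^sup>2 / real n) \<longlonglongrightarrow> 0" by (rule lim_const_over_n)
      show "\<forall>\<^sub>F n in sequentially. prob {\<omega>\<in>space M. dist ((\<Sum>i<n. g (Y i \<omega>)) / real n) m > e}
         \<le> V / e\<^sup>2 / real n"
        using eventually_gt_at_top[of 0]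
      proof eventually_elim
        case (elim n)
        have "\<bar>\<Sum>i<n. h (Y i \<omega>)\<bar> \<ge> real n * e"
          if "dist ((\<Sum>i<n. g (Y i \<omega>)) / real n) m > e" for \<omega>
        proof -
          have "(\<Sum>i<n. h (Y i \<omega>)) = real n * ((\<Sum>i<n. g (Y i \<omega>)) / real n - m)"
            using elim by (simp add: h_def sum_subtractf field_simps)
          then show ?thesis using that elim by (simp add: dist_real_def abs_mult)
        qed
        then have "prob {\<omega>\<in>space M. dist ((\<Sum>i<n. g (Y i \<omega>)) / real n) m > e}
            \<le> prob {\<omega>\<in>space M. \<bar>\<Sum>i<n. h (Y i \<omega>)\<bar> \<ge> real n * e}"
          by (intro finite_measure_mono) auto
        also have "\<dots> \<le> expectation (\<lambda>\<omega>. (\<Sum>i<n. h (Y i \<omega>))\<^sup>2) / (real n * e)\<^sup>2"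
          using elim \<open>e > 0\<close> by (intro second_moment_method second_moment_sum h2 h0) auto
        also have "\<dots> = V / e\<^sup>2 / real n"
          using elim second_moment_sum(2)[OF _ h2 h0, of n]
          by (simp add: V_def power2_eq_square field_simps)
        finally show ?case .
      qed
    qed auto
  qed measurable
  then show ?thesis by (subst (asm) tendsto_in_prob_iff) (auto simp: m_def)
qed

end

section \<open>Weak convergence from trigonometric functions\<close>

text \<open>The phase \<open>c\<close> makes a single generator cover sines, cosines and
  constants.\<close>

inductive_set trig_poly :: "('a::euclidean_space \<Rightarrow> real) set" where
  cos: "(\<lambda>x. r * cos (t \<bullet> x + c)) \<in> trig_poly"
| add: "f \<in> trig_poly \<Longrightarrow> g \<in> trig_poly \<Longrightarrow> (\<lambda>x. f x + g x) \<in> trig_poly"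

lemma trig_poly_const: "(\<lambda>x. r) \<in> trig_poly"
  using trig_poly.cos[of r 0 0] by simp

lemma trig_poly_sum:
  assumes "\<And>i. i \<in> I \<Longrightarrow> f i \<in> trig_poly"
  shows "(\<lambda>x. \<Sum>i\<in>I. f i x) \<in> trig_poly"
  using assms by (induction I rule: infinite_finite_induct) (auto intro: trig_poly_const trig_poly.add)

text \<open>The product-to-sum formula turns a product of two generators into a sum of two
  generators; distributivity does the rest. So \<open>trig_poly\<close> is an algebra.\<close>

lemma trig_poly_mult:
  assumes "f \<in> trig_poly" "g \<in> trig_poly"
  shows "(\<lambda>x. f x * g x) \<in> trig_poly"
  using assms(1)
proof induction
  case f: (cos r t c)
  show ?case using assms(2)
  proof induction
    case (cos s u d)
    have "(\<lambda>x. r * cos (t \<bullet> x + c) * (s * cos (u \<bullet> x + d)))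
        = (\<lambda>x. r * s / 2 * cos ((t - u) \<bullet> x + (c - d)) + r * s / 2 * cos ((t + u) \<bullet> x + (c + d)))"
    proof
      fix x
      define a b where "a = t \<bullet> x + c" and "b = u \<bullet> x + d"
      have "r * cos a * (s * cos b) = r * s * (cos a * cos b)" by simp
      also have "\<dots> = r * s / 2 * cos (a - b) + r * s / 2 * cos (a + b)"
        unfolding cos_times_cos by (simp add: distrib_left add_divide_distrib)
      finally show "r * cos (t \<bullet> x + c) * (s * cos (u \<bullet> x + d))
          = r * s / 2 * cos ((t - u) \<bullet> x + (c - d)) + r * s / 2 * cos ((t + u) \<bullet> x + (c + d))"
        by (simp add: a_def b_def inner_diff_left inner_add_left algebra_simps)
    qed
    then show ?case by (simp only: trig_poly.intros)
  next
    case (add g h)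
    then show ?case by (auto simp: ring_distribs intro: trig_poly.add)
  qed
next
  case (add f h)
  then show ?case by (auto simp: ring_distribs intro: trig_poly.add)
qed

lemma continuous_on_trig_poly: "f \<in> trig_poly \<Longrightarrow> continuous_on UNIV f"
  by (induction rule: trig_poly.induct) (auto intro!: continuous_intros)

text \<open>A linear function of the sines is a sum of terms
  \<open>f b * sin (x \<bullet> b / L)\<close>, and a sine is a cosine with phase -pi/2. Constants,
  sums and products are covered by the closure properties of \<open>trig_poly\<close>.\<close>

lemma trig_poly_polynomial_sin:
  assumes "real_polynomial_function q"
  shows "(\<lambda>x::'a::euclidean_space. q (\<Sum>b\<in>Basis. sin (x \<bullet> b / L) *\<^sub>R b)) \<in> trig_poly"
  using assms
proof induction
  case (linear f)
  interpret bounded_linear f by fact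
  have "(\<lambda>x. \<Sum>b\<in>Basis. f b * cos ((b /\<^sub>R L) \<bullet> x + (- pi / 2))) \<in> trig_poly"
    by (intro trig_poly_sum trig_poly.cos)
  also have "(\<lambda>x. \<Sum>b\<in>Basis. f b * cos ((b /\<^sub>R L) \<bullet> x + (- pi / 2)))
      = (\<lambda>x. f (\<Sum>b\<in>Basis. sin (x \<bullet> b / L) *\<^sub>R b))"
  proof
    fix x :: 'a
    have *: "sin y = cos (y + (- pi / 2))" for y :: real by (simp add: cos_diff)
    show "(\<Sum>b\<in>Basis. f b * cos ((b /\<^sub>R L) \<bullet> x + (- pi / 2)))
        = f (\<Sum>b\<in>Basis. sin (x \<bullet> b / L) *\<^sub>R b)"
      unfolding sum scaleR
    proof (intro sum.cong refl)
      fix b :: 'a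
      have "(b /\<^sub>R L) \<bullet> x = x \<bullet> b / L" by (simp add: inner_commute[of b x] divide_inverse mult.commute)
      then show "f b * cos ((b /\<^sub>R L) \<bullet> x + (- pi / 2)) = sin (x \<bullet> b / L) *\<^sub>R f b"
        by (simp add: * del: add_uminus_conv_diff)
    qed
  qed
  finally show ?case .
qed (auto intro: trig_poly_const trig_poly.add trig_poly_mult)

text \<open>On the box the coordinates are recovered from their scaled sines, so a function on the box is
  a function of these sines; it is approximated by a polynomial in them. Periodicity turns the bound
  on one period into a global one.\<close>

lemma trig_poly_approx:
  fixes g :: "'a::euclidean_space \<Rightarrow> real"
  assumes g: "continuous_on UNIV g" and B: "\<And>x. \<bar>g x\<bar> \<le> B" and "\<epsilon> > 0" "L > 0"
  obtains p where "p \<in> trig_poly" "\<And>x. \<bar>p x\<bar> \<le> B + \<epsilon>"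
    "\<And>x. norm x \<le> L \<Longrightarrow> \<bar>g x - p x\<bar> \<le> \<epsilon>"
proof -
  \<comment> \<open>The approximation takes place on the cube, where \<open>arcsin\<close> is
    continuous in each coordinate. The values of \<open>F\<close> are values of \<open>g\<close>,
    hence bounded by \<open>B\<close>.\<close>
  define F where "F = (\<lambda>u::'a. g (\<Sum>b\<in>Basis. (L * arcsin (u \<bullet> b)) *\<^sub>R b))"
  define h where "h = (\<lambda>x::'a. \<Sum>b\<in>Basis. sin (x \<bullet> b / L) *\<^sub>R b)"
  let ?C = "cbox (- One) One :: 'a set"
  have "continuous_on ?C F"
    unfolding F_def by (rule continuous_on_compose2[OF g])
      (auto intro!: continuous_intros simp: mem_box)
  from Stone_Weierstrass_real_polynomial_function[OF compact_cbox this \<open>\<epsilon> > 0\<close>]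
  obtain q where q: "real_polynomial_function q" "\<And>u. u \<in> ?C \<Longrightarrow> \<bar>F u - q u\<bar> < \<epsilon>"
    by metis
  have h: "h x \<in> ?C" for x
    by (auto simp: h_def mem_box inner_sum_left inner_Basis if_distrib sum.delta cong: if_cong)
  have "\<bar>q (h x)\<bar> \<le> B + \<epsilon>" for x
  proof -
    have "\<bar>F (h x) - q (h x)\<bar> < \<epsilon>" "\<bar>F (h x)\<bar> \<le> B" using q(2)[OF h] B by (auto simp: F_def)
    then show ?thesis by linarith
  qed
  moreover have "\<bar>g x - q (h x)\<bar> \<le> \<epsilon>" if "norm x \<le> L" for x
  proof -
    have "L * arcsin (h x \<bullet> b) = x \<bullet> b" if b: "b \<in> Basis" for b
    proof -
      have "\<bar>x \<bullet> b\<bar> \<le> L" using Basis_le_norm[OF b] \<open>norm x \<le> L\<close> by (rule order_trans)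
      then have "\<bar>x \<bullet> b / L\<bar> \<le> 1" using \<open>L > 0\<close> by simp
      \<comment> \<open>Relaxing 1 to pi/2 puts the argument into the interval on which
        \<open>arcsin\<close> inverts the sine.\<close>
      then have "\<bar>x \<bullet> b / L\<bar> \<le> pi / 2" using pi_ge_two by linarith
      moreover have "h x \<bullet> b = sin (x \<bullet> b / L)"
        using b by (simp add: h_def inner_sum_left inner_Basis if_distrib sum.delta cong: if_cong)
      moreover have "arcsin (sin z) = z" if "\<bar>z\<bar> \<le> pi / 2" for z
        using that by (intro arcsin_sin) linarith+
      ultimately show ?thesis using \<open>L > 0\<close> by simp
    qed
    then have "F (h x) = g x" by (simp add: F_def euclidean_representation)
    then show ?thesis using q(2)[OF h, of x] by simp
  qed
  ultimately show thesis
    using that[of "\<lambda>x. q (h x)"] trig_poly_polynomial_sin[OF q(1), of L] by (auto simp: h_def)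
qed

lemma integrable_bounded_continuous:
  fixes g :: "'a::euclidean_space \<Rightarrow> real"
  assumes "prob_space \<mu>" "sets \<mu> = sets borel" "continuous_on UNIV g" "\<And>x. \<bar>g x\<bar> \<le> B"
  shows "integrable \<mu> g"
proof -
  interpret prob_space \<mu> by fact
  have "g \<in> borel_measurable \<mu>"
    using borel_measurable_continuous_onI[OF assms(3)] assms(2) measurable_cong_sets by blast
  then show ?thesis using assms(4) by (intro integrable_const_bound[of _ B]) auto
qed

lemma trig_poly_bounded:
  assumes "p \<in> trig_poly" shows "\<exists>B. \<forall>x. \<bar>p x\<bar> \<le> B"
  using assms
proof induction
  case (cos r t c)
  have "\<bar>r * cos (t \<bullet> x + c)\<bar> \<le> \<bar>r\<bar> * 1" for x
    unfolding abs_mult by (intro mult_left_mono) auto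
  then show ?case by (intro exI[of _ "\<bar>r\<bar>"]) simp
next
  case (add f g)
  then obtain A B where "\<And>x. \<bar>f x\<bar> \<le> A" "\<And>x. \<bar>g x\<bar> \<le> B" by auto
  then have "\<bar>f x + g x\<bar> \<le> A + B" for x by (rule order_trans[OF abs_triangle_ineq add_mono])
  then show ?case by blast
qed

text \<open>Inside the ball the integrands differ by at most \<epsilon>, outside by at most
  \<open>B + C\<close> on a set of mass at most \<delta>.\<close>

lemma bounded_continuous_approx_integral:
  fixes g p :: "'a::euclidean_space \<Rightarrow> real"
  assumes "prob_space \<mu>" and s: "sets \<mu> = sets borel"
    and g: "continuous_on UNIV g" "\<And>x. \<bar>g x\<bar> \<le> B"
    and p: "continuous_on UNIV p" "\<And>x. \<bar>p x\<bar> \<le> C"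
    and gp: "\<And>x. norm x \<le> L \<Longrightarrow> \<bar>g x - p x\<bar> \<le> \<epsilon>" and "\<epsilon> \<ge> 0"
    and t: "measure \<mu> {x. norm x > L} \<le> \<delta>"
  shows "\<bar>(\<integral>x. g x \<partial>\<mu>) - (\<integral>x. p x \<partial>\<mu>)\<bar> \<le> \<epsilon> + (B + C) * \<delta>"
proof -
  interpret prob_space \<mu> by fact
  note [measurable_cong] = s
  have BC: "0 \<le> B + C" using g(2)[of 0] p(2)[of 0] by linarith
  have gi: "integrable \<mu> g" and pi: "integrable \<mu> p"
    by (rule integrable_bounded_continuous[OF \<open>prob_space \<mu>\<close> s]; fact)+
  let ?I = "indicator {x. norm x > L} :: 'a \<Rightarrow> real"
  have Ii: "integrable \<mu> ?I"
    by (intro integrable_const_bound[of _ 1]) (auto simp: indicator_def)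
  have "\<bar>(\<integral>x. g x \<partial>\<mu>) - (\<integral>x. p x \<partial>\<mu>)\<bar> = \<bar>\<integral>x. g x - p x \<partial>\<mu>\<bar>"
    using gi pi by simp
  also have "\<dots> \<le> (\<integral>x. \<epsilon> + (B + C) * ?I x \<partial>\<mu>)"
  proof (rule integral_abs_bound[THEN order_trans], rule integral_mono)
    show "\<bar>g x - p x\<bar> \<le> \<epsilon> + (B + C) * ?I x" for x
      using gp[of x] g(2)[of x] p(2)[of x] \<open>\<epsilon> \<ge> 0\<close> by (auto simp: indicator_def)
  qed (use gi pi Ii in auto)
  also have "\<dots> = \<epsilon> + (B + C) * measure \<mu> {x. norm x > L}"
    using Ii sets_eq_imp_space_eq[OF s] prob_space by simp
  also have "\<dots> \<le> \<epsilon> + (B + C) * \<delta>" using t BC by (simp add: mult_left_mono)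
  finally show ?thesis .
qed

lemma prob_space_tight:
  fixes \<nu> :: "'a::euclidean_space measure"
  assumes "prob_space \<nu>" and s: "sets \<nu> = sets borel" and "\<delta> > 0"
  obtains L where "L > 0" "measure \<nu> {x. norm x > L} \<le> \<delta>"
proof -
  interpret prob_space \<nu> by fact
  note [measurable_cong] = s
  have sp: "space \<nu> = UNIV" using sets_eq_imp_space_eq[OF s] by simp
  have m[measurable]: "{x. norm x > L} \<in> sets \<nu>" for L by measurable
  have "(\<lambda>n. measure \<nu> {x. norm x > real n}) \<longlonglongrightarrow> measure \<nu> (\<Inter>n. {x. norm x > real n})"
    by (rule finite_Lim_measure_decseq) (auto simp: decseq_def)
  also have "(\<Inter>n. {x::'a. norm x > real n}) = {}"
    using real_arch_simple by (auto simp: set_eq_iff not_less)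
  finally have "\<forall>\<^sub>F n in sequentially. measure \<nu> {x. norm x > real n} < \<delta>"
    using \<open>\<delta> > 0\<close> by (auto dest: order_tendstoD)
  then have "\<forall>\<^sub>F n in sequentially. measure \<nu> {x. norm x > real n} < \<delta> \<and> n > 0"
    using eventually_gt_at_top by (rule eventually_conj)
  then obtain n where "measure \<nu> {x. norm x > real n} < \<delta>" "n > 0"
    by (auto simp: eventually_sequentially)
  then show thesis using that[of "real n"] by simp
qed

text \<open>Takes the place of Levy's continuity theorem. Trigonometric polynomials approximate
  \<open>g\<close> only on a ball; the mass outside is small by tightness, and there the approximant
  is still bounded by \<open>B + \<epsilon>\<close>.\<close>

theorem weak_convergence_trigI:
  fixes \<mu> :: "nat \<Rightarrow> 'a::euclidean_space measure" and \<nu> :: "'a measure"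
  assumes \<mu>: "\<And>n. prob_space (\<mu> n)" "\<And>n. sets (\<mu> n) = sets borel"
    and \<nu>: "prob_space \<nu>" "sets \<nu> = sets borel"
    and cos: "\<And>t c. (\<lambda>n. \<integral>x. cos (t \<bullet> x + c) \<partial>\<mu> n) \<longlonglongrightarrow> (\<integral>x. cos (t \<bullet> x + c) \<partial>\<nu>)"
    and tight: "\<And>\<delta>. \<delta> > 0 \<Longrightarrow> \<exists>L. \<forall>\<^sub>F n in sequentially. measure (\<mu> n) {x. norm x > L} \<le> \<delta>"
    and g: "continuous_on UNIV g" "bounded (range g)"
  shows "(\<lambda>n. \<integral>x. g x \<partial>\<mu> n) \<longlonglongrightarrow> (\<integral>x. (g x :: real) \<partial>\<nu>)"
proof -
  have trig: "(\<lambda>n. \<integral>x. p x \<partial>\<mu> n) \<longlonglongrightarrow> (\<integral>x. p x \<partial>\<nu>)" if "p \<in> trig_poly" for p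
    using that
  proof induction
    case (cos r t c)
    then show ?case by (auto intro!: tendsto_mult assms(5))
  next
    case (add f g)
    then obtain A B where "\<And>x. \<bar>f x\<bar> \<le> A" "\<And>x. \<bar>g x\<bar> \<le> B" using trig_poly_bounded by meson
    then have "integrable m f \<and> integrable m g" if "prob_space m" "sets m = sets borel" for m
      using that add continuous_on_trig_poly integrable_bounded_continuous by metis
    then show ?case using \<mu> \<nu> add.IH by (simp add: tendsto_add)
  qed
  obtain B where B: "\<And>x. \<bar>g x\<bar> \<le> B"
    using g(2) by (auto simp: bounded_iff)
  have "B \<ge> 0" using B[of 0] by linarith
  show ?thesis
  proof (rule LIMSEQ_I, clarsimp simp: eventually_sequentially[symmetric])
    fix r :: real assume "r > 0"
    \<comment> \<open>Replacing \<open>g\<close> by a trigonometric polynomial \<open>p\<close>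
      costs at most \<open>\<epsilon> + (2 * B + \<epsilon>) * \<delta> \<le> r / 3\<close>. This is
      paid twice, for \<open>\<mu> n\<close> and for \<open>\<nu>\<close>; the remaining third is
      left for the convergence of the integrals of \<open>p\<close>.\<close>
    define \<delta> where "\<delta> = r / 6 / (2 * B + r)"
    define \<epsilon> where "\<epsilon> = r / 6"
    have pos: "\<delta> > 0" "\<epsilon> > 0" using \<open>r > 0\<close> \<open>B \<ge> 0\<close> by (auto simp: \<delta>_def \<epsilon>_def)
    have le: "(B + (B + \<epsilon>)) * \<delta> \<le> (2 * B + r) * \<delta>"
      using pos \<open>r > 0\<close> by (intro mult_right_mono) (auto simp: \<epsilon>_def)
    have cancel: "D * (r / 6 / D) = r / 6" if "D > 0" for D using that by simp
    have "(2 * B + r) * \<delta> = r / 6" unfolding \<delta>_def using cancel[of "2 * B + r"] \<open>r > 0\<close> \<open>B \<ge> 0\<close> by force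
    with le have small: "(B + (B + \<epsilon>)) * \<delta> \<le> r / 6" by simp
    obtain L1 where L1: "L1 > 0" "measure \<nu> {x. norm x > L1} \<le> \<delta>"
      by (rule prob_space_tight[OF \<nu> pos(1)])
    obtain L2 where L2: "\<forall>\<^sub>F n in sequentially. measure (\<mu> n) {x. norm x > L2} \<le> \<delta>"
      using tight pos by blast
    define L where "L = max L1 L2"
    have mono: "measure m {x. norm x > L} \<le> measure m {x. norm x > K}"
      if "prob_space m" "sets m = sets borel" "K \<le> L" for m :: "'a measure" and K
    proof -
      interpret m: prob_space m by fact
      show ?thesis using that by (intro m.finite_measure_mono) (auto simp: that(2))
    qed
    have "L > 0" using L1 by (simp add: L_def)
    obtain p where p: "p \<in> trig_poly" "\<And>x. \<bar>p x\<bar> \<le> B + \<epsilon>" "\<And>x. norm x \<le> L \<Longrightarrow> \<bar>g x - p x\<bar> \<le> \<epsilon>"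
      using trig_poly_approx[OF g(1) B pos(2) \<open>L > 0\<close>] by blast
    have approx: "\<bar>(\<integral>x. g x \<partial>m) - (\<integral>x. p x \<partial>m)\<bar> \<le> r / 3"
      if "prob_space m" "sets m = sets borel" "measure m {x. norm x > L} \<le> \<delta>" for m
    proof -
      have "\<bar>(\<integral>x. g x \<partial>m) - (\<integral>x. p x \<partial>m)\<bar> \<le> \<epsilon> + (B + (B + \<epsilon>)) * \<delta>"
        using that(1,2) g(1) B continuous_on_trig_poly[OF p(1)] p(2,3) less_imp_le[OF pos(2)] that(3)
        by (rule bounded_continuous_approx_integral)
      then show ?thesis using small by (simp add: \<epsilon>_def)
    qed
    have \<nu>3: "\<bar>(\<integral>x. g x \<partial>\<nu>) - (\<integral>x. p x \<partial>\<nu>)\<bar> \<le> r / 3"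
      using L1 mono[OF \<nu>, of L1] by (intro approx \<nu>) (auto simp: L_def)
    have "\<forall>\<^sub>F n in sequentially. \<bar>(\<integral>x. p x \<partial>\<mu> n) - (\<integral>x. p x \<partial>\<nu>)\<bar> < r / 3"
      using tendstoD[OF trig[OF p(1)], of "r / 3"] \<open>r > 0\<close> by (simp add: dist_real_def)
    with L2 show "\<forall>\<^sub>F n in sequentially. \<bar>(\<integral>x. g x \<partial>\<mu> n) - (\<integral>x. g x \<partial>\<nu>)\<bar> < r"
    proof eventually_elim
      case (elim n)
      have "\<bar>(\<integral>x. g x \<partial>\<mu> n) - (\<integral>x. p x \<partial>\<mu> n)\<bar> \<le> r / 3"
        using elim mono[OF \<mu>(1,2), of L2 n] by (intro approx \<mu>) (auto simp: L_def)
      then show ?case using \<nu>3 elim(2) by linarith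
    qed
  qed
qed

section \<open>From asymptotic equivalence to convergence in distribution\<close>

context prob_space
begin

text \<open>Bounded convergence for convergence in probability: off a good event, on a set of
  probability at most \<open>d\<close>, the integrand is still bounded by \<open>K\<close>.\<close>

lemma tendsto_expectation_bounded:
  fixes f :: "nat \<Rightarrow> 'a \<Rightarrow> real"
  assumes [measurable]: "\<And>n. f n \<in> borel_measurable M"
    and K: "\<And>n \<omega>. \<bar>f n \<omega>\<bar> \<le> K" and f: "((\<lambda>(n, \<omega>). f n \<omega>) \<longlongrightarrow> 0) in_prob"
  shows "(\<lambda>n. expectation (f n)) \<longlonglongrightarrow> 0"
proof (rule tendstoI)
  fix e :: real assume "e > 0"
  have "K \<ge> 0" using K[of 0 undefined] by linarith
  define d where "d = e / (2 * (K + 1))"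
  have "d > 0" "K * d < e / 2"
    using \<open>e > 0\<close> \<open>K \<ge> 0\<close> by (auto simp: d_def field_simps)
  have "\<forall>\<^sub>F n in sequentially. \<exists>A\<in>events. 1 - d \<le> prob A \<and>
      (\<forall>\<omega>\<in>A. dist (case (n, \<omega>) of (n, \<omega>) \<Rightarrow> f n \<omega>) 0 < e / 2)"
    using tendstoD[OF f half_gt_zero[OF \<open>e > 0\<close>]] \<open>d > 0\<close> unfolding eventually_in_prob by blast
  then show "\<forall>\<^sub>F n in sequentially. dist (expectation (f n)) 0 < e"
  proof eventually_elim
    case (elim n)
    then obtain A where A: "A \<in> events" "1 - d \<le> prob A" "\<And>\<omega>. \<omega> \<in> A \<Longrightarrow> \<bar>f n \<omega>\<bar> < e / 2"
      by auto
    note [measurable] = A(1)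
    let ?I = "indicator (space M - A) :: 'a \<Rightarrow> real"
    have Ii: "integrable M ?I"
      by (intro integrable_const_bound[of _ 1]) (auto simp: indicator_def)
    have "\<bar>expectation (f n)\<bar> \<le> expectation (\<lambda>\<omega>. e / 2 + K * ?I \<omega>)"
    proof (rule integral_abs_bound[THEN order_trans], rule integral_mono)
      show "integrable M (\<lambda>\<omega>. \<bar>f n \<omega>\<bar>)"
        by (intro integrable_const_bound[of _ K]) (auto simp: K)
      show "\<bar>f n \<omega>\<bar> \<le> e / 2 + K * ?I \<omega>" if "\<omega> \<in> space M" for \<omega>
        using that A(3)[of \<omega>] K[of n \<omega>] \<open>e > 0\<close> by (auto simp: indicator_def)
    qed (use Ii in auto)
    also have "\<dots> = e / 2 + K * prob (space M - A)"
      using Ii by (simp add: prob_space)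
    also have "\<dots> \<le> e / 2 + K * d"
      using A \<open>K \<ge> 0\<close> by (intro add_left_mono mult_left_mono) (auto simp: prob_compl)
    also have "\<dots> < e" using \<open>K * d < e / 2\<close> by simp
    finally show ?case by simp
  qed
qed

text \<open>Slutsky's lemma combined with the trigonometric criterion: \<open>X\<close> inherits the
  limits of the cosine integrals from \<open>Z\<close>, because the cosine is Lipschitz, and its
  tightness from the second moments of \<open>Z\<close>.\<close>

theorem tendsto_in_distr_trigI:
  fixes X Z :: "nat \<Rightarrow> 'a \<Rightarrow> 'b::euclidean_space"
  assumes [measurable]: "\<And>n. X n \<in> borel_measurable M" "\<And>n. Z n \<in> borel_measurable M"
    and XZ: "((\<lambda>(n, \<omega>). X n \<omega> - Z n \<omega>) \<longlongrightarrow> 0) in_prob"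
    and Z: "\<And>n. integrable M (\<lambda>\<omega>. (norm (Z n \<omega>))\<^sup>2)"
      "\<And>n. expectation (\<lambda>\<omega>. (norm (Z n \<omega>))\<^sup>2) \<le> C"
    and \<nu>: "prob_space \<nu>" "sets \<nu> = sets borel"
    and cos: "\<And>t c. (\<lambda>n. expectation (\<lambda>\<omega>. cos (t \<bullet> Z n \<omega> + c))) \<longlonglongrightarrow> (\<integral>x. cos (t \<bullet> x + c) \<partial>\<nu>)"
  shows "tendsto_in_distr M X \<nu>"
  unfolding tendsto_in_distr_def
proof (intro conjI allI impI)
  fix g :: "'b \<Rightarrow> real" assume g: "continuous_on UNIV g" "bounded (range g)"
  show "(\<lambda>n. \<integral>x. g x \<partial>distr M borel (X n)) \<longlonglongrightarrow> (\<integral>x. g x \<partial>\<nu>)"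
  proof (rule weak_convergence_trigI[OF _ _ \<nu> _ _ g])
    fix t :: 'b and c :: real
    have int: "integrable M (\<lambda>\<omega>. cos (t \<bullet> W n \<omega> + c))"
      if [measurable]: "\<And>n. W n \<in> borel_measurable M" for W n
      by (intro integrable_const_bound[of _ 1]) auto
    have "((\<lambda>(n, \<omega>). cos (t \<bullet> X n \<omega> + c) - cos (t \<bullet> Z n \<omega> + c)) \<longlongrightarrow> 0) in_prob"
    proof (rule Lim_null_comparison[OF always_eventually])
      show "((\<lambda>(n, \<omega>). norm t * norm (X n \<omega> - Z n \<omega>)) \<longlongrightarrow> 0) in_prob"
        using tendsto_mult_left[OF tendsto_norm[OF XZ], of "norm t"] by (simp add: split_def)
      have "\<bar>cos a - cos b\<bar> \<le> \<bar>a - b\<bar>" for a b :: real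
      proof -
        have "\<bar>cos a - cos b\<bar> = 2 * \<bar>sin ((a + b) / 2)\<bar> * \<bar>sin ((b - a) / 2)\<bar>"
          by (simp add: cos_diff_cos abs_mult)
        also have "\<dots> \<le> 2 * 1 * \<bar>(b - a) / 2\<bar>"
          by (intro mult_mono abs_sin_x_le_abs_x) auto
        finally show ?thesis by simp
      qed
      note lip = this
      have "\<bar>cos (t \<bullet> X n \<omega> + c) - cos (t \<bullet> Z n \<omega> + c)\<bar> \<le> norm t * norm (X n \<omega> - Z n \<omega>)" for n \<omega>
        using lip[of "t \<bullet> X n \<omega> + c" "t \<bullet> Z n \<omega> + c"] Cauchy_Schwarz_ineq2[of t "X n \<omega> - Z n \<omega>"]
        by (simp add: inner_diff_right)
      then show "\<forall>x. norm (case x of (n, \<omega>) \<Rightarrow> cos (t \<bullet> X n \<omega> + c) - cos (t \<bullet> Z n \<omega> + c))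
          \<le> (case x of (n, \<omega>) \<Rightarrow> norm t * norm (X n \<omega> - Z n \<omega>))"
        by auto
    qed
    then have "(\<lambda>n. expectation (\<lambda>\<omega>. cos (t \<bullet> X n \<omega> + c) - cos (t \<bullet> Z n \<omega> + c))) \<longlonglongrightarrow> 0"
    proof (rule tendsto_expectation_bounded[rotated 2])
      show "\<bar>cos (t \<bullet> X n \<omega> + c) - cos (t \<bullet> Z n \<omega> + c)\<bar> \<le> 2" for n \<omega>
        using abs_cos_le_one[of "t \<bullet> X n \<omega> + c"] abs_cos_le_one[of "t \<bullet> Z n \<omega> + c"] by linarith
    qed measurable
    from tendsto_add[OF this cos[of t c]]
    have "(\<lambda>n. expectation (\<lambda>\<omega>. cos (t \<bullet> X n \<omega> + c))) \<longlonglongrightarrow> (\<integral>x. cos (t \<bullet> x + c) \<partial>\<nu>)"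
      by (simp add: int)
    then show "(\<lambda>n. \<integral>x. cos (t \<bullet> x + c) \<partial>distr M borel (X n)) \<longlonglongrightarrow> (\<integral>x. cos (t \<bullet> x + c) \<partial>\<nu>)"
      by (simp add: integral_distr)
  next
    fix \<delta> :: real assume "\<delta> > 0"
    have "C \<ge> 0" using Z(2)[of 0] by (rule order_trans[rotated]) (simp add: integral_nonneg)
    define K where "K = sqrt (2 * (C + 1) / \<delta>)"
    have K: "K > 0" "C / K\<^sup>2 \<le> \<delta> / 2"
      using \<open>\<delta> > 0\<close> \<open>C \<ge> 0\<close> by (auto simp: K_def field_simps)
    have "\<forall>\<^sub>F n in sequentially. \<exists>A\<in>events. 1 - \<delta>/2 \<le> prob A \<and>
        (\<forall>\<omega>\<in>A. dist (case (n, \<omega>) of (n, \<omega>) \<Rightarrow> X n \<omega> - Z n \<omega>) 0 < 1)"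
      using tendstoD[OF XZ zero_less_one] half_gt_zero[OF \<open>\<delta> > 0\<close>] unfolding eventually_in_prob by blast
    \<comment> \<open>If \<open>norm (X n \<omega>) > K + 1\<close> and \<open>X n \<omega>\<close>
      is within 1 of \<open>Z n \<omega>\<close>, then \<open>norm (Z n \<omega>) > K\<close>, which
      Chebyshev's inequality controls.\<close>
    then have "\<forall>\<^sub>F n in sequentially. measure (distr M borel (X n)) {x. norm x > K + 1} \<le> \<delta>"
    proof eventually_elim
      case (elim n)
      then obtain A where A: "A \<in> events" "1 - \<delta>/2 \<le> prob A" "\<And>\<omega>. \<omega> \<in> A \<Longrightarrow> norm (X n \<omega> - Z n \<omega>) < 1"
        by auto
      let ?B = "{\<omega>\<in>space M. \<bar>norm (Z n \<omega>)\<bar> \<ge> K}"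
      have "prob ?B \<le> expectation (\<lambda>\<omega>. (norm (Z n \<omega>))\<^sup>2) / K\<^sup>2"
        using Z K by (intro second_moment_method) auto
      also have "\<dots> \<le> C / K\<^sup>2" by (intro divide_right_mono Z) auto
      also have "\<dots> \<le> \<delta>/2" by fact
      finally have B: "prob ?B \<le> \<delta>/2" .
      have "measure (distr M borel (X n)) {x. norm x > K + 1} = prob {\<omega>\<in>space M. norm (X n \<omega>) > K + 1}"
        by (subst measure_distr) (auto intro!: arg_cong[where f=prob])
      also have "\<dots> \<le> prob ((space M - A) \<union> ?B)"
      proof (intro finite_measure_mono subsetI)
        fix \<omega> assume \<omega>: "\<omega> \<in> {\<omega>\<in>space M. norm (X n \<omega>) > K + 1}"
        have "norm (X n \<omega>) \<le> norm (X n \<omega> - Z n \<omega>) + norm (Z n \<omega>)"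
          using norm_triangle_ineq[of "X n \<omega> - Z n \<omega>" "Z n \<omega>"] by simp
        then show "\<omega> \<in> (space M - A) \<union> ?B" using A(3)[of \<omega>] \<omega> by force
      qed (use A in auto)
      also have "\<dots> \<le> prob (space M - A) + prob ?B"
        using A by (intro measure_Un_le) auto
      also have "\<dots> \<le> \<delta>" using A B by (simp add: prob_compl)
      finally show ?case .
    qed
    then show "\<exists>L. \<forall>\<^sub>F n in sequentially. measure (distr M borel (X n)) {x. norm x > L} \<le> \<delta>" by blast
  qed (auto intro: prob_space_distr)
qed fact

end

section \<open>The bivariate normal law\<close>

lemma measurable_vector_2 [measurable (raw)]:
  fixes f g :: "'a \<Rightarrow> real"
  assumes [measurable]: "f \<in> borel_measurable M" "g \<in> borel_measurable M"
  shows "(\<lambda>x. vector [f x, g x] :: real^2) \<in> borel_measurable M"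
proof -
  have "(\<lambda>x. f x *\<^sub>R axis 1 1 + g x *\<^sub>R axis 2 1 :: real^2) \<in> borel_measurable M" by measurable
  also have "(\<lambda>x. f x *\<^sub>R axis 1 1 + g x *\<^sub>R axis 2 1 :: real^2) = (\<lambda>x. vector [f x, g x])"
    by (auto simp: vec_eq_iff forall_2 axis_def)
  finally show ?thesis .
qed

text \<open>Lebesgue measure is determined by the volumes of boxes. The identity reduces integrals
  over \<open>real^2\<close> to iterated ones.\<close>

lemma lborel_real_2:
  "(lborel :: (real^2) measure) = distr (lborel \<Otimes>\<^sub>M lborel) borel (\<lambda>(x, y). vector [x, y])"
proof (rule lborel_eqI)
  fix l u :: "real^2" assume lu: "\<And>b. b \<in> Basis \<Longrightarrow> l \<bullet> b \<le> u \<bullet> b"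
  have lu: "l $ i \<le> u $ i" for i
    using lu[of "axis i 1"] by (auto simp: inner_axis Basis_vec_def)
  have m: "(\<lambda>(x, y). vector [x, y] :: real^2) \<in> borel_measurable (lborel \<Otimes>\<^sub>M lborel)"
    by measurable
  have "(\<lambda>(x, y). vector [x, y]) -` box l u \<inter> space (lborel \<Otimes>\<^sub>M lborel) = {l$1<..<u$1} \<times> {l$2<..<u$2}"
    by (auto simp: mem_box_cart forall_2 space_pair_measure)
  then have "emeasure (distr (lborel \<Otimes>\<^sub>M lborel) borel (\<lambda>(x, y). vector [x, y])) (box l u)
      = emeasure (lborel \<Otimes>\<^sub>M lborel) ({l$1<..<u$1} \<times> {l$2<..<u$2})"
    using m by (subst emeasure_distr) auto
  also have "\<dots> = ennreal (u$1 - l$1) * ennreal (u$2 - l$2)"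
    using lu by (subst lborel.emeasure_pair_measure_Times) auto
  also have "\<dots> = ennreal (prod ((\<bullet>) (u - l)) Basis)"
    using lu by (simp add: Basis_vec_def prod.UNION_disjoint UNION_singleton_eq_range prod.reindex inj_on_def axis_eq_axis inner_axis UNIV_2 ennreal_mult mult.commute)
  finally show "emeasure (distr (lborel \<Otimes>\<^sub>M lborel) borel (\<lambda>(x, y). vector [x, y])) (box l u)
      = ennreal (prod ((\<bullet>) (u - l)) Basis)" .
qed simp

lemma measurable_matrix_vector_mult [measurable (raw)]:
  fixes A :: "real^'n^'m"
  assumes [measurable]: "f \<in> borel_measurable N'" shows "(\<lambda>x. A *v f x) \<in> borel_measurable N'"
proof -
  have "((*v) A) \<in> borel_measurable borel"
    by (intro borel_measurable_continuous_onI matrix_vector_mult_linear_continuous_on)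
  then show ?thesis using assms by (rule measurable_compose_rev)
qed

lemma matrix_inv_mult:
  fixes A :: "real^'n^'n"
  assumes "invertible A"
  shows "A ** matrix_inv A = mat 1" "matrix_inv A ** A = mat 1"
  using someI_ex[OF assms[unfolded invertible_def]] by (auto simp: matrix_inv_def)

lemma matrix_inv_matrix_inv:
  fixes A :: "real^'n^'n"
  assumes "invertible A" shows "matrix_inv (matrix_inv A) = A"
proof -
  have "invertible (matrix_inv A)" using matrix_inv_mult[OF assms] by (auto simp: invertible_def)
  from matrix_inv_mult(1)[OF this]
  have "A ** (matrix_inv A ** matrix_inv (matrix_inv A)) = A ** mat 1" by simp
  then show ?thesis unfolding matrix_mul_assoc matrix_inv_mult[OF assms] by simp
qed

lemma det_matrix_inv:
  fixes A :: "real^'n^'n"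
  assumes "invertible A" shows "det (matrix_inv A) = 1 / det A"
proof -
  have "det (matrix_inv A) * det A = 1" unfolding det_mul[symmetric] matrix_inv_mult[OF assms] by simp
  then show ?thesis using assms by (simp add: field_simps invertible_det_nz)
qed

text \<open>Completing the square: \<open>x \<bullet> A x = a (x\<^sub>1 + (b/a) x\<^sub>2)\<^sup>2 + (det A / a) x\<^sub>2\<^sup>2\<close>.\<close>

lemma multivariate_normal_2:
  fixes A :: "real^2^2"
  assumes sym: "A$2$1 = A$1$2" and a: "A$1$1 > 0" and det: "det A > 0"
  defines "r \<equiv> sqrt (A$1$1)" and "s \<equiv> sqrt (det A / A$1$1)" and "b \<equiv> A$1$2 / A$1$1"
  shows "multivariate_normal 0 (matrix_inv A)
    = distr (std_normal_distribution \<Otimes>\<^sub>M std_normal_distribution) borel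
        (\<lambda>(u, v). vector [- b * (v / s) + u / r, v / s])"
    (is "?L = distr ?P borel ?T")
proof (rule measure_eqI)
  show "sets ?L = sets (distr ?P borel ?T)" by (simp add: multivariate_normal_def)
next
  have inv: "invertible A" using det by (simp add: invertible_det_nz)
  have r: "r > 0" "r\<^sup>2 = A$1$1" and s: "s > 0" "s\<^sup>2 = det A / A$1$1" using a det by (auto simp: r_def s_def)
  have rs: "det A = (r * s)\<^sup>2" using a r s by (simp add: power_mult_distrib)
  \<comment> \<open>As \<open>r * s = sqrt (det A)\<close>, this is the normalizing constant for the
    covariance matrix \<open>matrix_inv A\<close>.\<close>
  define K where "K = r * s / (2 * pi)"
  have K: "exp (- ((x - 0) \<bullet> (matrix_inv (matrix_inv A) *v (x - 0))) / 2)
      / sqrt ((2 * pi) ^ CARD(2) * det (matrix_inv A)) = K * exp (- (x \<bullet> (A *v x)) / 2)" for x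
    using r(1) s(1) by (simp add: matrix_inv_matrix_inv[OF inv] det_matrix_inv[OF inv] K_def real_sqrt_divide
        rs real_sqrt_mult field_simps)
  have Q: "x \<bullet> (A *v x) = A$1$1 * (x$1 + b * x$2)\<^sup>2 + (det A / A$1$1) * (x$2)\<^sup>2" for x
    using a by (simp add: b_def inner_vec_def sum_2 matrix_vector_mult_def det_2 sym field_simps power2_eq_square)
  \<comment> \<open>In the new coordinates the quadratic form is u^2 + v^2; the factor
    \<open>r * s\<close> is cancelled below by the Jacobian of the substitution.\<close>
  have dens: "K * exp (- (vector [- b * (v / s) + u / r, v / s] \<bullet> (A *v vector [- b * (v / s) + u / r, v / s])) / 2)
      = r * s * (std_normal_density u * std_normal_density v)" for u v
  proof -
    have "vector [- b * (v / s) + u / r, v / s] \<bullet> (A *v vector [- b * (v / s) + u / r, v / s])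
        = r\<^sup>2 * (u / r)\<^sup>2 + s\<^sup>2 * (v / s)\<^sup>2"
      unfolding Q r(2) s(2) by simp
    also have "\<dots> = u\<^sup>2 + v\<^sup>2" using r(1) s(1) by (simp add: power_divide)
    finally show ?thesis
      by (simp add: K_def std_normal_density_def exp_add[symmetric] add_divide_distrib)
  qed
  interpret P: pair_sigma_finite std_normal_distribution std_normal_distribution
    by (intro pair_sigma_finite.intro prob_space_imp_sigma_finite prob_space_normal_density) simp_all
  fix X assume "X \<in> sets ?L"
  then have X[measurable]: "X \<in> sets borel" by (simp add: multivariate_normal_def)
  define F where "F = (\<lambda>x. ennreal (K * exp (- (x \<bullet> (A *v x)) / 2)) * indicator X x)"
  have [measurable]: "(\<lambda>x. x \<bullet> (A *v x)) \<in> borel_measurable borel"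
    by (intro borel_measurable_continuous_onI continuous_intros matrix_vector_mult_linear_continuous_on)
  have [measurable]: "F \<in> borel_measurable borel" unfolding F_def by measurable
  have "emeasure ?L X = (\<integral>\<^sup>+x. F x \<partial>lborel)"
    unfolding multivariate_normal_def K F_def by (subst emeasure_density) auto
  also have "\<dots> = (\<integral>\<^sup>+p. F (vector [fst p, snd p]) \<partial>(lborel \<Otimes>\<^sub>M lborel))"
    by (subst lborel_real_2, subst nn_integral_distr) (auto simp: split_def)
  also have "\<dots> = (\<integral>\<^sup>+y. \<integral>\<^sup>+x. F (vector [x, y]) \<partial>lborel \<partial>lborel)"
    by (subst lborel_pair.nn_integral_snd[symmetric]) auto
  \<comment> \<open>First the second coordinate is rescaled; then, for fixed \<open>v\<close>, the
    first one is shifted by \<open>- b * (v / s)\<close> and rescaled.\<close>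
  also have "\<dots> = ennreal (1 / s) * (\<integral>\<^sup>+v. \<integral>\<^sup>+x. F (vector [x, v / s]) \<partial>lborel \<partial>lborel)"
    using s by (subst nn_integral_real_affine[where c="1 / s" and t=0]) auto
  also have "\<dots> = ennreal (1 / s) * (\<integral>\<^sup>+v. ennreal (1 / r) * \<integral>\<^sup>+u. F (vector [- b * (v / s) + u / r, v / s]) \<partial>lborel \<partial>lborel)"
  proof (intro arg_cong[where f="(*) (ennreal (1 / s))"] nn_integral_cong)
    fix v :: real
    show "(\<integral>\<^sup>+x. F (vector [x, v / s]) \<partial>lborel)
        = ennreal (1 / r) * (\<integral>\<^sup>+u. F (vector [- b * (v / s) + u / r, v / s]) \<partial>lborel)"
      using r by (subst nn_integral_real_affine[where c="1 / r" and t="- b * (v / s)"]) auto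
  qed
  also have "\<dots> = (\<integral>\<^sup>+v. \<integral>\<^sup>+u. ennreal (1 / (r * s)) * F (vector [- b * (v / s) + u / r, v / s]) \<partial>lborel \<partial>lborel)"
    using r s by (simp add: nn_integral_cmult[symmetric] ennreal_mult''[symmetric] mult.assoc[symmetric] mult.commute)
  also have "\<dots> = (\<integral>\<^sup>+v. \<integral>\<^sup>+u. ennreal (std_normal_density v) * (ennreal (std_normal_density u) * indicator X (?T (u, v))) \<partial>lborel \<partial>lborel)"
    unfolding F_def dens using r s
    by (intro nn_integral_cong) (auto simp: indicator_def ennreal_mult''[symmetric] ennreal_mult[symmetric] mult.commute)
  also have "\<dots> = (\<integral>\<^sup>+v. \<integral>\<^sup>+u. indicator X (?T (u, v)) \<partial>std_normal_distribution \<partial>std_normal_distribution)"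
    by (simp add: nn_integral_density nn_integral_cmult)
  also have "\<dots> = (\<integral>\<^sup>+p. indicator X (?T p) \<partial>?P)"
    by (subst P.nn_integral_snd[symmetric]) auto
  also have "\<dots> = (\<integral>\<^sup>+x. indicator X x \<partial>distr ?P borel ?T)"
    by (rule nn_integral_distr[symmetric]) measurable
  also have "\<dots> = emeasure (distr ?P borel ?T) X"
    by (rule nn_integral_indicator) simp
  finally show "emeasure ?L X = emeasure (distr ?P borel ?T) X" .
qed

text \<open>Real and imaginary part of the characteristic function; the sine integral vanishes, so
  the phase \<open>e\<close> contributes only the factor \<open>cos e\<close>.\<close>

lemma integral_cos_std_normal:
  "(\<integral>u. cos (p * u + e) \<partial>std_normal_distribution) = exp (- p\<^sup>2 / 2) * cos e"
proof -
  interpret real_distribution std_normal_distribution by (rule real_dist_normal_dist)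
  have i: "integrable std_normal_distribution (\<lambda>u. f (p * u))" if "continuous_on UNIV f" "\<And>x. \<bar>f x\<bar> \<le> 1" for f :: "real \<Rightarrow> real"
    using that borel_measurable_continuous_onI[OF that(1)] by (intro integrable_const_bound[of _ 1]) auto
  have c: "integrable std_normal_distribution (\<lambda>u. cos (p * u))" "integrable std_normal_distribution (\<lambda>u. sin (p * u))"
    by (intro i; auto intro!: continuous_intros)+
  have "char std_normal_distribution p = of_real (exp (- p\<^sup>2 / 2))"
    by (simp add: char_std_normal_distribution)
  moreover have "char std_normal_distribution p
      = of_real (\<integral>u. cos (p * u) \<partial>std_normal_distribution) + \<i> * of_real (\<integral>u. sin (p * u) \<partial>std_normal_distribution)"
  proof -
    have "char std_normal_distribution p
        = (CLINT u|std_normal_distribution. of_real (cos (p * u)) + \<i> * of_real (sin (p * u)))"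
      unfolding char_def
      by (intro Bochner_Integration.integral_cong refl) (simp add: exp_Euler cos_of_real sin_of_real flip: of_real_mult)
    then show ?thesis using c by simp
  qed
  ultimately have "(\<integral>u. cos (p * u) \<partial>std_normal_distribution) = exp (- p\<^sup>2 / 2)" "(\<integral>u. sin (p * u) \<partial>std_normal_distribution) = 0"
    by (auto simp: complex_eq_iff)
  then show ?thesis using c by (simp add: cos_add)
qed

text \<open>Both claims are carried over from two independent standard normal variables: after the
  linear map the cosine integral is an iterated integral of the one-dimensional kind.\<close>

lemma
  fixes A :: "real^2^2"
  assumes sym: "A$2$1 = A$1$2" and a: "A$1$1 > 0" and det: "det A > 0"
  shows prob_space_multivariate_normal_2: "prob_space (multivariate_normal 0 (matrix_inv A))"
    and integral_cos_multivariate_normal_2: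
      "(\<integral>x. cos (t \<bullet> x + c) \<partial>multivariate_normal 0 (matrix_inv A))
        = exp (- (t \<bullet> (matrix_inv A *v t)) / 2) * cos c"
proof -
  define r s b where "r = sqrt (A$1$1)" and "s = sqrt (det A / A$1$1)" and "b = A$1$2 / A$1$1"
  have r: "r > 0" "r\<^sup>2 = A$1$1" and s: "s > 0" "s\<^sup>2 = det A / A$1$1" using a det by (auto simp: r_def s_def)
  let ?P = "std_normal_distribution \<Otimes>\<^sub>M std_normal_distribution"
  let ?T = "\<lambda>(u, v). vector [- b * (v / s) + u / r, v / s] :: real^2"
  have eq: "multivariate_normal 0 (matrix_inv A) = distr ?P borel ?T"
    using multivariate_normal_2[OF sym a det] by (simp add: r_def s_def b_def)
  interpret N: prob_space std_normal_distribution by (rule prob_space_normal_density) simp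
  interpret P: pair_prob_space std_normal_distribution std_normal_distribution ..
  have [measurable]: "?T \<in> borel_measurable ?P" by measurable
  show "prob_space (multivariate_normal 0 (matrix_inv A))"
    unfolding eq by (rule P.prob_space_distr) measurable
  define w where "w = matrix_inv A *v t"
  have inv: "invertible A" using det by (simp add: invertible_det_nz)
  have "A *v w = (A ** matrix_inv A) *v t" by (simp add: w_def matrix_vector_mul_assoc)
  then have t: "t = A *v w" using matrix_inv_mult[OF inv] by simp
  \<comment> \<open>The coefficients of \<open>u\<close> and \<open>v\<close> in
    \<open>t \<bullet> ?T (u, v)\<close>.\<close>
  define p q where "p = t$1 / r" and "q = (t$2 - b * t$1) / s"
  have "(\<integral>x. cos (t \<bullet> x + c) \<partial>multivariate_normal 0 (matrix_inv A))
      = (\<integral>z. cos (t \<bullet> ?T z + c) \<partial>?P)"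
    unfolding eq by (subst integral_distr) auto
  also have "\<dots> = (\<integral>z. (case z of (u, v) \<Rightarrow> cos (p * u + (q * v + c))) \<partial>?P)"
    by (intro Bochner_Integration.integral_cong refl arg_cong[where f=cos])
      (auto simp: p_def q_def inner_vec_def sum_2 diff_divide_distrib algebra_simps)
  also have "\<dots> = (\<integral>v. \<integral>u. cos (p * u + (q * v + c)) \<partial>std_normal_distribution \<partial>std_normal_distribution)"
    by (rule P.integral_snd[symmetric]) (auto intro!: P.integrable_const_bound[of _ 1])
  also have "\<dots> = exp (- p\<^sup>2 / 2) * exp (- q\<^sup>2 / 2) * cos c"
    by (simp add: integral_cos_std_normal)
  also have "\<dots> = exp (- (p\<^sup>2 + q\<^sup>2) / 2) * cos c"
    by (simp add: exp_add[symmetric] diff_divide_distrib add_divide_distrib)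
  also have "p\<^sup>2 + q\<^sup>2 = t \<bullet> w"
  proof -
    have "p\<^sup>2 = (t$1)\<^sup>2 / A$1$1" using r by (simp add: p_def power_divide)
    \<comment> \<open>From \<open>t = A *v w\<close> one gets
      \<open>t$2 - b * t$1 = (det A / A$1$1) * w$2\<close>, as elimination with \<open>b\<close>
      removes \<open>w$1\<close>.\<close>
    moreover have "q\<^sup>2 = (det A / A$1$1 * w$2)\<^sup>2 / (det A / A$1$1)"
      using a by (simp add: q_def power_divide s t b_def matrix_vector_mult_def sum_2 det_2 sym field_simps)
    moreover have "\<dots> = det A / A$1$1 * (w$2)\<^sup>2"
      using a det by (simp add: power2_eq_square)
    ultimately have pq: "p\<^sup>2 + q\<^sup>2 = (t$1)\<^sup>2 / A$1$1 + det A / A$1$1 * (w$2)\<^sup>2" by simp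
    show ?thesis
      unfolding pq using a by (simp add: t inner_vec_def matrix_vector_mult_def sum_2 det_2 sym field_simps power2_eq_square)
  qed
  finally show "(\<integral>x. cos (t \<bullet> x + c) \<partial>multivariate_normal 0 (matrix_inv A))
        = exp (- (t \<bullet> (matrix_inv A *v t)) / 2) * cos c"
    by (simp add: w_def)
qed

section \<open>The central limit theorem tested against cosines\<close>

context iid_sample
begin

text \<open>The standardized central limit theorem is tested against
  \<open>\<lambda>x. cos (\<sigma> * x + c)\<close>: the standard deviation moves into the
  frequency, and the limit is an integral under the standard normal law.\<close>

lemma tendsto_expectation_cos_sum:
  fixes g :: "real \<Rightarrow> real"
  assumes [measurable]: "g \<in> borel_measurable borel"
    and g2: "integrable N (\<lambda>y. (g y)\<^sup>2)" and g0: "(\<integral>y. g y \<partial>N) = 0" and V: "(\<integral>y. (g y)\<^sup>2 \<partial>N) > 0"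
  shows "(\<lambda>n. expectation (\<lambda>\<omega>. cos ((\<Sum>i<n. g (Y i \<omega>)) / sqrt (real n) + c)))
    \<longlonglongrightarrow> exp (- (\<integral>y. (g y)\<^sup>2 \<partial>N) / 2) * cos c"
proof -
  interpret N: prob_space N by (rule prob_space_N)
  define \<sigma> where "\<sigma> = sqrt (\<integral>y. (g y)\<^sup>2 \<partial>N)"
  have \<sigma>: "\<sigma> > 0" "\<sigma>\<^sup>2 = (\<integral>y. (g y)\<^sup>2 \<partial>N)" using V by (auto simp: \<sigma>_def)
  let ?S = "\<lambda>n \<omega>. (\<Sum>i<n. g (Y i \<omega>)) / sqrt (real n * \<sigma>\<^sup>2)"
  have ind: "indep_vars (\<lambda>_. borel) (\<lambda>i \<omega>. g (Y i \<omega>)) UNIV"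
    by (rule indep_vars_compose2[OF indep, of "\<lambda>_. g"]) simp
  have "weak_conv_m (\<lambda>n. distr M borel (?S n)) std_normal_distribution"
  proof (rule central_limit_theorem_zero_mean[OF ind])
    show "expectation (\<lambda>\<omega>. g (Y n \<omega>)) = 0" for n using g0 by (simp add: expectation_Y)
    then show "variance (\<lambda>\<omega>. g (Y n \<omega>)) = \<sigma>\<^sup>2" for n
      using expectation_Y[of "\<lambda>y. (g y)\<^sup>2"] \<sigma> by simp
    show "integrable M (\<lambda>\<omega>. (g (Y n \<omega>))\<^sup>2)" for n
      by (rule integrable_Y[OF _ g2]) simp
    show "distr M borel (\<lambda>\<omega>. g (Y n \<omega>)) = distr N borel g" for n
      unfolding distr_Y[of n, symmetric] by (subst distr_distr) (auto simp: comp_def)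
  qed fact
  then have "(\<lambda>n. \<integral>x. cos (\<sigma> * x + c) \<partial>distr M borel (?S n)) \<longlonglongrightarrow> (\<integral>x. cos (\<sigma> * x + c) \<partial>std_normal_distribution)"
    by (rule weak_conv_imp_integral_bdd_continuous_conv[rotated 2, where B=1])
      (auto intro!: real_dist_normal_dist)
  moreover have "(\<integral>x. cos (\<sigma> * x + c) \<partial>distr M borel (?S n))
      = expectation (\<lambda>\<omega>. cos ((\<Sum>i<n. g (Y i \<omega>)) / sqrt (real n) + c))" for n
    using \<sigma>(1) by (subst integral_distr) (auto simp: real_sqrt_mult)
  ultimately show ?thesis using \<sigma> by (simp add: integral_cos_std_normal)
qed

end

section \<open>The folded normal likelihood\<close>

text \<open>With a = (y - \<mu>)/\<sigma> and b = (y + \<mu>)/\<sigma> this is (phi(a) - phi(b)) /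
  (phi(a) + phi(b)), the only quotient of densities that the score involves.\<close>

definition tanh_term :: "real^2 \<Rightarrow> real \<Rightarrow> real" where
  "tanh_term \<theta> y = tanh (\<theta>$1 * y / \<theta>$2 ^ 2)"

text \<open>Agrees with the logarithm of the density for y \<ge> 0 and extends it smoothly to all
  \<open>y\<close>, so that bounds and derivatives need no case distinction on the sign of the
  observation.\<close>

definition log_dens :: "real^2 \<Rightarrow> real \<Rightarrow> real" where
  "log_dens \<theta> y = ln (2 / sqrt (2 * pi)) - ln (\<theta>$2) - (y\<^sup>2 + (\<theta>$1)\<^sup>2) / 2 / \<theta>$2 ^ 2
     + ln (cosh (\<theta>$1 * y / \<theta>$2 ^ 2))"

definition score1 :: "real^2 \<Rightarrow> real \<Rightarrow> real" where
  "score1 \<theta> y = (y * tanh_term \<theta> y - \<theta>$1) / \<theta>$2 ^ 2"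

text \<open>All quotients have the form \<open>x / \<theta>$2 ^ k\<close>, including \<open>k = 1\<close>, so that one rule on
  dependence on the parameter covers them.\<close>

definition score2 :: "real^2 \<Rightarrow> real \<Rightarrow> real" where
  "score2 \<theta> y = (y\<^sup>2 + (\<theta>$1)\<^sup>2 - 2 * \<theta>$1 * (y * tanh_term \<theta> y)) / \<theta>$2 ^ 3 - 1 / \<theta>$2 ^ 1"

text \<open>The second derivatives of \<open>log_dens\<close>. As tanh' = 1 - tanh^2, they are
  polynomials in y^2, \<mu>, 1/\<sigma> and y tanh(\<mu> y/\<sigma>^2).\<close>

definition hess11 :: "real^2 \<Rightarrow> real \<Rightarrow> real" where
  "hess11 \<theta> y = (y\<^sup>2 - (y * tanh_term \<theta> y)\<^sup>2) / \<theta>$2 ^ 4 - 1 / \<theta>$2 ^ 2"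

definition hess12 :: "real^2 \<Rightarrow> real \<Rightarrow> real" where
  "hess12 \<theta> y = 2 * (\<theta>$1 - y * tanh_term \<theta> y) / \<theta>$2 ^ 3
     - 2 * \<theta>$1 * (y\<^sup>2 - (y * tanh_term \<theta> y)\<^sup>2) / \<theta>$2 ^ 5"

definition hess22 :: "real^2 \<Rightarrow> real \<Rightarrow> real" where
  "hess22 \<theta> y = 1 / \<theta>$2 ^ 2 - 3 * (y\<^sup>2 + (\<theta>$1)\<^sup>2 - 2 * \<theta>$1 * (y * tanh_term \<theta> y)) / \<theta>$2 ^ 4
     + 4 * (\<theta>$1)\<^sup>2 * (y\<^sup>2 - (y * tanh_term \<theta> y)\<^sup>2) / \<theta>$2 ^ 6"

text \<open>Expanding the squares leaves a common Gaussian factor and the exponential of the cross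
  term with either sign; sum and difference then become cosh and sinh.\<close>

lemma std_normal_density_shift:
  assumes "\<sigma> > 0"
  shows "std_normal_density ((y - \<mu>) / \<sigma>) = 1 / sqrt (2 * pi) * exp (- ((y\<^sup>2 + \<mu>\<^sup>2) / 2 / \<sigma>\<^sup>2)) * exp (\<mu> * y / \<sigma>\<^sup>2)"
    and "std_normal_density ((y + \<mu>) / \<sigma>) = 1 / sqrt (2 * pi) * exp (- ((y\<^sup>2 + \<mu>\<^sup>2) / 2 / \<sigma>\<^sup>2)) * exp (- (\<mu> * y / \<sigma>\<^sup>2))"
proof -
  have "- ((y - \<mu>) / \<sigma>)\<^sup>2 / 2 = - ((y\<^sup>2 + \<mu>\<^sup>2) / 2 / \<sigma>\<^sup>2) + \<mu> * y / \<sigma>\<^sup>2"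
    using assms by (simp add: field_simps power2_eq_square)
  then show "std_normal_density ((y - \<mu>) / \<sigma>) = 1 / sqrt (2 * pi) * exp (- ((y\<^sup>2 + \<mu>\<^sup>2) / 2 / \<sigma>\<^sup>2)) * exp (\<mu> * y / \<sigma>\<^sup>2)"
    unfolding std_normal_density_def by (simp only: exp_add mult.assoc)
  have "- ((y + \<mu>) / \<sigma>)\<^sup>2 / 2 = - ((y\<^sup>2 + \<mu>\<^sup>2) / 2 / \<sigma>\<^sup>2) + - (\<mu> * y / \<sigma>\<^sup>2)"
    using assms by (simp add: field_simps power2_eq_square)
  then show "std_normal_density ((y + \<mu>) / \<sigma>) = 1 / sqrt (2 * pi) * exp (- ((y\<^sup>2 + \<mu>\<^sup>2) / 2 / \<sigma>\<^sup>2)) * exp (- (\<mu> * y / \<sigma>\<^sup>2))"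
    unfolding std_normal_density_def by (simp only: exp_add mult.assoc)
qed

text \<open>The 2 in the constant of \<open>log_dens\<close> arises because the two exponentials add
  up to 2 cosh. In this form a density ratio is the exponential of a difference.\<close>

lemma folded_normal_density_eq_exp:
  assumes "\<theta>$2 > 0" "y \<ge> 0"
  shows "folded_normal_density \<theta> y = exp (log_dens \<theta> y)"
proof -
  define K C H where "K = 2 / sqrt (2 * pi)" and "C = (y\<^sup>2 + (\<theta>$1)\<^sup>2) / 2 / (\<theta>$2)\<^sup>2"
    and "H = cosh (\<theta>$1 * y / (\<theta>$2)\<^sup>2)"
  have "K > 0" "H > 0" by (simp_all add: K_def H_def)
  have "log_dens \<theta> y = ln K - ln (\<theta>$2) + - C + ln H"
    by (simp add: log_dens_def K_def C_def H_def)
  then have "exp (log_dens \<theta> y) = K / \<theta>$2 * exp (- C) * H"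
    using \<open>K > 0\<close> \<open>H > 0\<close> assms(1) by (simp only: exp_add exp_diff exp_ln)
  note eq = this[unfolded K_def C_def H_def]
  show ?thesis
    unfolding eq using assms unfolding folded_normal_density_def std_normal_density_shift[OF assms(1)]
    by (simp add: cosh_def field_simps)
qed

lemma folded_normal_density_pos: "\<theta>$2 > 0 \<Longrightarrow> y \<ge> 0 \<Longrightarrow> folded_normal_density \<theta> y > 0"
  by (simp add: folded_normal_density_eq_exp)

lemma folded_normal_density_neg: "y < 0 \<Longrightarrow> folded_normal_density \<theta> y = 0"
  by (simp add: folded_normal_density_def)

lemma folded_normal_density_nonneg: "\<theta>$2 > 0 \<Longrightarrow> folded_normal_density \<theta> y \<ge> 0"
  using folded_normal_density_pos folded_normal_density_neg by (metis less_eq_real_def not_le)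

lemma measurable_folded_normal_density [measurable]: "folded_normal_density \<theta> \<in> borel_measurable borel"
  unfolding folded_normal_density_def[abs_def] by measurable

lemma ln_folded_normal_density:
  assumes "\<theta>$2 > 0" "y \<ge> 0"
  shows "ln (folded_normal_density \<theta> y) = log_dens \<theta> y"
  using assms by (simp add: folded_normal_density_eq_exp)

lemma normal_density_difference:
  assumes "\<theta>$2 > 0"
  shows "std_normal_density ((y - \<theta>$1) / \<theta>$2) - std_normal_density ((y + \<theta>$1) / \<theta>$2)
    = tanh_term \<theta> y * (std_normal_density ((y - \<theta>$1) / \<theta>$2) + std_normal_density ((y + \<theta>$1) / \<theta>$2))"
proof -
  define E where "E = exp (\<theta>$1 * y / (\<theta>$2)\<^sup>2)"
  have "E > 0" by (simp add: E_def)
  have "tanh_term \<theta> y = (E - inverse E) / (E + inverse E)"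
    by (simp add: tanh_term_def tanh_altdef E_def exp_minus)
  moreover have "E + inverse E > 0" using \<open>E > 0\<close> by (simp add: add_pos_pos)
  ultimately show ?thesis
    unfolding std_normal_density_shift[OF assms] exp_minus E_def[symmetric] by (simp add: field_simps)
qed

section \<open>Derivatives with respect to the parameter\<close>

lemma has_derivative_vec_nth [derivative_intros]: "((\<lambda>x. x $ i) has_derivative (\<lambda>h. h $ i)) F"
  by (rule bounded_linear_imp_has_derivative[OF bounded_linear_vec_nth])

lemma cosh_real_nz: "cosh (x::real) \<noteq> 0" using cosh_real_pos[of x] by linarith

lemma has_derivative_tanh_term:
  assumes "\<theta>$2 > 0"
  shows "((\<lambda>\<theta>. tanh_term \<theta> y) has_derivative
    (\<lambda>h. (1 - (tanh_term \<theta> y)\<^sup>2) * (y / \<theta>$2 ^ 2 * h$1 - 2 * \<theta>$1 * y / \<theta>$2 ^ 3 * h$2))) (at \<theta>)"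
proof -
  have "((\<lambda>\<theta>. \<theta>$1 * y / \<theta>$2 ^ 2) has_derivative
     (\<lambda>h. y / \<theta>$2 ^ 2 * h$1 - 2 * \<theta>$1 * y / \<theta>$2 ^ 3 * h$2)) (at \<theta>)"
    using assms by (auto intro!: derivative_eq_intros simp: fun_eq_iff field_simps power2_eq_square power3_eq_cube)
  moreover have "(tanh has_real_derivative 1 - (tanh z)\<^sup>2) (at z)" for z :: real
    by (auto intro!: derivative_eq_intros simp: cosh_real_nz)
  ultimately show ?thesis
    unfolding tanh_term_def using DERIV_compose_FDERIV by (simp add: mult.commute) blast
qed

lemma has_derivative_log_dens:
  assumes "\<theta>$2 > 0"
  shows "((\<lambda>\<theta>. log_dens \<theta> y) has_derivative (\<lambda>h. h$1 * score1 \<theta> y + h$2 * score2 \<theta> y)) (at \<theta>)"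
proof -
  have d: "((\<lambda>\<theta>. \<theta>$1 * y / \<theta>$2 ^ 2) has_derivative
     (\<lambda>h. y / \<theta>$2 ^ 2 * h$1 - 2 * \<theta>$1 * y / \<theta>$2 ^ 3 * h$2)) (at \<theta>)"
    using assms by (auto intro!: derivative_eq_intros simp: fun_eq_iff field_simps power2_eq_square power3_eq_cube)
  have "((\<lambda>x. ln (cosh x)) has_real_derivative tanh x) (at x)" for x :: real
    by (auto intro!: derivative_eq_intros simp: tanh_def cosh_real_pos cosh_real_nz field_simps)
  from DERIV_compose_FDERIV[OF this d]
  have 1: "((\<lambda>\<theta>. ln (cosh (\<theta>$1 * y / \<theta>$2 ^ 2))) has_derivative
     (\<lambda>h. (y / \<theta>$2 ^ 2 * h$1 - 2 * \<theta>$1 * y / \<theta>$2 ^ 3 * h$2) * tanh_term \<theta> y)) (at \<theta>)"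
    by (simp add: tanh_term_def)
  have 2: "((\<lambda>\<theta>. (y\<^sup>2 + (\<theta>$1)\<^sup>2) / 2 / \<theta>$2 ^ 2) has_derivative
     (\<lambda>h. \<theta>$1 / \<theta>$2 ^ 2 * h$1 - (y\<^sup>2 + (\<theta>$1)\<^sup>2) / \<theta>$2 ^ 3 * h$2)) (at \<theta>)"
    using assms by (auto intro!: derivative_eq_intros simp: fun_eq_iff field_simps power2_eq_square power3_eq_cube)
  have 3: "((\<lambda>\<theta>. ln (\<theta>$2)) has_derivative (\<lambda>h. h$2 / \<theta>$2)) (at \<theta>)"
    using assms by (auto intro!: derivative_eq_intros simp: field_simps)
  show ?thesis
    unfolding log_dens_def
    by (rule has_derivative_eq_rhs[OF has_derivative_add[OF has_derivative_diff[OF has_derivative_diff[OF has_derivative_const 3] 2] 1]])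
      (use assms in \<open>simp add: fun_eq_iff score1_def score2_def field_simps power2_eq_square power3_eq_cube\<close>)
qed

lemma has_derivative_inverse_power:
  fixes \<theta> :: "real^'n"
  assumes "\<theta>$i \<noteq> 0"
  shows "((\<lambda>\<theta>. (1 / \<theta>$i) ^ k) has_derivative (\<lambda>h. - (real k * (1 / \<theta>$i) ^ Suc k * h$i))) (at \<theta>)"
proof -
  have "((\<lambda>x. (1 / x) ^ k) has_real_derivative - (real k * (1 / \<theta>$i) ^ Suc k)) (at (\<theta>$i))"
  proof -
    have "((\<lambda>x. 1 / x) has_real_derivative - (1 / \<theta>$i)\<^sup>2) (at (\<theta>$i))"
      using assms by (auto intro!: derivative_eq_intros simp: power2_eq_square)
    from DERIV_power[OF this, of k] show ?thesis
      by (cases k) (simp_all add: power2_eq_square mult_ac)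
  qed
  from DERIV_compose_FDERIV[OF this has_derivative_vec_nth] show ?thesis
    by (simp add: mult.commute)
qed

lemma has_derivative_score:
  assumes "\<theta>$2 > 0"
  shows "((\<lambda>\<theta>. score1 \<theta> y) has_derivative (\<lambda>h. h$1 * hess11 \<theta> y + h$2 * hess12 \<theta> y)) (at \<theta>)"
    and "((\<lambda>\<theta>. score2 \<theta> y) has_derivative (\<lambda>h. h$1 * hess12 \<theta> y + h$2 * hess22 \<theta> y)) (at \<theta>)"
proof -
  \<comment> \<open>In terms of \<open>c\<close> and \<open>w\<close> all formulas become
    polynomial, so the two sides can be compared by expansion alone.\<close>
  define c where "c = 1 / \<theta>$2"
  define w where "w = y * tanh_term \<theta> y"
  have div: "x / z ^ k = x * (1 / z) ^ k" for x z :: real and k by (simp add: power_one_over)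
  have dw: "((\<lambda>\<theta>. y * tanh_term \<theta> y) has_derivative
      (\<lambda>h. (y\<^sup>2 - w\<^sup>2) * (c ^ 2 * h$1 - 2 * \<theta>$1 * c ^ 3 * h$2))) (at \<theta>)"
    by (rule has_derivative_eq_rhs[OF has_derivative_mult_right[OF has_derivative_tanh_term[OF assms]]])
      (unfold div c_def[symmetric], simp add: fun_eq_iff w_def algebra_simps power2_eq_square)
  have dc: "((\<lambda>\<theta>. (1 / \<theta>$2) ^ k) has_derivative (\<lambda>h. - (real k * c ^ Suc k * h$2))) (at \<theta>)" for k
    using has_derivative_inverse_power[of \<theta> 2 k] assms by (simp add: c_def)
  show "((\<lambda>\<theta>. score1 \<theta> y) has_derivative (\<lambda>h. h$1 * hess11 \<theta> y + h$2 * hess12 \<theta> y)) (at \<theta>)"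
    unfolding score1_def div
    by (rule has_derivative_eq_rhs, (rule dw dc derivative_intros)+)
      (unfold hess11_def hess12_def div c_def[symmetric] w_def[symmetric], simp add: fun_eq_iff algebra_simps eval_nat_numeral)
  show "((\<lambda>\<theta>. score2 \<theta> y) has_derivative (\<lambda>h. h$1 * hess12 \<theta> y + h$2 * hess22 \<theta> y)) (at \<theta>)"
    unfolding score2_def div
    by (rule has_derivative_eq_rhs, (rule dw dc derivative_intros)+)
      (unfold hess12_def hess22_def div c_def[symmetric] w_def[symmetric], simp add: fun_eq_iff algebra_simps eval_nat_numeral)
qed

lemma GDERIV_ln_folded_normal_density:
  assumes "\<theta>$2 > 0" "y \<ge> 0"
  shows "GDERIV (\<lambda>t. ln (folded_normal_density t y)) \<theta> :> vector [score1 \<theta> y, score2 \<theta> y]"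
proof -
  \<comment> \<open>The gradient depends on the function near \<theta> only, and the identity with
    \<open>log_dens\<close> holds on this open half-plane.\<close>
  have "open {t::real^2. t$2 > 0}" by (intro open_Collect_less continuous_intros)
  moreover have "(\<lambda>h. h \<bullet> vector [score1 \<theta> y, score2 \<theta> y]) = (\<lambda>h::real^2. h$1 * score1 \<theta> y + h$2 * score2 \<theta> y)"
    by (simp add: inner_vec_def sum_2)
  moreover have "((\<lambda>t. ln (folded_normal_density t y)) has_derivative
      (\<lambda>h. h$1 * score1 \<theta> y + h$2 * score2 \<theta> y)) (at \<theta>)"
    by (rule has_derivative_transform_within_open[OF has_derivative_log_dens[OF assms(1)] \<open>open _\<close>])
      (use assms in \<open>simp_all add: ln_folded_normal_density\<close>)
  ultimately show ?thesis by (simp add: gderiv_def)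
qed

lemma GDERIV_unique: "GDERIV f x :> D \<Longrightarrow> GDERIV f x :> E \<Longrightarrow> D = E"
  unfolding gderiv_def by (drule (1) has_derivative_unique) (metis inner_commute vector_eq_rdot)

lemma score_eq:
  assumes "\<theta>$2 > 0" "y \<ge> 0"
  shows "score \<theta> y = vector [score1 \<theta> y, score2 \<theta> y]"
  unfolding score_def
  using GDERIV_ln_folded_normal_density[OF assms] GDERIV_unique by (intro the_equality) auto

text \<open>With P and Q the two density values, aP - bQ = (y (P - Q) - \<mu> (P + Q)) / \<sigma>
  and a^2 P + b^2 Q = ((y^2 + \<mu>^2)(P + Q) - 2 \<mu> y (P - Q)) / \<sigma>^2; division by P + Q
  brings in the hyperbolic tangent.\<close>

lemma score_mu_eq:
  assumes "\<theta>$2 > 0" shows "score_mu (\<theta>$1) (\<theta>$2) y = score1 \<theta> y"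
  and "score_sigma (\<theta>$1) (\<theta>$2) y = score2 \<theta> y"
proof -
  define P Q where "P = std_normal_density ((y - \<theta>$1) / \<theta>$2)" and "Q = std_normal_density ((y + \<theta>$1) / \<theta>$2)"
  have pos: "P + Q > 0" by (auto simp: P_def Q_def intro!: add_pos_pos normal_density_pos)
  have t: "tanh_term \<theta> y = (P - Q) / (P + Q)"
    using normal_density_difference[OF assms, of y] pos unfolding P_def[symmetric] Q_def[symmetric]
    by (simp add: field_simps)
  show "score_mu (\<theta>$1) (\<theta>$2) y = score1 \<theta> y"
    unfolding score_mu_def score1_def Let_def P_def[symmetric] Q_def[symmetric] t
    using assms pos by (simp add: divide_simps) (simp add: algebra_simps power2_eq_square)
  show "score_sigma (\<theta>$1) (\<theta>$2) y = score2 \<theta> y"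
    unfolding score_sigma_def score2_def Let_def P_def[symmetric] Q_def[symmetric] t
    using assms pos by (simp add: divide_simps) (simp add: algebra_simps eval_nat_numeral)
qed

section \<open>Moments of the folded normal law\<close>

text \<open>The folded normal law is the law of \<open>\<bar>X\<bar>\<close> for a normal \<open>X\<close>: even functions keep
  their expectation, and odd functions do so after multiplication by the hyperbolic tangent, which is
  the conditional mean of the sign of \<open>X\<close> given \<open>\<bar>X\<bar>\<close>.\<close>

lemma folded_normal_integral:
  fixes g h :: "real \<Rightarrow> real"
  assumes \<theta>: "\<theta>$2 > 0" and [measurable]: "g \<in> borel_measurable borel" "h \<in> borel_measurable borel"
    and F: "integrable lborel (\<lambda>x. normal_density (\<theta>$1) (\<theta>$2) x * h x)"
    and gh: "\<And>y. y \<ge> 0 \<Longrightarrow> folded_normal_density \<theta> y * g y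
      = normal_density (\<theta>$1) (\<theta>$2) y * h y + normal_density (\<theta>$1) (\<theta>$2) (- y) * h (- y)"
  shows "integrable (folded_normal \<theta>) g"
    and "(\<integral>y. g y \<partial>folded_normal \<theta>) = (\<integral>x. normal_density (\<theta>$1) (\<theta>$2) x * h x \<partial>lborel)"
proof -
  define F where "F = (\<lambda>x. normal_density (\<theta>$1) (\<theta>$2) x * h x)"
  have [measurable]: "F \<in> borel_measurable borel" unfolding F_def by measurable
  have Fi: "integrable lborel F" using F by (simp add: F_def)
  have Fi2: "integrable lborel (\<lambda>x. F (- x))"
    using lborel_integrable_real_affine[OF Fi, of "-1" 0] by simp
  have i1: "integrable lborel (\<lambda>x. indicator {0..} x * F x)" "integrable lborel (\<lambda>x. indicator {..0} x * F x)"
    using integrable_mult_indicator[OF _ Fi] by simp_all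
  have i2: "integrable lborel (\<lambda>x. indicator {0..} x * F (- x))"
    using integrable_mult_indicator[OF _ Fi2] by simp
  have fg: "folded_normal_density \<theta> y * g y = indicator {0..} y * F y + indicator {0..} y * F (- y)" for y
    using gh[of y] by (cases "y \<ge> 0") (auto simp: F_def folded_normal_density_neg)
  have nn: "AE y in lborel. 0 \<le> folded_normal_density \<theta> y"
    using folded_normal_density_nonneg[OF \<theta>] by simp
  show "integrable (folded_normal \<theta>) g"
    unfolding folded_normal_def
    by (subst integrable_real_density) (use nn i1 i2 in \<open>auto simp: fg\<close>)
  have "(\<integral>y. g y \<partial>folded_normal \<theta>) = (\<integral>y. indicator {0..} y * F y + indicator {0..} y * F (- y) \<partial>lborel)"
    unfolding folded_normal_def by (subst integral_real_density) (use nn in \<open>auto simp: fg\<close>)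
  also have "\<dots> = (\<integral>y. indicator {0..} y * F y \<partial>lborel) + (\<integral>y. indicator {0..} y * F (- y) \<partial>lborel)"
    using i1 i2 by simp
  also have "(\<integral>y. indicator {0..} y * F (- y) \<partial>lborel) = (\<integral>y. indicator {..0} y * F y \<partial>lborel)"
    using lborel_integral_real_affine[of "-1" "\<lambda>y. indicator {..0} y * F y" 0] by (simp add: indicator_def)
  also have "(\<integral>y. indicator {0..} y * F y \<partial>lborel) + \<dots> = (\<integral>y. indicator {0..} y * F y + indicator {..0} y * F y \<partial>lborel)"
    using i1 by simp
  \<comment> \<open>The two half-lines overlap in 0 only, a null set.\<close>
  also have "\<dots> = (\<integral>y. F y \<partial>lborel)"
    by (intro integral_cong_AE) (use AE_lborel_singleton[of 0] in \<open>auto elim!: eventually_mono simp: indicator_def\<close>)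
  finally show "(\<integral>y. g y \<partial>folded_normal \<theta>) = (\<integral>x. normal_density (\<theta>$1) (\<theta>$2) x * h x \<partial>lborel)"
    by (simp add: F_def)
qed

lemma folded_normal_density_eq_normal:
  assumes "\<theta>$2 > 0" "y \<ge> 0"
  shows "folded_normal_density \<theta> y = normal_density (\<theta>$1) (\<theta>$2) y + normal_density (\<theta>$1) (\<theta>$2) (- y)"
    and "folded_normal_density \<theta> y * tanh_term \<theta> y
      = normal_density (\<theta>$1) (\<theta>$2) y - normal_density (\<theta>$1) (\<theta>$2) (- y)"
proof -
  have n: "normal_density (\<theta>$1) (\<theta>$2) x = 1 / \<theta>$2 * std_normal_density ((x - \<theta>$1) / \<theta>$2)" for x
    using assms(1) by (simp add: normal_density_def real_sqrt_mult power_divide mult_ac)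
  have "((- y - \<theta>$1) / \<theta>$2)\<^sup>2 = ((y + \<theta>$1) / \<theta>$2)\<^sup>2"
    by (simp add: power_divide power2_eq_square algebra_simps)
  then have m: "normal_density (\<theta>$1) (\<theta>$2) (- y) = 1 / \<theta>$2 * std_normal_density ((y + \<theta>$1) / \<theta>$2)"
    unfolding n std_normal_density_def by (simp only:)
  show "folded_normal_density \<theta> y = normal_density (\<theta>$1) (\<theta>$2) y + normal_density (\<theta>$1) (\<theta>$2) (- y)"
    unfolding m n[of y] folded_normal_density_def using assms by (simp add: distrib_left)
  show "folded_normal_density \<theta> y * tanh_term \<theta> y
      = normal_density (\<theta>$1) (\<theta>$2) y - normal_density (\<theta>$1) (\<theta>$2) (- y)"
    using normal_density_difference[OF assms(1), of y] assms
    unfolding m n[of y] folded_normal_density_def by (simp add: diff_divide_distrib[symmetric] mult.commute)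
qed

lemma measurable_tanh_real [measurable]: "(tanh :: real \<Rightarrow> real) \<in> borel_measurable borel"
  by (intro borel_measurable_continuous_onI continuous_intros) (simp add: cosh_real_nz)

lemma measurable_tanh_term [measurable]: "tanh_term \<theta> \<in> borel_measurable borel"
  unfolding tanh_term_def[abs_def] by measurable

lemma folded_normal_even_odd:
  fixes h :: "real \<Rightarrow> real"
  assumes \<theta>: "\<theta>$2 > 0" and [measurable]: "h \<in> borel_measurable borel"
    and F: "has_bochner_integral lborel (\<lambda>x. normal_density (\<theta>$1) (\<theta>$2) x * h x) c"
  shows folded_normal_even: "(\<And>y. h (- y) = h y) \<Longrightarrow> has_bochner_integral (folded_normal \<theta>) h c"
    and folded_normal_odd: "(\<And>y. h (- y) = - h y) \<Longrightarrow> has_bochner_integral (folded_normal \<theta>) (\<lambda>y. h y * tanh_term \<theta> y) c"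
proof -
  have Fi: "integrable lborel (\<lambda>x. normal_density (\<theta>$1) (\<theta>$2) x * h x)"
    and Fc: "(\<integral>x. normal_density (\<theta>$1) (\<theta>$2) x * h x \<partial>lborel) = c"
    using F by (auto simp: has_bochner_integral_iff)
  show "has_bochner_integral (folded_normal \<theta>) h c" if "\<And>y. h (- y) = h y"
    using folded_normal_integral[OF \<theta> _ _ Fi, of h] folded_normal_density_eq_normal(1)[OF \<theta>] Fc that
    by (simp add: has_bochner_integral_iff distrib_right)
  show "has_bochner_integral (folded_normal \<theta>) (\<lambda>y. h y * tanh_term \<theta> y) c" if "\<And>y. h (- y) = - h y"
  proof -
    have "folded_normal_density \<theta> y * (h y * tanh_term \<theta> y)
        = normal_density (\<theta>$1) (\<theta>$2) y * h y + normal_density (\<theta>$1) (\<theta>$2) (- y) * h (- y)" if "y \<ge> 0" for y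
    proof -
      have "folded_normal_density \<theta> y * (h y * tanh_term \<theta> y) = (folded_normal_density \<theta> y * tanh_term \<theta> y) * h y"
        by simp
      then show ?thesis unfolding folded_normal_density_eq_normal(2)[OF \<theta> that] \<open>\<And>y. h (- y) = - h y\<close>
        by (simp add: left_diff_distrib)
    qed
    then show ?thesis
      using folded_normal_integral[OF \<theta> _ _ Fi, of "\<lambda>y. h y * tanh_term \<theta> y"] Fc
      by (simp add: has_bochner_integral_iff)
  qed
qed

lemma integrable_normal_power:
  assumes "\<sigma> > 0"
  shows "integrable lborel (\<lambda>x. normal_density \<mu> \<sigma> x * x ^ k)"
proof -
  have "normal_density \<mu> \<sigma> x * x ^ k
      = (\<Sum>j\<le>k. (real (k choose j) * \<mu> ^ (k - j)) * (normal_density \<mu> \<sigma> x * (x - \<mu>) ^ j))" for x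
    using binomial_ring[of "x - \<mu>" \<mu> k] by (simp add: sum_distrib_left mult_ac)
  then show ?thesis
    using integrable_normal_moment[OF assms, of \<mu>] by (simp add: Bochner_Integration.integrable_sum)
qed

lemma normal_raw_moments:
  assumes \<sigma>: "\<sigma> > 0"
  shows "has_bochner_integral lborel (\<lambda>x. normal_density \<mu> \<sigma> x * x) \<mu>"
    and "has_bochner_integral lborel (\<lambda>x. normal_density \<mu> \<sigma> x * x ^ 2) (\<mu>\<^sup>2 + \<sigma>\<^sup>2)"
    and "has_bochner_integral lborel (\<lambda>x. normal_density \<mu> \<sigma> x * x ^ 3) (\<mu> ^ 3 + 3 * \<mu> * \<sigma>\<^sup>2)"
    and "has_bochner_integral lborel (\<lambda>x. normal_density \<mu> \<sigma> x * x ^ 4) (\<mu> ^ 4 + 6 * \<mu>\<^sup>2 * \<sigma>\<^sup>2 + 3 * \<sigma> ^ 4)"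
proof -
  let ?m = "\<lambda>k x. normal_density \<mu> \<sigma> x * (x - \<mu>) ^ k"
  have m: "has_bochner_integral lborel (?m 0) 1" "has_bochner_integral lborel (?m 1) 0"
    "has_bochner_integral lborel (?m 2) (\<sigma>\<^sup>2)" "has_bochner_integral lborel (?m 3) 0"
    "has_bochner_integral lborel (?m 4) (3 * \<sigma> ^ 4)"
    using normal_moment_even[OF \<sigma>, of \<mu> 0] normal_moment_odd[OF \<sigma>, of \<mu> 0] normal_moment_even[OF \<sigma>, of \<mu> 1]
      normal_moment_odd[OF \<sigma>, of \<mu> 1] normal_moment_even[OF \<sigma>, of \<mu> 2]
    by (simp_all add: fact_numeral power_divide power2_eq_square eval_nat_numeral)
  show "has_bochner_integral lborel (\<lambda>x. normal_density \<mu> \<sigma> x * x) \<mu>"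
    by (rule normal_moment_nz_1[OF \<sigma>])
  have "has_bochner_integral lborel (\<lambda>x. ?m 2 x + (2 * \<mu>) * ?m 1 x + \<mu>\<^sup>2 * ?m 0 x) (\<sigma>\<^sup>2 + (2 * \<mu>) * 0 + \<mu>\<^sup>2 * 1)"
    by (intro has_bochner_integral_add has_bochner_integral_mult_right m)
  then show "has_bochner_integral lborel (\<lambda>x. normal_density \<mu> \<sigma> x * x ^ 2) (\<mu>\<^sup>2 + \<sigma>\<^sup>2)"
    by (rule has_bochner_integral_cong[THEN iffD1, rotated -1]) (auto simp: algebra_simps eval_nat_numeral)
  have "has_bochner_integral lborel (\<lambda>x. ?m 3 x + (3 * \<mu>) * ?m 2 x + (3 * \<mu>\<^sup>2) * ?m 1 x + \<mu> ^ 3 * ?m 0 x)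
      (0 + (3 * \<mu>) * \<sigma>\<^sup>2 + (3 * \<mu>\<^sup>2) * 0 + \<mu> ^ 3 * 1)"
    by (intro has_bochner_integral_add has_bochner_integral_mult_right m)
  then show "has_bochner_integral lborel (\<lambda>x. normal_density \<mu> \<sigma> x * x ^ 3) (\<mu> ^ 3 + 3 * \<mu> * \<sigma>\<^sup>2)"
    by (rule has_bochner_integral_cong[THEN iffD1, rotated -1]) (auto simp: algebra_simps eval_nat_numeral)
  have "has_bochner_integral lborel (\<lambda>x. ?m 4 x + (4 * \<mu>) * ?m 3 x + (6 * \<mu>\<^sup>2) * ?m 2 x + (4 * \<mu> ^ 3) * ?m 1 x + \<mu> ^ 4 * ?m 0 x)
      (3 * \<sigma> ^ 4 + (4 * \<mu>) * 0 + (6 * \<mu>\<^sup>2) * \<sigma>\<^sup>2 + (4 * \<mu> ^ 3) * 0 + \<mu> ^ 4 * 1)"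
    by (intro has_bochner_integral_add has_bochner_integral_mult_right m)
  then show "has_bochner_integral lborel (\<lambda>x. normal_density \<mu> \<sigma> x * x ^ 4) (\<mu> ^ 4 + 6 * \<mu>\<^sup>2 * \<sigma>\<^sup>2 + 3 * \<sigma> ^ 4)"
    by (rule has_bochner_integral_cong[THEN iffD1, rotated -1]) (auto simp: algebra_simps eval_nat_numeral)
qed

text \<open>For a normal \<open>X\<close> these are E X^2, E X^4, E X and E X^3; the odd ones
  survive the folding through the factor tanh.\<close>

lemma folded_normal_moments:
  assumes \<theta>: "\<theta>$2 > 0"
  shows "has_bochner_integral (folded_normal \<theta>) (\<lambda>y. y\<^sup>2) ((\<theta>$1)\<^sup>2 + (\<theta>$2)\<^sup>2)"
    and "has_bochner_integral (folded_normal \<theta>) (\<lambda>y. y ^ 4) (\<theta>$1 ^ 4 + 6 * (\<theta>$1)\<^sup>2 * (\<theta>$2)\<^sup>2 + 3 * \<theta>$2 ^ 4)"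
    and "has_bochner_integral (folded_normal \<theta>) (\<lambda>y. y * tanh_term \<theta> y) (\<theta>$1)"
    and "has_bochner_integral (folded_normal \<theta>) (\<lambda>y. y ^ 3 * tanh_term \<theta> y) (\<theta>$1 ^ 3 + 3 * \<theta>$1 * (\<theta>$2)\<^sup>2)"
  by (intro folded_normal_even folded_normal_odd normal_raw_moments \<theta>; simp)+

lemma prob_space_folded_normal:
  assumes \<theta>: "\<theta>$2 > 0" shows "prob_space (folded_normal \<theta>)"
proof -
  have "has_bochner_integral lborel (\<lambda>x. normal_density (\<theta>$1) (\<theta>$2) x * 1) 1"
    using normal_moment_even[OF \<theta>, of "\<theta>$1" 0] by simp
  then have "has_bochner_integral (folded_normal \<theta>) (\<lambda>_. 1) (1::real)"
    by (intro folded_normal_even \<theta>) auto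
  then have "(\<integral>\<^sup>+y. ennreal 1 \<partial>folded_normal \<theta>) = ennreal 1"
    by (subst nn_integral_eq_integral) (auto simp: has_bochner_integral_iff)
  then show ?thesis by (intro prob_spaceI) simp
qed

lemma sets_folded_normal [simp, measurable_cong]: "sets (folded_normal \<theta>) = sets borel"
  by (simp add: folded_normal_def)

lemma space_folded_normal [simp]: "space (folded_normal \<theta>) = UNIV"
  by (simp add: folded_normal_def)

lemma integrable_folded_normal_weight:
  assumes \<theta>: "\<theta>$2 > 0" shows "integrable (folded_normal \<theta>) (\<lambda>y. (1 + y\<^sup>2) ^ k)"
proof -
  have "integrable (folded_normal \<theta>) (\<lambda>y. y ^ (2 * j))" for j
  proof -
    have "has_bochner_integral (folded_normal \<theta>) (\<lambda>y. y ^ (2 * j))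
        (\<integral>x. normal_density (\<theta>$1) (\<theta>$2) x * x ^ (2 * j) \<partial>lborel)"
      using integrable_normal_power[OF \<theta>]
      by (intro folded_normal_even \<theta>) (auto simp: has_bochner_integral_iff)
    then show ?thesis by (rule integrable.intros)
  qed
  moreover have "(1 + y\<^sup>2) ^ k = (\<Sum>j\<le>k. real (k choose j) * y ^ (2 * (k - j)))" for y :: real
    using binomial_ring[of 1 "y\<^sup>2" k] by (simp add: power_mult)
  ultimately show ?thesis by (simp add: Bochner_Integration.integrable_sum)
qed

lemma integrable_folded_normal_bounded:
  fixes g :: "real \<Rightarrow> real"
  assumes \<theta>: "\<theta>$2 > 0" and [measurable]: "g \<in> borel_measurable borel"
    and g: "\<And>y. \<bar>g y\<bar> \<le> C * (1 + y\<^sup>2) ^ k"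
  shows "integrable (folded_normal \<theta>) g" "integrable (folded_normal \<theta>) (\<lambda>y. (g y)\<^sup>2)"
proof -
  have int: "integrable (folded_normal \<theta>) (\<lambda>y. D * (1 + y\<^sup>2) ^ j)" for D j
    using integrable_folded_normal_weight[OF \<theta>, of j] by simp
  show "integrable (folded_normal \<theta>) g"
    by (rule Bochner_Integration.integrable_bound[OF int]) (auto intro: order_trans[OF g] abs_ge_self)
  have "(g y)\<^sup>2 \<le> C\<^sup>2 * (1 + y\<^sup>2) ^ (2 * k)" for y
    using power_mono[OF g[of y], of 2] by (simp add: power_mult_distrib power_mult power_commutes power2_eq_square power_add mult_2 mult_ac)
  then show "integrable (folded_normal \<theta>) (\<lambda>y. (g y)\<^sup>2)"
    by (intro Bochner_Integration.integrable_bound[OF int]) (auto intro: order_trans abs_ge_self)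
qed

text \<open>Change of measure with the likelihood ratio as density; \<open>D\<close> is prescribed
  on the support only.\<close>

lemma folded_normal_change_density:
  fixes g :: "real \<Rightarrow> real"
  assumes \<theta>: "\<theta>$2 > 0" and \<eta>: "\<eta>$2 > 0" and [measurable]: "g \<in> borel_measurable borel"
    and D: "D \<in> borel_measurable borel" "\<And>y. y \<ge> 0 \<Longrightarrow> D y = exp (log_dens \<eta> y - log_dens \<theta> y)"
    and g: "has_bochner_integral (folded_normal \<eta>) g c"
  shows "has_bochner_integral (folded_normal \<theta>) (\<lambda>y. g y * D y) c"
proof -
  note [measurable] = D(1)
  have eq: "folded_normal_density \<theta> y * (g y * D y) = folded_normal_density \<eta> y * g y" for y
  proof (cases "y \<ge> 0")
    case True
    then show ?thesis
      using \<theta> \<eta> by (simp add: folded_normal_density_eq_exp D(2) exp_diff)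
  qed (simp add: folded_normal_density_neg)
  show ?thesis
    using g unfolding folded_normal_def has_bochner_integral_iff
    using folded_normal_density_nonneg[OF \<theta>] folded_normal_density_nonneg[OF \<eta>]
    by (simp add: integrable_real_density integral_real_density eq)
qed

lemma AE_folded_normal_nonneg: "AE y in folded_normal \<theta>. y \<ge> 0"
  unfolding folded_normal_def
  by (subst AE_density) (auto simp: folded_normal_density_def indicator_def)

section \<open>Lipschitz dependence on the parameter\<close>

text \<open>One envelope of polynomial growth, uniform in the parameter, serves both as bound and as
  Lipschitz constant. Since \<open>1 + y\<^sup>2 \<ge> 1\<close>, the weights increase with the
  exponent and the class is closed under sums and products, so membership of the model functions
  follows their syntax.\<close>

definition poly_lip :: "(real^2) set \<Rightarrow> (real^2 \<Rightarrow> real \<Rightarrow> real) \<Rightarrow> bool" where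
  "poly_lip S g \<longleftrightarrow> (\<forall>\<theta>\<in>S. g \<theta> \<in> borel_measurable borel) \<and>
     (\<exists>C\<ge>0. \<exists>k. \<forall>y. \<forall>\<theta>\<in>S. \<bar>g \<theta> y\<bar> \<le> C * (1 + y\<^sup>2) ^ k \<and>
        (\<forall>\<theta>'\<in>S. \<bar>g \<theta> y - g \<theta>' y\<bar> \<le> C * (1 + y\<^sup>2) ^ k * norm (\<theta> - \<theta>')))"

lemma poly_lipI:
  assumes "\<And>\<theta>. \<theta> \<in> S \<Longrightarrow> g \<theta> \<in> borel_measurable borel" "C \<ge> 0"
    "\<And>\<theta> y. \<theta> \<in> S \<Longrightarrow> \<bar>g \<theta> y\<bar> \<le> C * (1 + y\<^sup>2) ^ k"
    "\<And>\<theta> \<theta>' y. \<theta> \<in> S \<Longrightarrow> \<theta>' \<in> S \<Longrightarrow> \<bar>g \<theta> y - g \<theta>' y\<bar> \<le> C * (1 + y\<^sup>2) ^ k * norm (\<theta> - \<theta>')"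
  shows "poly_lip S g"
  unfolding poly_lip_def using assms by blast

lemma poly_lipE:
  assumes "poly_lip S g"
  obtains C k where "C \<ge> 0" "\<And>\<theta> y. \<theta> \<in> S \<Longrightarrow> \<bar>g \<theta> y\<bar> \<le> C * (1 + y\<^sup>2) ^ k"
    "\<And>\<theta> \<theta>' y. \<theta> \<in> S \<Longrightarrow> \<theta>' \<in> S \<Longrightarrow> \<bar>g \<theta> y - g \<theta>' y\<bar> \<le> C * (1 + y\<^sup>2) ^ k * norm (\<theta> - \<theta>')"
  using assms unfolding poly_lip_def by blast

lemma poly_lip_measurable: "poly_lip S g \<Longrightarrow> \<theta> \<in> S \<Longrightarrow> g \<theta> \<in> borel_measurable borel"
  unfolding poly_lip_def by blast

lemma weight_mono:
  fixes y :: real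
  assumes "0 \<le> C" "C \<le> D" "k \<le> l"
  shows "C * (1 + y\<^sup>2) ^ k \<le> D * (1 + y\<^sup>2) ^ l"
  using assms by (intro mult_mono power_increasing) auto

lemma poly_lip_add:
  assumes g: "poly_lip S g" and h: "poly_lip S h"
  shows "poly_lip S (\<lambda>\<theta> y. g \<theta> y + h \<theta> y)"
proof -
  obtain C k where C: "C \<ge> 0" "\<And>\<theta> y. \<theta> \<in> S \<Longrightarrow> \<bar>g \<theta> y\<bar> \<le> C * (1 + y\<^sup>2) ^ k"
    "\<And>\<theta> \<theta>' y. \<theta> \<in> S \<Longrightarrow> \<theta>' \<in> S \<Longrightarrow> \<bar>g \<theta> y - g \<theta>' y\<bar> \<le> C * (1 + y\<^sup>2) ^ k * norm (\<theta> - \<theta>')"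
    using poly_lipE[OF g] by metis
  obtain D l where D: "D \<ge> 0" "\<And>\<theta> y. \<theta> \<in> S \<Longrightarrow> \<bar>h \<theta> y\<bar> \<le> D * (1 + y\<^sup>2) ^ l"
    "\<And>\<theta> \<theta>' y. \<theta> \<in> S \<Longrightarrow> \<theta>' \<in> S \<Longrightarrow> \<bar>h \<theta> y - h \<theta>' y\<bar> \<le> D * (1 + y\<^sup>2) ^ l * norm (\<theta> - \<theta>')"
    using poly_lipE[OF h] by metis
  have w: "C * (1 + y\<^sup>2) ^ k + D * (1 + y\<^sup>2) ^ l \<le> (C + D) * (1 + y\<^sup>2) ^ (k + l)" for y :: real
    using weight_mono[OF C(1) order_refl, of k "k + l" y] weight_mono[OF D(1) order_refl, of l "k + l" y]
    by (simp add: distrib_right)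
  show ?thesis
  proof (rule poly_lipI)
    fix \<theta> \<theta>' and y :: real assume \<theta>: "\<theta> \<in> S"
    show "(\<lambda>y. g \<theta> y + h \<theta> y) \<in> borel_measurable borel"
      using poly_lip_measurable[OF g \<theta>] poly_lip_measurable[OF h \<theta>] by measurable
    show "\<bar>g \<theta> y + h \<theta> y\<bar> \<le> (C + D) * (1 + y\<^sup>2) ^ (k + l)"
      using C(2)[OF \<theta>, of y] D(2)[OF \<theta>, of y] w[of y] by linarith
    assume \<theta>': "\<theta>' \<in> S"
    have "\<bar>(g \<theta> y + h \<theta> y) - (g \<theta>' y + h \<theta>' y)\<bar> \<le> (C * (1 + y\<^sup>2) ^ k + D * (1 + y\<^sup>2) ^ l) * norm (\<theta> - \<theta>')"
      using C(3)[OF \<theta> \<theta>', of y] D(3)[OF \<theta> \<theta>', of y] by (simp add: distrib_right)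
    also have "\<dots> \<le> (C + D) * (1 + y\<^sup>2) ^ (k + l) * norm (\<theta> - \<theta>')"
      by (intro mult_right_mono w) auto
    finally show "\<bar>(g \<theta> y + h \<theta> y) - (g \<theta>' y + h \<theta>' y)\<bar> \<le> \<dots>" .
  qed (use C D in auto)
qed

lemma poly_lip_mult:
  assumes g: "poly_lip S g" and h: "poly_lip S h"
  shows "poly_lip S (\<lambda>\<theta> y. g \<theta> y * h \<theta> y)"
proof -
  obtain C k where C: "C \<ge> 0" "\<And>\<theta> y. \<theta> \<in> S \<Longrightarrow> \<bar>g \<theta> y\<bar> \<le> C * (1 + y\<^sup>2) ^ k"
    "\<And>\<theta> \<theta>' y. \<theta> \<in> S \<Longrightarrow> \<theta>' \<in> S \<Longrightarrow> \<bar>g \<theta> y - g \<theta>' y\<bar> \<le> C * (1 + y\<^sup>2) ^ k * norm (\<theta> - \<theta>')"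
    using poly_lipE[OF g] by metis
  obtain D l where D: "D \<ge> 0" "\<And>\<theta> y. \<theta> \<in> S \<Longrightarrow> \<bar>h \<theta> y\<bar> \<le> D * (1 + y\<^sup>2) ^ l"
    "\<And>\<theta> \<theta>' y. \<theta> \<in> S \<Longrightarrow> \<theta>' \<in> S \<Longrightarrow> \<bar>h \<theta> y - h \<theta>' y\<bar> \<le> D * (1 + y\<^sup>2) ^ l * norm (\<theta> - \<theta>')"
    using poly_lipE[OF h] by metis
  show ?thesis
  proof (rule poly_lipI)
    fix \<theta> \<theta>' and y :: real assume \<theta>: "\<theta> \<in> S"
    let ?w = "1 + y\<^sup>2" let ?n = "norm (\<theta> - \<theta>')"
    show "(\<lambda>y. g \<theta> y * h \<theta> y) \<in> borel_measurable borel"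
      using poly_lip_measurable[OF g \<theta>] poly_lip_measurable[OF h \<theta>] by measurable
    have "\<bar>g \<theta> y * h \<theta> y\<bar> \<le> (C * ?w ^ k) * (D * ?w ^ l)"
      unfolding abs_mult using C(1) by (intro mult_mono C(2) D(2) \<theta>) auto
    also have "\<dots> = (C * D) * ?w ^ (k + l)" by (simp add: power_add)
    \<comment> \<open>The difference of two products gives two terms, each with constant
      \<open>C * D\<close>; the bound has to share the resulting constant, hence the factor
      2.\<close>
    also have "\<dots> \<le> (2 * (C * D)) * ?w ^ (k + l)"
      using C D by (intro weight_mono) auto
    finally show "\<bar>g \<theta> y * h \<theta> y\<bar> \<le> \<dots>" .
    assume \<theta>': "\<theta>' \<in> S"
    have "g \<theta> y * h \<theta> y - g \<theta>' y * h \<theta>' y = g \<theta> y * (h \<theta> y - h \<theta>' y) + (g \<theta> y - g \<theta>' y) * h \<theta>' y"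
      by (simp add: algebra_simps)
    then have "\<bar>g \<theta> y * h \<theta> y - g \<theta>' y * h \<theta>' y\<bar> \<le> \<bar>g \<theta> y\<bar> * \<bar>h \<theta> y - h \<theta>' y\<bar> + \<bar>g \<theta> y - g \<theta>' y\<bar> * \<bar>h \<theta>' y\<bar>"
      using abs_triangle_ineq[of "g \<theta> y * (h \<theta> y - h \<theta>' y)" "(g \<theta> y - g \<theta>' y) * h \<theta>' y"] by (simp add: abs_mult)
    also have "\<dots> \<le> (C * ?w ^ k) * (D * ?w ^ l * ?n) + (C * ?w ^ k * ?n) * (D * ?w ^ l)"
      using C(1) D(1) by (intro add_mono mult_mono C(2,3) D(2,3) \<theta> \<theta>') auto
    also have "\<dots> = (2 * (C * D)) * ?w ^ (k + l) * ?n"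
      by (simp add: power_add)
    finally show "\<bar>g \<theta> y * h \<theta> y - g \<theta>' y * h \<theta>' y\<bar> \<le> \<dots>" .
  qed (use C D in auto)
qed

text \<open>Made for \<open>tanh\<close> and \<open>\<lambda>x. ln (cosh x)\<close>. Vanishing at 0
  turns the Lipschitz property of \<phi> into a bound on the composition.\<close>

lemma poly_lip_compose:
  fixes \<phi> :: "real \<Rightarrow> real"
  assumes g: "poly_lip S g" and \<phi>: "\<And>a b. \<bar>\<phi> a - \<phi> b\<bar> \<le> \<bar>a - b\<bar>" "\<phi> 0 = 0"
    and [measurable]: "\<phi> \<in> borel_measurable borel"
  shows "poly_lip S (\<lambda>\<theta> y. \<phi> (g \<theta> y))"
proof -
  obtain C k where C: "C \<ge> 0" "\<And>\<theta> y. \<theta> \<in> S \<Longrightarrow> \<bar>g \<theta> y\<bar> \<le> C * (1 + y\<^sup>2) ^ k"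
    "\<And>\<theta> \<theta>' y. \<theta> \<in> S \<Longrightarrow> \<theta>' \<in> S \<Longrightarrow> \<bar>g \<theta> y - g \<theta>' y\<bar> \<le> C * (1 + y\<^sup>2) ^ k * norm (\<theta> - \<theta>')"
    using poly_lipE[OF g] by metis
  show ?thesis
  proof (rule poly_lipI[OF _ C(1)])
    fix \<theta> \<theta>' and y :: real assume \<theta>: "\<theta> \<in> S"
    show "(\<lambda>y. \<phi> (g \<theta> y)) \<in> borel_measurable borel"
      using poly_lip_measurable[OF g \<theta>] by measurable
    show "\<bar>\<phi> (g \<theta> y)\<bar> \<le> C * (1 + y\<^sup>2) ^ k"
      using \<phi>(1)[of "g \<theta> y" 0] \<phi>(2) C(2)[OF \<theta>, of y] by simp
    assume \<theta>': "\<theta>' \<in> S"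
    show "\<bar>\<phi> (g \<theta> y) - \<phi> (g \<theta>' y)\<bar> \<le> C * (1 + y\<^sup>2) ^ k * norm (\<theta> - \<theta>')"
      using \<phi>(1) C(3)[OF \<theta> \<theta>'] by (rule order_trans)
  qed
qed

lemma poly_lip_arg: "poly_lip S (\<lambda>\<theta> y. y)"
proof (rule poly_lipI[where C=1 and k=1])
  show "\<bar>y\<bar> \<le> 1 * (1 + y\<^sup>2) ^ 1" for y :: real
    using sum_squares_bound[of "\<bar>y\<bar>" 1] by simp
qed auto

lemma poly_lip_param:
  assumes S: "bounded S" and L: "\<And>\<theta> \<theta>'. \<theta> \<in> S \<Longrightarrow> \<theta>' \<in> S \<Longrightarrow> \<bar>f \<theta> - f \<theta>'\<bar> \<le> L * norm (\<theta> - \<theta>')" "L \<ge> 0"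
  shows "poly_lip S (\<lambda>\<theta> y. f \<theta>)"
proof -
  obtain K where K: "K \<ge> 0" "\<And>\<theta>. \<theta> \<in> S \<Longrightarrow> \<bar>f \<theta>\<bar> \<le> K"
  proof (cases "S = {}")
    case False
    then obtain \<theta>' where \<theta>': "\<theta>' \<in> S" by auto
    obtain R where R: "R > 0" "\<And>\<theta>. \<theta> \<in> S \<Longrightarrow> norm \<theta> \<le> R" using S bounded_pos by blast
    have "\<bar>f \<theta>\<bar> \<le> \<bar>f \<theta>'\<bar> + L * (R + R)" if \<theta>: "\<theta> \<in> S" for \<theta>
    proof -
      have "norm (\<theta> - \<theta>') \<le> R + R"
        using R(2)[OF \<theta>] R(2)[OF \<theta>'] norm_triangle_ineq4[of \<theta> \<theta>'] by linarith
      then have "L * norm (\<theta> - \<theta>') \<le> L * (R + R)" using L(2) by (rule mult_left_mono)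
      then show ?thesis using L(1)[OF \<theta> \<theta>'] by linarith
    qed
    then show ?thesis using L R by (intro that[of "\<bar>f \<theta>'\<bar> + L * (R + R)"]) auto
  qed auto
  show ?thesis
  proof (rule poly_lipI[where C="K + L" and k=0])
    fix \<theta> \<theta>' and y :: real assume "\<theta> \<in> S" "\<theta>' \<in> S"
    then show "\<bar>f \<theta> - f \<theta>'\<bar> \<le> (K + L) * (1 + y\<^sup>2) ^ 0 * norm (\<theta> - \<theta>')"
      using L(1)[of \<theta> \<theta>'] mult_nonneg_nonneg[OF K(1) norm_ge_zero, of "\<theta> - \<theta>'"] by (simp add: distrib_right)
  qed (use K L add_increasing2[OF L(2) K(2)] in auto)
qed

lemma abs_tanh_le: "\<bar>tanh (x::real)\<bar> \<le> 1"
  using tanh_real_bounds[of x] by auto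

lemma tanh_lip: "\<bar>tanh a - tanh b\<bar> \<le> \<bar>a - b\<bar>" for a b :: real
proof -
  have "norm (tanh a - tanh b) \<le> 1 * norm (a - b)"
  proof (rule field_differentiable_bound[OF convex_UNIV])
    show "(tanh has_real_derivative 1 - (tanh z)\<^sup>2) (at z within UNIV)" for z :: real
      by (auto intro!: derivative_eq_intros simp: cosh_real_nz)
    show "norm (1 - (tanh z)\<^sup>2) \<le> 1" for z :: real
      using abs_tanh_le[of z] by (auto simp: abs_le_iff abs_square_le_1 intro: order_trans[OF _ zero_le_power2])
  qed auto
  then show ?thesis by simp
qed

lemma ln_cosh_lip: "\<bar>ln (cosh a) - ln (cosh b)\<bar> \<le> \<bar>a - b\<bar>" for a b :: real
proof -
  have "norm (ln (cosh a) - ln (cosh b)) \<le> 1 * norm (a - b)"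
  proof (rule field_differentiable_bound[OF convex_UNIV])
    show "((\<lambda>x. ln (cosh x)) has_real_derivative tanh z) (at z within UNIV)" for z :: real
      by (auto intro!: derivative_eq_intros simp: tanh_def cosh_real_pos cosh_real_nz field_simps)
  qed (auto simp: abs_tanh_le)
  then show ?thesis by simp
qed

lemma sigma_lip: "\<bar>\<theta>$2 - \<theta>'$2\<bar> \<le> norm (\<theta> - \<theta>')" for \<theta> \<theta>' :: "real^2"
  using component_le_norm_cart[of "\<theta> - \<theta>'" 2] by simp

text \<open>Keeping \<sigma> away from 0 makes 1/\<sigma> and ln \<sigma> Lipschitz; boundedness
  turns Lipschitz functions of the parameter into bounded ones.\<close>

locale param_set =
  fixes S :: "(real^2) set" and m :: real
  assumes bdd: "bounded S" and m_pos: "m > 0" and m_le: "\<And>\<theta>. \<theta> \<in> S \<Longrightarrow> m \<le> \<theta>$2"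
begin

lemma poly_lip_const: "poly_lip S (\<lambda>\<theta> y. c)"
  by (rule poly_lip_param[OF bdd, where L=0]) auto

lemma poly_lip_uminus: "poly_lip S g \<Longrightarrow> poly_lip S (\<lambda>\<theta> y. - g \<theta> y)"
  using poly_lip_mult[OF poly_lip_const[of "-1"]] by simp

lemma poly_lip_diff: "poly_lip S g \<Longrightarrow> poly_lip S h \<Longrightarrow> poly_lip S (\<lambda>\<theta> y. g \<theta> y - h \<theta> y)"
  using poly_lip_add[OF _ poly_lip_uminus] by simp

lemma poly_lip_power: "poly_lip S g \<Longrightarrow> poly_lip S (\<lambda>\<theta> y. g \<theta> y ^ k)"
  by (induction k) (auto intro: poly_lip_const poly_lip_mult)

lemma poly_lip_divide_const: "poly_lip S g \<Longrightarrow> poly_lip S (\<lambda>\<theta> y. g \<theta> y / c)"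
  using poly_lip_mult[OF _ poly_lip_const[of "1 / c"]] by simp

lemma poly_lip_mu: "poly_lip S (\<lambda>\<theta> y. \<theta>$1)"
  by (rule poly_lip_param[OF bdd, where L=1])
    (use component_le_norm_cart in \<open>auto simp: vector_minus_component[symmetric] simp del: vector_minus_component\<close>)

lemma poly_lip_inverse_sigma: "poly_lip S (\<lambda>\<theta> y. 1 / \<theta>$2)"
proof (rule poly_lip_param[OF bdd])
  fix \<theta> \<theta>' assume \<theta>: "\<theta> \<in> S" "\<theta>' \<in> S"
  have s: "m \<le> \<theta>$2" "m \<le> \<theta>'$2" using m_le \<theta> by auto
  have "\<bar>1 / \<theta>$2 - 1 / \<theta>'$2\<bar> = \<bar>\<theta>$2 - \<theta>'$2\<bar> / (\<theta>$2 * \<theta>'$2)"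
    using s m_pos by (simp add: divide_simps abs_mult abs_minus_commute)
  also have "\<dots> \<le> norm (\<theta> - \<theta>') / (m * m)"
    using s m_pos by (intro frac_le sigma_lip mult_mono) auto
  finally show "\<bar>1 / \<theta>$2 - 1 / \<theta>'$2\<bar> \<le> 1 / (m * m) * norm (\<theta> - \<theta>')" by simp
qed (use m_pos in simp)

lemma poly_lip_divide_sigma_power: "poly_lip S g \<Longrightarrow> poly_lip S (\<lambda>\<theta> y. g \<theta> y / \<theta>$2 ^ k)"
  using poly_lip_mult[OF _ poly_lip_power[OF poly_lip_inverse_sigma]] by (simp add: power_one_over)

lemma poly_lip_ln_sigma: "poly_lip S (\<lambda>\<theta> y. ln (\<theta>$2))"
proof (rule poly_lip_param[OF bdd])
  fix \<theta> \<theta>' assume \<theta>: "\<theta> \<in> S" "\<theta>' \<in> S"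
  have "ln a - ln b \<le> \<bar>a - b\<bar> / m" if "m \<le> a" "m \<le> b" for a b
  proof -
    have "ln a - ln b \<le> (a - b) / b" using that m_pos by (intro ln_diff_le) auto
    also have "\<dots> \<le> \<bar>a - b\<bar> / m" using that m_pos by (intro frac_le) auto
    finally show ?thesis .
  qed
  from this[of "\<theta>$2" "\<theta>'$2"] this[of "\<theta>'$2" "\<theta>$2"]
  have "\<bar>ln (\<theta>$2) - ln (\<theta>'$2)\<bar> \<le> \<bar>\<theta>$2 - \<theta>'$2\<bar> / m"
    using m_le \<theta> by (simp add: abs_le_iff abs_minus_commute)
  also have "\<dots> \<le> norm (\<theta> - \<theta>') / m" using m_pos sigma_lip by (simp add: divide_right_mono)
  finally show "\<bar>ln (\<theta>$2) - ln (\<theta>'$2)\<bar> \<le> 1 / m * norm (\<theta> - \<theta>')" by simp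
qed (use m_pos in simp)

lemma poly_lip_tanh: "poly_lip S g \<Longrightarrow> poly_lip S (\<lambda>\<theta> y. tanh (g \<theta> y))"
  by (rule poly_lip_compose[OF _ tanh_lip]) auto

lemma poly_lip_ln_cosh: "poly_lip S g \<Longrightarrow> poly_lip S (\<lambda>\<theta> y. ln (cosh (g \<theta> y)))"
  by (rule poly_lip_compose[OF _ ln_cosh_lip])
    (auto intro!: borel_measurable_ln borel_measurable_continuous_onI continuous_intros)

lemmas poly_lip_intros = poly_lip_const poly_lip_arg poly_lip_mu poly_lip_add poly_lip_diff
  poly_lip_mult poly_lip_power poly_lip_divide_sigma_power poly_lip_divide_const
  poly_lip_ln_sigma poly_lip_tanh poly_lip_ln_cosh

lemma poly_lip_tanh_term: "poly_lip S tanh_term"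
proof -
  have "poly_lip S (\<lambda>\<theta> y. tanh_term \<theta> y)"
    unfolding tanh_term_def by (intro poly_lip_intros)
  then show ?thesis by simp
qed

lemma poly_lip_model:
  "poly_lip S log_dens" "poly_lip S score1" "poly_lip S score2"
  "poly_lip S hess11" "poly_lip S hess12" "poly_lip S hess22"
proof -
  note t = poly_lip_tanh_term
  have "poly_lip S (\<lambda>\<theta> y. log_dens \<theta> y)" unfolding log_dens_def by (intro poly_lip_intros)
  then show "poly_lip S log_dens" by simp
  have "poly_lip S (\<lambda>\<theta> y. score1 \<theta> y)" unfolding score1_def by (intro poly_lip_intros t)
  then show "poly_lip S score1" by simp
  have "poly_lip S (\<lambda>\<theta> y. score2 \<theta> y)" unfolding score2_def by (intro poly_lip_intros t)
  then show "poly_lip S score2" by simp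
  have "poly_lip S (\<lambda>\<theta> y. hess11 \<theta> y)" unfolding hess11_def by (intro poly_lip_intros t)
  then show "poly_lip S hess11" by simp
  have "poly_lip S (\<lambda>\<theta> y. hess12 \<theta> y)" unfolding hess12_def by (intro poly_lip_intros t)
  then show "poly_lip S hess12" by simp
  have "poly_lip S (\<lambda>\<theta> y. hess22 \<theta> y)" unfolding hess22_def by (intro poly_lip_intros t)
  then show "poly_lip S hess22" by simp
qed

end

text \<open>One-point sets give integrability of the model functions at an arbitrary
  parameter.\<close>

lemma param_set_singleton: "\<theta>$2 > 0 \<Longrightarrow> param_set {\<theta>} (\<theta>$2)"
  by unfold_locales auto

lemma poly_lip_integrable:
  assumes "poly_lip S g" "\<theta> \<in> S" "\<eta>$2 > 0"
  shows "integrable (folded_normal \<eta>) (g \<theta>)" "integrable (folded_normal \<eta>) (\<lambda>y. (g \<theta> y)\<^sup>2)"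
  using poly_lipE[OF assms(1)] integrable_folded_normal_bounded[OF assms(3) poly_lip_measurable[OF assms(1,2)]] assms(2)
  by metis+

lemma measurable_cosh_real [measurable]: "(cosh :: real \<Rightarrow> real) \<in> borel_measurable borel"
  by (intro borel_measurable_continuous_onI continuous_intros)

lemma measurable_model [measurable]:
  shows "log_dens \<theta> \<in> borel_measurable borel" and "score1 \<theta> \<in> borel_measurable borel"
    and "score2 \<theta> \<in> borel_measurable borel" and "hess11 \<theta> \<in> borel_measurable borel"
    and "hess12 \<theta> \<in> borel_measurable borel" and "hess22 \<theta> \<in> borel_measurable borel"
proof -
  show "log_dens \<theta> \<in> borel_measurable borel" unfolding log_dens_def[abs_def] by measurable
  show "score1 \<theta> \<in> borel_measurable borel" unfolding score1_def[abs_def] by measurable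
  show "score2 \<theta> \<in> borel_measurable borel" unfolding score2_def[abs_def] by measurable
  show "hess11 \<theta> \<in> borel_measurable borel" unfolding hess11_def[abs_def] by measurable
  show "hess12 \<theta> \<in> borel_measurable borel" unfolding hess12_def[abs_def] by measurable
  show "hess22 \<theta> \<in> borel_measurable borel" unfolding hess22_def[abs_def] by measurable
qed

text \<open>Equality in \<open>exp D \<ge> 1 + D\<close> for the log-density ratio \<open>D\<close> would make the two laws equal;
  the parameter is recovered from \<open>3 (E Y\<^sup>2)\<^sup>2 - E Y\<^sup>4 = 2 \<mu>\<^sup>4\<close> and \<open>E Y\<^sup>2 = \<mu>\<^sup>2 + \<sigma>\<^sup>2\<close>.\<close>

lemma folded_normal_relative_entropy_pos:
  assumes \<theta>: "\<theta>$1 > 0" "\<theta>$2 > 0" and \<eta>: "\<eta>$1 > 0" "\<eta>$2 > 0" and "\<eta> \<noteq> \<theta>"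
  shows "(\<integral>y. log_dens \<theta> y - log_dens \<eta> y \<partial>folded_normal \<theta>) > 0"
proof (rule ccontr)
  interpret prob_space "folded_normal \<theta>" by (rule prob_space_folded_normal[OF \<theta>(2)])
  define D where "D = (\<lambda>y. log_dens \<eta> y - log_dens \<theta> y)"
  have [measurable]: "D \<in> borel_measurable borel" unfolding D_def by measurable
  have li: "integrable (folded_normal \<theta>) (log_dens \<zeta>)" if "\<zeta>$2 > 0" for \<zeta>
    using poly_lip_integrable[OF param_set.poly_lip_model(1)[OF param_set_singleton[OF that]]] \<theta> by simp
  have Di: "integrable (folded_normal \<theta>) D"
    using li \<theta> \<eta> by (simp add: D_def)
  assume "\<not> ?thesis"
  moreover have "(\<integral>y. log_dens \<theta> y - log_dens \<eta> y \<partial>folded_normal \<theta>) = - (\<integral>y. D y \<partial>folded_normal \<theta>)"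
    using li \<theta> \<eta> by (simp add: D_def)
  ultimately have D0: "(\<integral>y. D y \<partial>folded_normal \<theta>) \<ge> 0" by simp
  have ch: "has_bochner_integral (folded_normal \<theta>) (\<lambda>y. g y * exp (D y)) c"
    if "has_bochner_integral (folded_normal \<eta>) g c" "g \<in> borel_measurable borel" for g c
    by (rule folded_normal_change_density[OF \<theta>(2) \<eta>(2) that(2) _ _ that(1)]) (auto simp: D_def)
  have "has_bochner_integral (folded_normal \<eta>) (\<lambda>_. 1) (1::real)"
    using prob_space.prob_space[OF prob_space_folded_normal[OF \<eta>(2)]]
      prob_space.finite_measure[OF prob_space_folded_normal[OF \<eta>(2)]]
    by (simp add: has_bochner_integral_iff finite_measure.integrable_const)
  from ch[OF this] have e: "integrable (folded_normal \<theta>) (\<lambda>y. exp (D y))" "(\<integral>y. exp (D y) \<partial>folded_normal \<theta>) = 1"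
    by (auto simp: has_bochner_integral_iff)
  \<comment> \<open>As \<open>exp (D y)\<close> has integral 1, this nonnegative function integrates
    to minus the integral of \<open>D\<close>, which is at most 0 under the contrary assumption. So
    it vanishes almost everywhere.\<close>
  have Gi: "integrable (folded_normal \<theta>) (\<lambda>y. exp (D y) - 1 - D y)" using e Di by simp
  have G0: "exp (D y) - 1 - D y \<ge> 0" for y using exp_ge_add_one_self[of "D y"] by linarith
  have "(\<integral>y. exp (D y) - 1 - D y \<partial>folded_normal \<theta>) = - (\<integral>y. D y \<partial>folded_normal \<theta>)"
    using e Di prob_space by simp
  moreover have "(\<integral>y. exp (D y) - 1 - D y \<partial>folded_normal \<theta>) \<ge> 0"
    using G0 by (intro Bochner_Integration.integral_nonneg) auto
  ultimately have "(\<integral>y. exp (D y) - 1 - D y \<partial>folded_normal \<theta>) = 0"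
    using D0 by linarith
  then have "AE y in folded_normal \<theta>. exp (D y) - 1 - D y = 0"
    using integral_nonneg_eq_0_iff_AE[OF Gi] G0 by simp
  then have 1: "AE y in folded_normal \<theta>. exp (D y) = 1"
  proof eventually_elim
    case (elim y)
    \<comment> \<open>With \<open>x = exp (D y)\<close> the equation reads
      \<open>ln x = x - 1\<close>, which forces \<open>x = 1\<close>.\<close>
    then show ?case using ln_eq_minus_one[of "exp (D y)"] by simp
  qed
  have eq: "c = d" if "has_bochner_integral (folded_normal \<eta>) g c" "has_bochner_integral (folded_normal \<theta>) g d"
    "g \<in> borel_measurable borel" for g :: "real \<Rightarrow> real" and c d
  proof -
    note [measurable] = that(3)
    have "(\<integral>y. g y * exp (D y) \<partial>folded_normal \<theta>) = (\<integral>y. g y \<partial>folded_normal \<theta>)"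
      by (rule integral_cong_AE) (use 1 in \<open>auto elim: eventually_mono\<close>)
    then show ?thesis using ch[OF that(1,3)] that(2) by (auto simp: has_bochner_integral_iff)
  qed
  have m2: "(\<eta>$1)\<^sup>2 + (\<eta>$2)\<^sup>2 = (\<theta>$1)\<^sup>2 + (\<theta>$2)\<^sup>2"
    by (rule eq[OF folded_normal_moments(1)[OF \<eta>(2)] folded_normal_moments(1)[OF \<theta>(2)]]) simp
  have m4: "\<eta>$1 ^ 4 + 6 * (\<eta>$1)\<^sup>2 * (\<eta>$2)\<^sup>2 + 3 * \<eta>$2 ^ 4 = \<theta>$1 ^ 4 + 6 * (\<theta>$1)\<^sup>2 * (\<theta>$2)\<^sup>2 + 3 * \<theta>$2 ^ 4"
    by (rule eq[OF folded_normal_moments(2)[OF \<eta>(2)] folded_normal_moments(2)[OF \<theta>(2)]]) simp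
  have sq: "2 * a ^ 4 = 3 * (a\<^sup>2 + b\<^sup>2)\<^sup>2 - (a ^ 4 + 6 * a\<^sup>2 * b\<^sup>2 + 3 * b ^ 4)" for a b :: real
    by (simp add: power2_eq_square algebra_simps eval_nat_numeral)
  have "\<eta>$1 ^ 4 = \<theta>$1 ^ 4"
    using sq[of "\<eta>$1" "\<eta>$2"] sq[of "\<theta>$1" "\<theta>$2"] m2 m4 by simp
  then have 1: "\<eta>$1 = \<theta>$1" using \<theta> \<eta> power_eq_imp_eq_base[of "\<eta>$1" 4 "\<theta>$1"] by simp
  then have "(\<eta>$2)\<^sup>2 = (\<theta>$2)\<^sup>2" using m2 by simp
  then have "\<eta>$2 = \<theta>$2" using \<theta> \<eta> power_eq_imp_eq_base[of "\<eta>$2" 2 "\<theta>$2"] by simp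
  with 1 have "\<eta> = \<theta>" by (simp add: vec_eq_iff forall_2)
  with \<open>\<eta> \<noteq> \<theta>\<close> show False by simp
qed

section \<open>Fisher information\<close>

definition info_rem :: "real^2 \<Rightarrow> real" where
  "info_rem \<theta> = (\<integral>y. (y * tanh_term \<theta> y)\<^sup>2 \<partial>folded_normal \<theta>)"

text \<open>Only \<open>\<integral> (y tanh(\<mu> y / \<sigma>\<^sup>2))\<^sup>2\<close> has no closed form. It enters the second moments of the
  score and the expected Hessian with the same coefficient, which gives the information identity.\<close>

lemma folded_normal_linear_moments:
  assumes \<theta>: "\<theta>$2 > 0"
  defines "\<mu> \<equiv> \<theta>$1" and "\<sigma> \<equiv> \<theta>$2"
  shows "has_bochner_integral (folded_normal \<theta>)
    (\<lambda>y. c0 + c1 * y\<^sup>2 + c2 * y ^ 4 + c3 * (y * tanh_term \<theta> y) + c4 * (y ^ 3 * tanh_term \<theta> y)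
      + c5 * (y * tanh_term \<theta> y)\<^sup>2)
    (c0 + c1 * (\<mu>\<^sup>2 + \<sigma>\<^sup>2) + c2 * (\<mu> ^ 4 + 6 * \<mu>\<^sup>2 * \<sigma>\<^sup>2 + 3 * \<sigma> ^ 4) + c3 * \<mu>
      + c4 * (\<mu> ^ 3 + 3 * \<mu> * \<sigma>\<^sup>2) + c5 * info_rem \<theta>)"
proof -
  interpret prob_space "folded_normal \<theta>" by (rule prob_space_folded_normal[OF \<theta>])
  have "\<bar>y * tanh_term \<theta> y\<bar> \<le> 1 * (1 + y\<^sup>2) ^ 1" for y
  proof -
    have "\<bar>y * tanh_term \<theta> y\<bar> \<le> \<bar>y\<bar> * 1"
      unfolding abs_mult tanh_term_def using tanh_real_bounds by (intro mult_left_mono) (auto simp: abs_le_iff less_imp_le)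
    also have "\<bar>y\<bar> * 1 \<le> 1 + y\<^sup>2" using sum_squares_bound[of "\<bar>y\<bar>" 1] by simp
    finally show ?thesis by simp
  qed
  then have "integrable (folded_normal \<theta>) (\<lambda>y. (y * tanh_term \<theta> y)\<^sup>2)"
    by (rule integrable_folded_normal_bounded(2)[OF \<theta>, rotated]) simp
  then have q: "has_bochner_integral (folded_normal \<theta>) (\<lambda>y. (y * tanh_term \<theta> y)\<^sup>2) (info_rem \<theta>)"
    by (simp add: has_bochner_integral_iff info_rem_def)
  have c: "has_bochner_integral (folded_normal \<theta>) (\<lambda>y. c0) c0"
    using prob_space by (simp add: has_bochner_integral_iff)
  show ?thesis unfolding \<mu>_def \<sigma>_def
    by (intro has_bochner_integral_add has_bochner_integral_mult_right c q folded_normal_moments \<theta>)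
qed

text \<open>Turns each expectation below into a choice of six coefficients: integrand and value are
  premises, checked by algebra once the coefficients are supplied.\<close>

lemma folded_normal_linear_momentsI:
  assumes \<theta>: "\<theta>$2 > 0"
    and "\<And>y. f y = c0 + c1 * y\<^sup>2 + c2 * y ^ 4 + c3 * (y * tanh_term \<theta> y) + c4 * (y ^ 3 * tanh_term \<theta> y)
      + c5 * (y * tanh_term \<theta> y)\<^sup>2"
    and "v = c0 + c1 * ((\<theta>$1)\<^sup>2 + (\<theta>$2)\<^sup>2) + c2 * (\<theta>$1 ^ 4 + 6 * (\<theta>$1)\<^sup>2 * (\<theta>$2)\<^sup>2 + 3 * \<theta>$2 ^ 4)
      + c3 * \<theta>$1 + c4 * (\<theta>$1 ^ 3 + 3 * \<theta>$1 * (\<theta>$2)\<^sup>2) + c5 * info_rem \<theta>"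
  shows "has_bochner_integral (folded_normal \<theta>) f v"
  unfolding assms(2)[abs_def] assms(3) by (rule folded_normal_linear_moments[OF \<theta>])

text \<open>The three information entries have the form of negated expected second derivatives, with
  \<open>info_rem \<theta>\<close> left as the single integral without closed form.\<close>

definition info11 :: "real^2 \<Rightarrow> real" where
  "info11 \<theta> = (info_rem \<theta> - (\<theta>$1)\<^sup>2) / \<theta>$2 ^ 4"

definition info12 :: "real^2 \<Rightarrow> real" where
  "info12 \<theta> = 2 * \<theta>$1 * ((\<theta>$1)\<^sup>2 + (\<theta>$2)\<^sup>2 - info_rem \<theta>) / \<theta>$2 ^ 5"

definition info22 :: "real^2 \<Rightarrow> real" where
  "info22 \<theta> = 2 / \<theta>$2 ^ 2 - 4 * (\<theta>$1)\<^sup>2 * ((\<theta>$1)\<^sup>2 + (\<theta>$2)\<^sup>2 - info_rem \<theta>) / \<theta>$2 ^ 6"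

text \<open>That the expected products and the negated expected second derivatives coincide is the
  information identity. The last two values are the partial derivatives of E Y^2 = \<mu>^2 +
  \<sigma>^2; they serve to prove positive definiteness.\<close>

lemma score_moments:
  assumes \<theta>: "\<theta>$2 > 0"
  shows "has_bochner_integral (folded_normal \<theta>) (score1 \<theta>) 0"
    and "has_bochner_integral (folded_normal \<theta>) (score2 \<theta>) 0"
    and "has_bochner_integral (folded_normal \<theta>) (hess11 \<theta>) (- info11 \<theta>)"
    and "has_bochner_integral (folded_normal \<theta>) (hess12 \<theta>) (- info12 \<theta>)"
    and "has_bochner_integral (folded_normal \<theta>) (hess22 \<theta>) (- info22 \<theta>)"
    and "has_bochner_integral (folded_normal \<theta>) (\<lambda>y. score1 \<theta> y * score1 \<theta> y) (info11 \<theta>)"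
    and "has_bochner_integral (folded_normal \<theta>) (\<lambda>y. score1 \<theta> y * score2 \<theta> y) (info12 \<theta>)"
    and "has_bochner_integral (folded_normal \<theta>) (\<lambda>y. score2 \<theta> y * score2 \<theta> y) (info22 \<theta>)"
    and "has_bochner_integral (folded_normal \<theta>) (\<lambda>y. score1 \<theta> y * y\<^sup>2) (2 * \<theta>$1)"
    and "has_bochner_integral (folded_normal \<theta>) (\<lambda>y. score2 \<theta> y * y\<^sup>2) (2 * \<theta>$2)"
proof -
  define m s q where "m = \<theta>$1" and "s = \<theta>$2" and "q = info_rem \<theta>"
  define c where "c = 1 / s"
  define w where "w = (\<lambda>y. y * tanh_term \<theta> y)"
  have cs: "c * s = 1" using \<theta> by (simp add: c_def s_def)
  have div: "x / z ^ k = x * (1 / z) ^ k" for x z :: real and k by (simp add: power_one_over)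
  note unf = score1_def score2_def hess11_def hess12_def hess22_def info11_def info12_def info22_def
    div m_def[symmetric] s_def[symmetric] q_def[symmetric] c_def[symmetric] w_def[symmetric]
  have y3: "y ^ 3 * tanh_term \<theta> y = y\<^sup>2 * w y" for y by (simp add: w_def eval_nat_numeral)
  have red: "c * (s * x) = x" for x using cs by (simp flip: mult.assoc)
  note I = folded_normal_linear_momentsI[OF \<theta>, unfolded y3 w_def[symmetric] m_def[symmetric] s_def[symmetric] q_def[symmetric]]
  have wy: "y * tanh_term \<theta> y = w y" for y by (simp add: w_def)
  note unf' = unf wy
  \<comment> \<open>Here and below the six arguments are the coefficients of 1, y^2, y^4, w, y^2 w
    and w^2 in the expanded integrand.\<close>
  show "has_bochner_integral (folded_normal \<theta>) (score1 \<theta>) 0"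
    by (rule I[of _ "- m * c^2" 0 0 "c^2" 0 0]) (unfold unf', simp_all add: algebra_simps)
  show "has_bochner_integral (folded_normal \<theta>) (score2 \<theta>) 0"
    by (rule I[of _ "m\<^sup>2 * c^3 - c" "c^3" 0 "- 2 * m * c^3" 0 0])
      (unfold unf', simp_all add: algebra_simps eval_nat_numeral red cs)
  show "has_bochner_integral (folded_normal \<theta>) (hess11 \<theta>) (- info11 \<theta>)"
    by (rule I[of _ "- (c^2)" "c^4" 0 0 0 "- (c^4)"])
      (unfold unf', simp_all add: algebra_simps eval_nat_numeral red cs)
  show "has_bochner_integral (folded_normal \<theta>) (hess12 \<theta>) (- info12 \<theta>)"
    by (rule I[of _ "2 * m * c^3" "- 2 * m * c^5" 0 "- 2 * c^3" 0 "2 * m * c^5"])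
      (unfold unf', simp_all add: algebra_simps eval_nat_numeral red cs)
  show "has_bochner_integral (folded_normal \<theta>) (hess22 \<theta>) (- info22 \<theta>)"
    by (rule I[of _ "c^2 - 3 * m\<^sup>2 * c^4" "- 3 * c^4 + 4 * m\<^sup>2 * c^6" 0 "6 * m * c^4" 0 "- 4 * m\<^sup>2 * c^6"])
      (unfold unf', simp_all add: algebra_simps eval_nat_numeral red cs)
  show "has_bochner_integral (folded_normal \<theta>) (\<lambda>y. score1 \<theta> y * score1 \<theta> y) (info11 \<theta>)"
    by (rule I[of _ "m\<^sup>2 * c^4" 0 0 "- 2 * m * c^4" 0 "c^4"])
      (unfold unf', simp_all add: algebra_simps eval_nat_numeral red cs)
  show "has_bochner_integral (folded_normal \<theta>) (\<lambda>y. score1 \<theta> y * score2 \<theta> y) (info12 \<theta>)"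
    by (rule I[of _ "- (m^3) * c^5 + m * c^3" "- m * c^5" 0 "3 * m\<^sup>2 * c^5 - c^3" "c^5" "- 2 * m * c^5"])
      (unfold unf', simp_all add: algebra_simps eval_nat_numeral red cs)
  show "has_bochner_integral (folded_normal \<theta>) (\<lambda>y. score2 \<theta> y * score2 \<theta> y) (info22 \<theta>)"
    by (rule I[of _ "m^4 * c^6 - 2 * m\<^sup>2 * c^4 + c^2" "2 * m\<^sup>2 * c^6 - 2 * c^4" "c^6"
        "- 4 * m^3 * c^6 + 4 * m * c^4" "- 4 * m * c^6" "4 * m\<^sup>2 * c^6"])
      (unfold unf', simp_all add: algebra_simps eval_nat_numeral red cs)
  show "has_bochner_integral (folded_normal \<theta>) (\<lambda>y. score1 \<theta> y * y\<^sup>2) (2 * \<theta>$1)"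
    by (rule I[of _ 0 "- m * c^2" 0 0 "c^2" 0])
      (unfold unf', simp_all add: algebra_simps eval_nat_numeral red cs)
  show "has_bochner_integral (folded_normal \<theta>) (\<lambda>y. score2 \<theta> y * y\<^sup>2) (2 * \<theta>$2)"
    by (rule I[of _ 0 "m\<^sup>2 * c^3 - c" "c^3" 0 "- 2 * m * c^3" 0])
      (unfold unf', simp_all add: algebra_simps eval_nat_numeral red cs)
qed

text \<open>The density is positive for y \<ge> 0, so every interval (0, d) has positive mass, and a
  function continuous at the end point 0 cannot be nonzero there and vanish almost
  everywhere.\<close>

lemma continuous_AE_folded_normal_0:
  fixes p :: "real \<Rightarrow> real"
  assumes \<theta>: "\<theta>$2 > 0" and p: "isCont p 0" and AE: "AE y in folded_normal \<theta>. p y = 0"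
  shows "p 0 = 0"
proof (rule ccontr)
  assume "p 0 \<noteq> 0"
  then obtain d where d: "d > 0" "\<And>y. dist 0 y < d \<Longrightarrow> p y \<noteq> 0"
    using continuous_at_avoid[OF p, of 0] by auto
  have "AE y in lborel. 0 < folded_normal_density \<theta> y \<longrightarrow> p y = 0"
    using AE unfolding folded_normal_def by (subst (asm) AE_density) (auto simp: ennreal_less_zero_iff)
  then have "AE y in lborel. \<not> (0 < y \<and> y < d)"
  proof eventually_elim
    case (elim y)
    then show ?case using d(2)[of y] folded_normal_density_pos[OF \<theta>, of y] by (auto simp: dist_real_def)
  qed
  then have "emeasure lborel {0<..<d} = 0"
    by (subst (asm) AE_iff_measurable[of "{0<..<d}"]) auto
  then show False using d(1) by simp
qed

text \<open>If a linear combination of the score components vanished almost surely, then so would its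
  expectation against \<open>y\<^sup>2\<close> and its value at \<open>0\<close>: two independent equations for the coefficients.\<close>

lemma info_pos_def:
  assumes \<theta>: "\<theta>$1 > 0" "\<theta>$2 > 0" and ab: "a \<noteq> 0 \<or> b \<noteq> 0"
  shows "a\<^sup>2 * info11 \<theta> + 2 * a * b * info12 \<theta> + b\<^sup>2 * info22 \<theta> > 0"
proof (rule ccontr)
  define p where "p = (\<lambda>y. a * score1 \<theta> y + b * score2 \<theta> y)"
  have "has_bochner_integral (folded_normal \<theta>)
      (\<lambda>y. a\<^sup>2 * (score1 \<theta> y * score1 \<theta> y) + (2 * a * b) * (score1 \<theta> y * score2 \<theta> y) + b\<^sup>2 * (score2 \<theta> y * score2 \<theta> y))
      (a\<^sup>2 * info11 \<theta> + (2 * a * b) * info12 \<theta> + b\<^sup>2 * info22 \<theta>)"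
    by (intro has_bochner_integral_add has_bochner_integral_mult_right score_moments \<theta>)
  also have "(\<lambda>y. a\<^sup>2 * (score1 \<theta> y * score1 \<theta> y) + (2 * a * b) * (score1 \<theta> y * score2 \<theta> y) + b\<^sup>2 * (score2 \<theta> y * score2 \<theta> y))
      = (\<lambda>y. (p y)\<^sup>2)"
    by (simp add: fun_eq_iff p_def power2_eq_square algebra_simps)
  finally have p2: "integrable (folded_normal \<theta>) (\<lambda>y. (p y)\<^sup>2)"
    "(\<integral>y. (p y)\<^sup>2 \<partial>folded_normal \<theta>) = a\<^sup>2 * info11 \<theta> + 2 * a * b * info12 \<theta> + b\<^sup>2 * info22 \<theta>"
    by (auto simp: has_bochner_integral_iff)
  assume "\<not> ?thesis"
  moreover have "(\<integral>y. (p y)\<^sup>2 \<partial>folded_normal \<theta>) \<ge> 0" by (intro Bochner_Integration.integral_nonneg) auto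
  ultimately have "(\<integral>y. (p y)\<^sup>2 \<partial>folded_normal \<theta>) = 0" using p2(2) by linarith
  then have AE: "AE y in folded_normal \<theta>. p y = 0"
    using integral_nonneg_eq_0_iff_AE[OF p2(1)] by simp
  have "has_bochner_integral (folded_normal \<theta>) (\<lambda>y. a * (score1 \<theta> y * y\<^sup>2) + b * (score2 \<theta> y * y\<^sup>2)) (a * (2 * \<theta>$1) + b * (2 * \<theta>$2))"
    by (intro has_bochner_integral_add has_bochner_integral_mult_right score_moments \<theta>)
  moreover have "(\<integral>y. a * (score1 \<theta> y * y\<^sup>2) + b * (score2 \<theta> y * y\<^sup>2) \<partial>folded_normal \<theta>) = (\<integral>y. 0 \<partial>folded_normal \<theta>)"
  proof (rule integral_cong_AE)
    show "AE y in folded_normal \<theta>. a * (score1 \<theta> y * y\<^sup>2) + b * (score2 \<theta> y * y\<^sup>2) = 0"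
      using AE
    proof eventually_elim
      case (elim y)
      have "a * (score1 \<theta> y * y\<^sup>2) + b * (score2 \<theta> y * y\<^sup>2) = p y * y\<^sup>2" by (simp add: p_def algebra_simps)
      then show ?case using elim by simp
    qed
  qed auto
  ultimately have 1: "a * \<theta>$1 + b * \<theta>$2 = 0" by (simp add: has_bochner_integral_iff)
  have "isCont p 0"
    unfolding p_def score1_def score2_def tanh_term_def
    using \<theta> by (intro continuous_intros) (auto simp: cosh_real_nz)
  then have "p 0 = 0" using AE by (rule continuous_AE_folded_normal_0[OF \<theta>(2)])
  moreover have "p 0 * \<theta>$2 ^ 3 = b * (\<theta>$1)\<^sup>2 - b * (\<theta>$2)\<^sup>2 - a * \<theta>$1 * \<theta>$2"
    using \<theta> by (simp add: p_def score1_def score2_def field_simps eval_nat_numeral)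
  ultimately have 2: "b * (\<theta>$1)\<^sup>2 - b * (\<theta>$2)\<^sup>2 = a * \<theta>$1 * \<theta>$2" by simp
  \<comment> \<open>The first equation times \<sigma>, combined with the second, leaves b \<mu>^2 =
    0; here \<mu> > 0 enters.\<close>
  have "a * \<theta>$1 * \<theta>$2 = - b * (\<theta>$2)\<^sup>2"
    using arg_cong[OF 1, of "\<lambda>x. x * \<theta>$2"] by (simp add: algebra_simps power2_eq_square)
  with 2 have "b * (\<theta>$1)\<^sup>2 = 0" by simp
  then have "b = 0" using \<theta> by simp
  with 1 \<theta> ab show False by simp
qed

text \<open>The quadratic form at (1, 0) is the first entry; at (-I12, I11) it is I11 times the
  determinant.\<close>

lemma info_det_pos:
  assumes \<theta>: "\<theta>$1 > 0" "\<theta>$2 > 0"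
  shows "info11 \<theta> > 0" "info11 \<theta> * info22 \<theta> - info12 \<theta> * info12 \<theta> > 0"
proof -
  show 1: "info11 \<theta> > 0" using info_pos_def[OF \<theta>, of 1 0] by simp
  have "(info12 \<theta>)\<^sup>2 * info11 \<theta> + 2 * (- info12 \<theta>) * info11 \<theta> * info12 \<theta> + (info11 \<theta>)\<^sup>2 * info22 \<theta>
      = info11 \<theta> * (info11 \<theta> * info22 \<theta> - info12 \<theta> * info12 \<theta>)"
    by (simp add: algebra_simps power2_eq_square)
  then show "info11 \<theta> * info22 \<theta> - info12 \<theta> * info12 \<theta> > 0"
    using info_pos_def[OF \<theta>, of "- info12 \<theta>" "info11 \<theta>"] 1 by (simp add: zero_less_mult_iff)
qed

definition info_mat :: "real^2 \<Rightarrow> real^2^2" where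
  "info_mat \<theta> = vector [vector [info11 \<theta>, info12 \<theta>], vector [info12 \<theta>, info22 \<theta>]]"

lemma info_mat_nth: "info_mat \<theta> $ 1 $ 1 = info11 \<theta>" "info_mat \<theta> $ 1 $ 2 = info12 \<theta>"
  "info_mat \<theta> $ 2 $ 1 = info12 \<theta>" "info_mat \<theta> $ 2 $ 2 = info22 \<theta>"
  by (simp_all add: info_mat_def)

lemma outer_square_nth: "outer_square v $ i $ j = v $ i * v $ j"
  by (simp add: outer_square_def columnvector_def rowvector_def matrix_matrix_mult_def sum_1)

text \<open>Expansion in the unit matrices \<open>axis i (axis j 1)\<close> reduces the
  matrix-valued integral to scalar moments.\<close>

lemma has_bochner_integral_outer_square:
  assumes \<theta>: "\<theta>$2 > 0"
  shows "has_bochner_integral (folded_normal \<theta>) (\<lambda>y. outer_square (vector [score1 \<theta> y, score2 \<theta> y])) (info_mat \<theta>)"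
proof -
  let ?E = "\<lambda>i j. axis i (axis j 1) :: real^2^2"
  have eq: "outer_square (vector [u, v] :: real^2) = (u * u) *\<^sub>R ?E 1 1 + (u * v) *\<^sub>R ?E 1 2 + (u * v) *\<^sub>R ?E 2 1 + (v * v) *\<^sub>R ?E 2 2" for u v
    by (simp add: vec_eq_iff forall_2 outer_square_nth axis_def)
  have "info_mat \<theta> = info11 \<theta> *\<^sub>R ?E 1 1 + info12 \<theta> *\<^sub>R ?E 1 2 + info12 \<theta> *\<^sub>R ?E 2 1 + info22 \<theta> *\<^sub>R ?E 2 2"
    by (simp add: vec_eq_iff forall_2 info_mat_def axis_def)
  then show ?thesis
    unfolding eq by (auto intro!: has_bochner_integral_add has_bochner_integral_scaleR_left score_moments \<theta>)
qed

lemma AE_score_eq: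
  assumes \<theta>: "\<theta>$2 > 0"
  shows "AE y in folded_normal \<theta>. score \<theta> y = vector [score1 \<theta> y, score2 \<theta> y]"
  using AE_folded_normal_nonneg by eventually_elim (simp add: score_eq[OF \<theta>])

text \<open>For negative \<open>y\<close> the density vanishes at every parameter, so its logarithm
  is the constant \<open>ln 0 = 0\<close> with gradient 0. A formula for all \<open>y\<close> yields
  measurability of a function defined by \<open>THE\<close>.\<close>

lemma score_eq_if:
  assumes "\<theta>$2 > 0"
  shows "score \<theta> y = (if y \<ge> 0 then vector [score1 \<theta> y, score2 \<theta> y] else 0)"
proof (cases "y \<ge> 0")
  case False
  then have "(\<lambda>t. ln (folded_normal_density t y)) = (\<lambda>t. 0)"
    by (simp add: folded_normal_density_neg fun_eq_iff)
  then have "GDERIV (\<lambda>t. ln (folded_normal_density t y)) \<theta> :> 0"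
    by (simp add: GDERIV_const)
  then have "score \<theta> y = 0"
    unfolding score_def using GDERIV_unique by (intro the_equality) auto
  with False show ?thesis by simp
qed (simp add: score_eq[OF assms])

lemma measurable_score [measurable]:
  assumes "\<theta>$2 > 0" shows "score \<theta> \<in> borel_measurable borel"
  unfolding score_eq_if[OF assms, abs_def] by measurable

lemma
  assumes \<theta>: "\<theta>$2 > 0"
  shows integrable_outer_square_score: "integrable (folded_normal \<theta>) (\<lambda>y. outer_square (score \<theta> y))"
    and fisher_info_eq: "fisher_info \<theta> = info_mat \<theta>"
proof -
  let ?s = "\<lambda>y. vector [score1 \<theta> y, score2 \<theta> y] :: real^2"
  have I: "integrable (folded_normal \<theta>) (\<lambda>y. outer_square (?s y))"
    "(\<integral>y. outer_square (?s y) \<partial>folded_normal \<theta>) = info_mat \<theta>"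
    using has_bochner_integral_outer_square[OF \<theta>] by (auto simp: has_bochner_integral_iff)
  have m[measurable]: "(\<lambda>y. outer_square (?s y)) \<in> borel_measurable borel"
    using borel_measurable_integrable[OF I(1)] by simp
  have 0: "outer_square (0 :: real^2) = 0" by (simp add: vec_eq_iff outer_square_nth)
  have "(\<lambda>y. outer_square (score \<theta> y)) = (\<lambda>y. if y \<ge> 0 then outer_square (?s y) else 0)"
    by (auto simp: fun_eq_iff score_eq_if[OF \<theta>] 0)
  then have m': "(\<lambda>y. outer_square (score \<theta> y)) \<in> borel_measurable (folded_normal \<theta>)" by simp
  have AE: "AE y in folded_normal \<theta>. outer_square (score \<theta> y) = outer_square (?s y)"
    using AE_score_eq[OF \<theta>] by eventually_elim simp
  show "integrable (folded_normal \<theta>) (\<lambda>y. outer_square (score \<theta> y))"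
    using I(1) integrable_cong_AE[OF m' _ AE] by simp
  show "fisher_info \<theta> = info_mat \<theta>"
    unfolding fisher_info_def using I(2) integral_cong_AE[OF m' _ AE] by simp
qed

section \<open>Consistency and asymptotic normality\<close>

text \<open>Mean value inequality for \<open>G\<close>, which is \<open>g\<close> minus its linear
  part at \<theta>0: its derivative is the deviation of \<open>p\<close> and \<open>q\<close> from
  their values at \<theta>0, controlled on the ball through \<theta>. \<open>P\<close> and
  \<open>Q\<close> may depend on \<open>y\<close>, so that the remainder can be averaged over the
  sample.\<close>

lemma score_taylor:
  fixes g p q :: "real^2 \<Rightarrow> real \<Rightarrow> real"
  assumes S: "cball \<theta>0 \<rho> \<subseteq> S" and \<theta>: "\<theta> \<in> cball \<theta>0 \<rho>"
    and d: "\<And>\<eta>. \<eta> \<in> S \<Longrightarrow> ((\<lambda>\<theta>. g \<theta> y) has_derivative (\<lambda>h. h$1 * p \<eta> y + h$2 * q \<eta> y)) (at \<eta>)"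
    and p: "\<And>\<eta>. \<eta> \<in> S \<Longrightarrow> \<bar>p \<eta> y - p \<theta>0 y\<bar> \<le> P * norm (\<eta> - \<theta>0)"
    and q: "\<And>\<eta>. \<eta> \<in> S \<Longrightarrow> \<bar>q \<eta> y - q \<theta>0 y\<bar> \<le> Q * norm (\<eta> - \<theta>0)"
    and PQ: "P \<ge> 0" "Q \<ge> 0"
  shows "\<bar>g \<theta> y - g \<theta>0 y - ((\<theta> - \<theta>0)$1 * p \<theta>0 y + (\<theta> - \<theta>0)$2 * q \<theta>0 y)\<bar> \<le> (P + Q) * (norm (\<theta> - \<theta>0))\<^sup>2"
proof -
  define C where "C = cball \<theta>0 (norm (\<theta> - \<theta>0))"
  define G where "G = (\<lambda>\<eta>. g \<eta> y - ((\<eta> - \<theta>0)$1 * p \<theta>0 y + (\<eta> - \<theta>0)$2 * q \<theta>0 y))"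
  have lin: "((\<lambda>\<eta>. (\<eta> - \<theta>0)$i * c) has_derivative (\<lambda>h. h$i * c)) F" for i c F
    by (auto intro!: derivative_eq_intros)
  have CS: "C \<subseteq> S" using S \<theta> by (auto simp: C_def dist_norm norm_minus_commute)
  have "norm (G \<theta> - G \<theta>0) \<le> ((P + Q) * norm (\<theta> - \<theta>0)) * norm (\<theta> - \<theta>0)"
  proof (rule differentiable_bound)
    show "convex C" by (simp add: C_def)
    fix \<eta> assume \<eta>: "\<eta> \<in> C"
    show "(G has_derivative (\<lambda>h. h$1 * (p \<eta> y - p \<theta>0 y) + h$2 * (q \<eta> y - q \<theta>0 y))) (at \<eta> within C)"
      unfolding G_def
      by (rule has_derivative_eq_rhs[OF has_derivative_diff[OF has_derivative_at_withinI[OF d]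
              has_derivative_add[OF lin lin]]])
        (use \<eta> CS in \<open>auto simp: fun_eq_iff algebra_simps\<close>)
    have "norm (\<eta> - \<theta>0) \<le> norm (\<theta> - \<theta>0)" using \<eta> by (simp add: C_def dist_norm norm_minus_commute)
    then have pq: "\<bar>p \<eta> y - p \<theta>0 y\<bar> \<le> P * norm (\<theta> - \<theta>0)" "\<bar>q \<eta> y - q \<theta>0 y\<bar> \<le> Q * norm (\<theta> - \<theta>0)"
      using p[of \<eta>] q[of \<eta>] \<eta> CS PQ by (meson mult_left_mono order_trans subsetD)+
    show "onorm (\<lambda>h::real^2. h$1 * (p \<eta> y - p \<theta>0 y) + h$2 * (q \<eta> y - q \<theta>0 y)) \<le> (P + Q) * norm (\<theta> - \<theta>0)"
    proof (rule onorm_bound)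
      fix h :: "real^2"
      have "\<bar>h$1 * (p \<eta> y - p \<theta>0 y)\<bar> \<le> norm h * (P * norm (\<theta> - \<theta>0))"
        unfolding abs_mult by (intro mult_mono pq component_le_norm_cart) auto
      moreover have "\<bar>h$2 * (q \<eta> y - q \<theta>0 y)\<bar> \<le> norm h * (Q * norm (\<theta> - \<theta>0))"
        unfolding abs_mult by (intro mult_mono pq component_le_norm_cart) auto
      ultimately show "norm (h$1 * (p \<eta> y - p \<theta>0 y) + h$2 * (q \<eta> y - q \<theta>0 y)) \<le> (P + Q) * norm (\<theta> - \<theta>0) * norm h"
        by (simp add: algebra_simps)
    qed (use PQ in simp)
  qed (simp_all add: C_def dist_norm norm_minus_commute)
  then show ?thesis by (simp add: G_def power2_eq_square algebra_simps)
qed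

section \<open>The maximum likelihood estimator: consistency\<close>

locale folded_normal_mle = prob_space M for M :: "'a measure" +
  fixes Y :: "nat \<Rightarrow> 'a \<Rightarrow> real" and \<theta>0 :: "real^2" and \<Theta> :: "(real^2) set"
    and \<theta>hat :: "nat \<Rightarrow> 'a \<Rightarrow> real^2"
  assumes indep_Y: "indep_vars (\<lambda>_. borel) Y UNIV"
    and Y_distributed: "\<And>i. distributed M lborel (Y i) (\<lambda>y. ennreal (folded_normal_density \<theta>0 y))"
    and \<theta>0: "\<theta>0 $ 1 > 0" "\<theta>0 $ 2 > 0"
    and \<Theta>: "compact \<Theta>" "\<Theta> \<subseteq> {\<theta>. \<theta> $ 1 > 0 \<and> \<theta> $ 2 > 0}" "\<theta>0 \<in> interior \<Theta>"
    and \<theta>hat_measurable [measurable]: "\<And>n. \<theta>hat n \<in> borel_measurable M"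
    and \<theta>hat_arg_max: "\<And>n. n \<ge> 1 \<Longrightarrow> AE \<omega> in M.
           is_arg_max (log_lik (\<lambda>i. Y i \<omega>) n) (\<lambda>\<theta>. \<theta> \<in> \<Theta>) (\<theta>hat n \<omega>)"
begin

sublocale iid_sample M Y "folded_normal \<theta>0"
proof
  show "distr M borel (Y i) = folded_normal \<theta>0" for i
  proof -
    have "distr M borel (Y i) = distr M lborel (Y i)" by (rule distr_cong) auto
    then show ?thesis
      using distributed_distr_eq_density[OF Y_distributed] by (simp add: folded_normal_def)
  qed
qed (rule indep_Y)

definition avg :: "(real \<Rightarrow> real) \<Rightarrow> nat \<Rightarrow> 'a \<Rightarrow> real" where
  "avg g n \<omega> = (\<Sum>i<n. g (Y i \<omega>)) / real n"

lemma avg_add: "avg (\<lambda>y. g y + h y) n \<omega> = avg g n \<omega> + avg h n \<omega>"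
  by (simp add: avg_def sum.distrib add_divide_distrib)

lemma avg_diff: "avg (\<lambda>y. g y - h y) n \<omega> = avg g n \<omega> - avg h n \<omega>"
  by (simp add: avg_def sum_subtractf diff_divide_distrib)

lemma avg_cmult: "avg (\<lambda>y. c * g y) n \<omega> = c * avg g n \<omega>"
  by (simp add: avg_def sum_distrib_left)

lemma avg_mono: "(\<And>y. g y \<le> h y) \<Longrightarrow> avg g n \<omega> \<le> avg h n \<omega>"
  by (auto simp: avg_def intro!: divide_right_mono sum_mono)

lemma avg_abs: "\<bar>avg g n \<omega>\<bar> \<le> avg (\<lambda>y. \<bar>g y\<bar>) n \<omega>"
  by (auto simp: avg_def intro!: divide_right_mono sum_abs)

lemma avg_tendsto:
  assumes "g \<in> borel_measurable borel" "\<And>y. \<bar>g y\<bar> \<le> C * (1 + y\<^sup>2) ^ k"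
  shows "((\<lambda>(n, \<omega>). avg g n \<omega>) \<longlongrightarrow> (\<integral>y. g y \<partial>folded_normal \<theta>0)) in_prob"
  unfolding avg_def
  using weak_law_of_large_numbers[OF assms(1)] integrable_folded_normal_bounded(2)[OF \<theta>0(2) assms] by simp

lemma avg_tendsto_poly_lip:
  assumes "poly_lip S g" "\<theta> \<in> S"
  shows "((\<lambda>(n, \<omega>). avg (g \<theta>) n \<omega>) \<longlongrightarrow> (\<integral>y. g \<theta> y \<partial>folded_normal \<theta>0)) in_prob"
  using poly_lipE[OF assms(1)] avg_tendsto[OF poly_lip_measurable[OF assms]] assms(2) by metis

lemma \<theta>0_mem: "\<theta>0 \<in> \<Theta>" using \<Theta>(3) interior_subset by blast

lemma AE_Y_nonneg: "AE \<omega> in M. \<forall>i. Y i \<omega> \<ge> 0"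
proof (subst AE_all_countable, rule allI)
  fix i
  have "AE y in distr M borel (Y i). y \<ge> 0"
    unfolding distr_Y by (rule AE_folded_normal_nonneg)
  then show "AE \<omega> in M. Y i \<omega> \<ge> 0" by (subst (asm) AE_distr_iff) auto
qed

lemma param_set_\<Theta>: "\<exists>m. param_set \<Theta> m"
proof -
  have "continuous_on \<Theta> (\<lambda>\<theta>. \<theta>$2)" by (intro continuous_intros)
  then obtain \<eta> where "\<eta> \<in> \<Theta>" "\<forall>\<theta>\<in>\<Theta>. \<eta>$2 \<le> \<theta>$2"
    using continuous_attains_inf[OF \<Theta>(1)] \<theta>0_mem by blast
  then show ?thesis using \<Theta> by (intro exI[of _ "\<eta>$2"] param_set.intro compact_imp_bounded) auto
qed

text \<open>Where all observations are nonnegative the log-likelihood is \<open>n\<close> times the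
  average of \<open>log_dens\<close>. The condition \<open>n > 0\<close> allows this factor to be
  cancelled; \<open>\<theta>hat 0\<close> is unconstrained.\<close>

lemma eventually_maximizer:
  "\<forall>\<^sub>F (n, \<omega>) in in_prob. n > 0 \<and> \<theta>hat n \<omega> \<in> \<Theta> \<and>
     (\<forall>\<theta>\<in>\<Theta>. avg (log_dens \<theta>) n \<omega> \<le> avg (log_dens (\<theta>hat n \<omega>)) n \<omega>)"
proof (rule eventually_in_prob_AE, rule eventually_mono[OF eventually_ge_at_top[of 1]])
  fix n :: nat assume n: "1 \<le> n"
  show "AE \<omega> in M. n > 0 \<and> \<theta>hat n \<omega> \<in> \<Theta> \<and>
     (\<forall>\<theta>\<in>\<Theta>. avg (log_dens \<theta>) n \<omega> \<le> avg (log_dens (\<theta>hat n \<omega>)) n \<omega>)"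
    using \<theta>hat_arg_max[OF n] AE_Y_nonneg
  proof eventually_elim
    case (elim \<omega>)
    have L: "log_lik (\<lambda>i. Y i \<omega>) n \<theta> = real n * avg (log_dens \<theta>) n \<omega>" if "\<theta> \<in> \<Theta>" for \<theta>
    proof -
      have "\<theta>$2 > 0" using that \<Theta>(2) by auto
      then show ?thesis
        using n elim(2) by (simp add: log_lik_def avg_def ln_folded_normal_density)
    qed
    show ?case using elim(1) n L by (auto simp: is_arg_max_def not_less)
  qed
qed

theorem consistent: "((\<lambda>(n, \<omega>). \<theta>hat n \<omega>) \<longlongrightarrow> \<theta>0) in_prob"
proof (rule tendstoI)
  fix e :: real assume "e > 0"
  obtain m where "param_set \<Theta> m" using param_set_\<Theta> by blast
  then interpret param_set \<Theta> m .
  obtain C k where C: "C \<ge> 0" "\<And>\<theta> y. \<theta> \<in> \<Theta> \<Longrightarrow> \<bar>log_dens \<theta> y\<bar> \<le> C * (1 + y\<^sup>2) ^ k"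
    "\<And>\<theta> \<theta>' y. \<theta> \<in> \<Theta> \<Longrightarrow> \<theta>' \<in> \<Theta> \<Longrightarrow> \<bar>log_dens \<theta> y - log_dens \<theta>' y\<bar> \<le> C * (1 + y\<^sup>2) ^ k * norm (\<theta> - \<theta>')"
    using poly_lipE[OF poly_lip_model(1)] by metis
  define w where "w = (\<lambda>y::real. C * (1 + y\<^sup>2) ^ k)"
  define W where "W = (\<integral>y. w y \<partial>folded_normal \<theta>0)"
  have w0: "w y \<ge> 0" for y using C(1) by (simp add: w_def)
  have "W \<ge> 0" unfolding W_def using w0 by (intro Bochner_Integration.integral_nonneg)
  have "((\<lambda>(n, \<omega>). avg w n \<omega>) \<longlongrightarrow> W) in_prob"
    unfolding W_def using w0 by (intro avg_tendsto[of w C k]) (auto simp: w_def[abs_def])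
  then have evW: "\<forall>\<^sub>F (n, \<omega>) in in_prob. avg w n \<omega> < W + 1"
    using order_tendstoD(2)[of _ W in_prob "W + 1"] by (simp add: split_def)
  define \<kappa> where "\<kappa> = (\<lambda>\<theta>. \<integral>y. log_dens \<theta>0 y - log_dens \<theta> y \<partial>folded_normal \<theta>0)"
  define K where "K = \<Theta> - ball \<theta>0 e"
  have K: "compact K" using \<Theta>(1) by (simp add: K_def compact_diff)
  have \<kappa>pos: "\<kappa> \<theta> > 0" if "\<theta> \<in> K" for \<theta>
    unfolding \<kappa>_def using that \<Theta>(2) \<theta>0 \<open>e > 0\<close>
    by (intro folded_normal_relative_entropy_pos) (auto simp: K_def)
  \<comment> \<open>On the ball of radius \<open>r \<theta>\<close> the average log-likelihood moves
    by at most \<open>r \<theta> * (W + 2) = \<kappa> \<theta> / 2\<close> once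
    \<open>avg w n \<omega> < W + 1\<close>, while at the centre its deficit against \<theta>0
    exceeds \<open>\<kappa> \<theta> / 2\<close>. So no point of \<Theta> in the ball can be a
    maximizer.\<close>
  define r where "r = (\<lambda>\<theta>. \<kappa> \<theta> / (2 * (W + 2)))"
  have rpos: "r \<theta> > 0" if "\<theta> \<in> K" for \<theta>
    using \<kappa>pos[OF that] \<open>W \<ge> 0\<close> by (simp add: r_def)
  obtain F where F: "F \<subseteq> K" "finite F" "K \<subseteq> (\<Union>\<theta>\<in>F. ball \<theta> (r \<theta>))"
    by (rule compactE_image[OF K, of K "\<lambda>\<theta>. ball \<theta> (r \<theta>)"]) (use rpos in auto)
  have "\<forall>\<^sub>F x in in_prob. \<forall>\<theta>\<in>F. (case x of (n, \<omega>) \<Rightarrow> avg (log_dens \<theta>0) n \<omega> - avg (log_dens \<theta>) n \<omega>) > \<kappa> \<theta> / 2"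
  \<comment> \<open>A limit in probability gives the bound for each centre separately; finiteness of
    \<open>F\<close> makes the bounds hold together.\<close>
  proof (rule eventually_ball_finite[OF F(2)], rule ballI)
    fix \<theta> assume "\<theta> \<in> F"
    then have \<theta>: "\<theta> \<in> K" "\<theta> \<in> \<Theta>" using F by (auto simp: K_def)
    have i: "integrable (folded_normal \<theta>0) (log_dens \<theta>)" "integrable (folded_normal \<theta>0) (log_dens \<theta>0)"
      using poly_lip_integrable[OF poly_lip_model(1) _ \<theta>0(2)] \<theta> \<theta>0_mem by auto
    have "((\<lambda>x. (case x of (n, \<omega>) \<Rightarrow> avg (log_dens \<theta>0) n \<omega>) - (case x of (n, \<omega>) \<Rightarrow> avg (log_dens \<theta>) n \<omega>)) \<longlongrightarrow> \<kappa> \<theta>) in_prob"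
      unfolding \<kappa>_def Bochner_Integration.integral_diff[OF i(2,1)]
      by (intro tendsto_diff avg_tendsto_poly_lip[OF poly_lip_model(1)] \<theta> \<theta>0_mem)
    from order_tendstoD(1)[OF this, of "\<kappa> \<theta> / 2"] \<kappa>pos[OF \<theta>(1)]
    show "\<forall>\<^sub>F x in in_prob. (case x of (n, \<omega>) \<Rightarrow> avg (log_dens \<theta>0) n \<omega> - avg (log_dens \<theta>) n \<omega>) > \<kappa> \<theta> / 2"
      by (simp add: split_def)
  qed
  with evW eventually_maximizer
  show "\<forall>\<^sub>F x in in_prob. dist (case x of (n, \<omega>) \<Rightarrow> \<theta>hat n \<omega>) \<theta>0 < e"
  proof eventually_elim
    case (elim x)
    obtain n \<omega> where x: "x = (n, \<omega>)" by (cases x)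
    have mx: "n > 0" "\<theta>hat n \<omega> \<in> \<Theta>" "avg (log_dens \<theta>0) n \<omega> \<le> avg (log_dens (\<theta>hat n \<omega>)) n \<omega>"
      and aw: "avg w n \<omega> < W + 1"
      and F': "\<And>\<theta>. \<theta> \<in> F \<Longrightarrow> avg (log_dens \<theta>0) n \<omega> - avg (log_dens \<theta>) n \<omega> > \<kappa> \<theta> / 2"
      using elim \<theta>0_mem by (auto simp: x)
    show ?case
    proof (rule ccontr)
      assume "\<not> ?thesis"
      then have "\<theta>hat n \<omega> \<in> K" using mx by (auto simp: K_def x dist_commute)
      then obtain \<theta> where \<theta>: "\<theta> \<in> F" "dist \<theta> (\<theta>hat n \<omega>) < r \<theta>" using F(3) by auto
      then have \<theta>': "\<theta> \<in> K" "\<theta> \<in> \<Theta>" using F by (auto simp: K_def)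
      have "\<bar>avg (\<lambda>y. log_dens (\<theta>hat n \<omega>) y - log_dens \<theta> y) n \<omega>\<bar>
          \<le> avg (\<lambda>y. \<bar>log_dens (\<theta>hat n \<omega>) y - log_dens \<theta> y\<bar>) n \<omega>"
        by (rule avg_abs)
      also have "\<dots> \<le> avg (\<lambda>y. r \<theta> * w y) n \<omega>"
      proof (rule avg_mono)
        fix y
        have "\<bar>log_dens (\<theta>hat n \<omega>) y - log_dens \<theta> y\<bar> \<le> w y * norm (\<theta>hat n \<omega> - \<theta>)"
          unfolding w_def by (rule C(3)[OF mx(2) \<theta>'(2)])
        also have "\<dots> \<le> w y * r \<theta>"
          using \<theta>(2) w0 by (intro mult_left_mono) (auto simp: dist_norm norm_minus_commute)
        finally show "\<bar>log_dens (\<theta>hat n \<omega>) y - log_dens \<theta> y\<bar> \<le> r \<theta> * w y" by (simp add: mult.commute)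
      qed
      also have "\<dots> = r \<theta> * avg w n \<omega>" by (rule avg_cmult)
      also have "\<dots> \<le> r \<theta> * (W + 2)"
        using aw rpos[OF \<theta>'(1)] by (intro mult_left_mono) auto
      also have "\<dots> = \<kappa> \<theta> / 2" using \<open>W \<ge> 0\<close> by (simp add: r_def field_simps)
      finally show False using F'[OF \<theta>(1)] mx(3) unfolding avg_diff by linarith
    qed
  qed
qed

end

section \<open>The linear representation and the limit law\<close>

context folded_normal_mle
begin

text \<open>The score need vanish only at an interior maximizer, hence the open set
  \<open>B\<close>; consistency places the estimator in such a set with probability tending to
  one.\<close>

lemma avg_score_maximizer:
  assumes "open B" "\<eta> \<in> B" "B \<subseteq> \<Theta>" "\<And>\<theta>. \<theta> \<in> \<Theta> \<Longrightarrow> avg (log_dens \<theta>) n \<omega> \<le> avg (log_dens \<eta>) n \<omega>"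
  shows "avg (score1 \<eta>) n \<omega> = 0" "avg (score2 \<eta>) n \<omega> = 0"
proof -
  have "\<eta>$2 > 0" using assms \<Theta>(2) by auto
  then have "((\<lambda>\<theta>. 1 / real n * (\<Sum>i<n. log_dens \<theta> (Y i \<omega>))) has_derivative
      (\<lambda>h. 1 / real n * (\<Sum>i<n. h$1 * score1 \<eta> (Y i \<omega>) + h$2 * score2 \<eta> (Y i \<omega>)))) (at \<eta>)"
    by (intro has_derivative_mult_right has_derivative_sum has_derivative_log_dens)
  also have "(\<lambda>\<theta>. 1 / real n * (\<Sum>i<n. log_dens \<theta> (Y i \<omega>))) = (\<lambda>\<theta>. avg (log_dens \<theta>) n \<omega>)"
    by (simp add: avg_def)
  finally have "(\<lambda>h. 1 / real n * (\<Sum>i<n. h$1 * score1 \<eta> (Y i \<omega>) + h$2 * score2 \<eta> (Y i \<omega>))) = (\<lambda>h::real^2. 0)"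
    using assms by (intro differential_zero_maxmin[of \<eta> B]) auto
  from fun_cong[OF this, of "axis 1 1"] fun_cong[OF this, of "axis 2 1"]
  show "avg (score1 \<eta>) n \<omega> = 0" "avg (score2 \<eta>) n \<omega> = 0"
    by (auto simp: avg_def axis_def)
qed

text \<open>The error is measured against the norm of the estimation error, as no rate is known yet.
  The factor \<open>\<delta>\<close> collects the deviations of the averaged Hessian from its mean,
  and the averaged Lipschitz weights times \<open>norm (\<theta>hat n \<omega> - \<theta>0)\<close>;
  it vanishes in the limit by the law of large numbers and consistency.\<close>

lemma score_expansion:
  obtains \<delta> :: "nat \<Rightarrow> 'a \<Rightarrow> real"
  where "((\<lambda>(n, \<omega>). \<delta> n \<omega>) \<longlongrightarrow> 0) in_prob"
    and "\<forall>\<^sub>F (n, \<omega>) in in_prob. n > 0 \<and>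
      norm (info_mat \<theta>0 *v (\<theta>hat n \<omega> - \<theta>0) - vector [avg (score1 \<theta>0) n \<omega>, avg (score2 \<theta>0) n \<omega>])
        \<le> \<delta> n \<omega> * norm (\<theta>hat n \<omega> - \<theta>0)"
proof -
  obtain \<rho> where \<rho>: "\<rho> > 0" "cball \<theta>0 \<rho> \<subseteq> \<Theta>"
    using \<Theta>(3) by (auto simp: mem_interior_cball)
  obtain m where "param_set \<Theta> m" using param_set_\<Theta> by blast
  then interpret param_set \<Theta> m .
  have lip: "\<exists>w. w \<in> borel_measurable borel \<and> (\<exists>C k. \<forall>y. \<bar>w y\<bar> \<le> C * (1 + y\<^sup>2) ^ k) \<and> (\<forall>y. w y \<ge> 0) \<and>
      (\<forall>\<theta>\<in>\<Theta>. \<forall>y. \<bar>g \<theta> y - g \<theta>0 y\<bar> \<le> w y * norm (\<theta> - \<theta>0))" if g: "poly_lip \<Theta> g" for g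
  proof -
    obtain C k where C: "C \<ge> 0"
      "\<And>\<theta> \<theta>' y. \<theta> \<in> \<Theta> \<Longrightarrow> \<theta>' \<in> \<Theta> \<Longrightarrow> \<bar>g \<theta> y - g \<theta>' y\<bar> \<le> C * (1 + y\<^sup>2) ^ k * norm (\<theta> - \<theta>')"
      using poly_lipE[OF g] by metis
    define w where "w = (\<lambda>y::real. C * (1 + y\<^sup>2) ^ k)"
    have "w \<in> borel_measurable borel" unfolding w_def by measurable
    moreover have "\<forall>y. \<bar>w y\<bar> \<le> C * (1 + y\<^sup>2) ^ k" "\<forall>y. w y \<ge> 0" using C(1) by (auto simp: w_def)
    moreover have "\<forall>\<theta>\<in>\<Theta>. \<forall>y. \<bar>g \<theta> y - g \<theta>0 y\<bar> \<le> w y * norm (\<theta> - \<theta>0)"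
      using C(2) \<theta>0_mem by (auto simp: w_def)
    ultimately show ?thesis by blast
  qed
  obtain w1 C1 k1 where w1: "w1 \<in> borel_measurable borel" "\<And>y. \<bar>w1 y\<bar> \<le> C1 * (1 + y\<^sup>2) ^ k1" "\<And>y. w1 y \<ge> 0"
    "\<And>\<theta> y. \<theta> \<in> \<Theta> \<Longrightarrow> \<bar>hess11 \<theta> y - hess11 \<theta>0 y\<bar> \<le> w1 y * norm (\<theta> - \<theta>0)"
    using lip[OF poly_lip_model(4)] by metis
  obtain w2 C2 k2 where w2: "w2 \<in> borel_measurable borel" "\<And>y. \<bar>w2 y\<bar> \<le> C2 * (1 + y\<^sup>2) ^ k2" "\<And>y. w2 y \<ge> 0"
    "\<And>\<theta> y. \<theta> \<in> \<Theta> \<Longrightarrow> \<bar>hess12 \<theta> y - hess12 \<theta>0 y\<bar> \<le> w2 y * norm (\<theta> - \<theta>0)"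
    using lip[OF poly_lip_model(5)] by metis
  obtain w3 C3 k3 where w3: "w3 \<in> borel_measurable borel" "\<And>y. \<bar>w3 y\<bar> \<le> C3 * (1 + y\<^sup>2) ^ k3" "\<And>y. w3 y \<ge> 0"
    "\<And>\<theta> y. \<theta> \<in> \<Theta> \<Longrightarrow> \<bar>hess22 \<theta> y - hess22 \<theta>0 y\<bar> \<le> w3 y * norm (\<theta> - \<theta>0)"
    using lip[OF poly_lip_model(6)] by metis
  let ?A = "\<lambda>g x. avg g (fst x) (snd x)"
  have W: "(?A w1 \<longlongrightarrow> (\<integral>y. w1 y \<partial>folded_normal \<theta>0)) in_prob" "(?A w2 \<longlongrightarrow> (\<integral>y. w2 y \<partial>folded_normal \<theta>0)) in_prob"
    "(?A w3 \<longlongrightarrow> (\<integral>y. w3 y \<partial>folded_normal \<theta>0)) in_prob"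
    using avg_tendsto[OF w1(1,2)] avg_tendsto[OF w2(1,2)] avg_tendsto[OF w3(1,2)] by (simp_all add: split_def)
  have H: "(?A (hess11 \<theta>0) \<longlongrightarrow> - info11 \<theta>0) in_prob" "(?A (hess12 \<theta>0) \<longlongrightarrow> - info12 \<theta>0) in_prob"
    "(?A (hess22 \<theta>0) \<longlongrightarrow> - info22 \<theta>0) in_prob"
    using avg_tendsto_poly_lip[OF poly_lip_model(4) \<theta>0_mem] avg_tendsto_poly_lip[OF poly_lip_model(5) \<theta>0_mem]
      avg_tendsto_poly_lip[OF poly_lip_model(6) \<theta>0_mem] score_moments(3-5)[OF \<theta>0(2)]
    by (simp_all add: split_def has_bochner_integral_iff)
  have T: "((\<lambda>x. \<theta>hat (fst x) (snd x)) \<longlongrightarrow> \<theta>0) in_prob" using consistent by (simp add: split_def)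
  \<comment> \<open>Off-diagonal terms carry the factor 2 because they enter both components of the
    error vector.\<close>
  define \<delta> where "\<delta> = (\<lambda>n \<omega>. \<bar>avg (hess11 \<theta>0) n \<omega> + info11 \<theta>0\<bar> + 2 * \<bar>avg (hess12 \<theta>0) n \<omega> + info12 \<theta>0\<bar>
    + \<bar>avg (hess22 \<theta>0) n \<omega> + info22 \<theta>0\<bar> + (avg w1 n \<omega> + 2 * avg w2 n \<omega> + avg w3 n \<omega>) * norm (\<theta>hat n \<omega> - \<theta>0))"
  show thesis
  proof (rule that)
    show "((\<lambda>(n, \<omega>). \<delta> n \<omega>) \<longlongrightarrow> 0) in_prob"
      unfolding \<delta>_def split_def by (rule tendsto_eq_intros W H T refl | simp)+
    have "\<forall>\<^sub>F (n, \<omega>) in in_prob. dist (\<theta>hat n \<omega>) \<theta>0 < \<rho>"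
      using tendstoD[OF consistent \<rho>(1)] by (simp add: split_def)
    with eventually_maximizer
    show "\<forall>\<^sub>F (n, \<omega>) in in_prob. n > 0 \<and>
      norm (info_mat \<theta>0 *v (\<theta>hat n \<omega> - \<theta>0) - vector [avg (score1 \<theta>0) n \<omega>, avg (score2 \<theta>0) n \<omega>])
        \<le> \<delta> n \<omega> * norm (\<theta>hat n \<omega> - \<theta>0)"
    proof eventually_elim
      case (elim x)
      obtain n \<omega> where x: "x = (n, \<omega>)" by (cases x)
      define h where "h = \<theta>hat n \<omega> - \<theta>0"
      define r where "r = norm h"
      have n: "n > 0" and mem: "\<theta>hat n \<omega> \<in> ball \<theta>0 \<rho>"
        and mx: "\<And>\<theta>. \<theta> \<in> \<Theta> \<Longrightarrow> avg (log_dens \<theta>) n \<omega> \<le> avg (log_dens (\<theta>hat n \<omega>)) n \<omega>"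
        using elim by (auto simp: x dist_commute)
      have ball: "ball \<theta>0 \<rho> \<subseteq> \<Theta>" using \<rho>(2) ball_subset_cball by blast
      note s0 = avg_score_maximizer[OF open_ball mem ball mx]
      have pos: "\<eta>$2 > 0" if "\<eta> \<in> \<Theta>" for \<eta> using that \<Theta>(2) by auto
      have mem': "\<theta>hat n \<omega> \<in> cball \<theta>0 \<rho>" using mem by auto
      \<comment> \<open>Remainder estimate for one score component, used below with each row of the
        Hessian; the score at the maximizer drops out by \<open>s0\<close>.\<close>
      have R: "\<bar>avg (s \<theta>0) n \<omega> + h$1 * avg (p \<theta>0) n \<omega> + h$2 * avg (q \<theta>0) n \<omega>\<bar> \<le> (avg P n \<omega> + avg Q n \<omega>) * r\<^sup>2"
        if s0: "avg (s (\<theta>hat n \<omega>)) n \<omega> = 0"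
        and d: "\<And>\<eta> y. \<eta> \<in> \<Theta> \<Longrightarrow> ((\<lambda>\<theta>. s \<theta> y) has_derivative (\<lambda>h. h$1 * p \<eta> y + h$2 * q \<eta> y)) (at \<eta>)"
        and P: "\<And>\<theta> y. \<theta> \<in> \<Theta> \<Longrightarrow> \<bar>p \<theta> y - p \<theta>0 y\<bar> \<le> P y * norm (\<theta> - \<theta>0)"
        and Q: "\<And>\<theta> y. \<theta> \<in> \<Theta> \<Longrightarrow> \<bar>q \<theta> y - q \<theta>0 y\<bar> \<le> Q y * norm (\<theta> - \<theta>0)"
        and PQ: "\<And>y. P y \<ge> 0" "\<And>y. Q y \<ge> 0"
        for s p q :: "real^2 \<Rightarrow> real \<Rightarrow> real" and P Q :: "real \<Rightarrow> real"
      proof -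
        have "avg (s \<theta>0) n \<omega> + h$1 * avg (p \<theta>0) n \<omega> + h$2 * avg (q \<theta>0) n \<omega>
            = - avg (\<lambda>y. s (\<theta>hat n \<omega>) y - s \<theta>0 y - (h$1 * p \<theta>0 y + h$2 * q \<theta>0 y)) n \<omega>"
          by (simp add: avg_diff avg_add avg_cmult s0)
        also have "\<bar>\<dots>\<bar> \<le> avg (\<lambda>y. \<bar>s (\<theta>hat n \<omega>) y - s \<theta>0 y - (h$1 * p \<theta>0 y + h$2 * q \<theta>0 y)\<bar>) n \<omega>"
          using avg_abs by simp
        also have "\<dots> \<le> avg (\<lambda>y. r\<^sup>2 * (P y + Q y)) n \<omega>"
        proof (rule avg_mono)
          fix y
          show "\<bar>s (\<theta>hat n \<omega>) y - s \<theta>0 y - (h$1 * p \<theta>0 y + h$2 * q \<theta>0 y)\<bar> \<le> r\<^sup>2 * (P y + Q y)"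
            using score_taylor[where g=s and p=p and q=q and y=y and P="P y" and Q="Q y",
                OF \<rho>(2) mem' d P Q PQ]
            by (simp only: h_def r_def mult.commute)
        qed
        also have "\<dots> = (avg P n \<omega> + avg Q n \<omega>) * r\<^sup>2" unfolding avg_cmult avg_add by simp
        finally show ?thesis .
      qed
      define a11 a12 a22 where "a11 = avg (hess11 \<theta>0) n \<omega>" and "a12 = avg (hess12 \<theta>0) n \<omega>" and "a22 = avg (hess22 \<theta>0) n \<omega>"
      define u where "u = info_mat \<theta>0 *v h - vector [avg (score1 \<theta>0) n \<omega>, avg (score2 \<theta>0) n \<omega>]"
      have R1: "\<bar>avg (score1 \<theta>0) n \<omega> + h$1 * a11 + h$2 * a12\<bar> \<le> (avg w1 n \<omega> + avg w2 n \<omega>) * r\<^sup>2"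
        unfolding a11_def a12_def
        by (rule R[OF s0(1) has_derivative_score(1)[OF pos] w1(4) w2(4) w1(3) w2(3)])
      have R2: "\<bar>avg (score2 \<theta>0) n \<omega> + h$1 * a12 + h$2 * a22\<bar> \<le> (avg w2 n \<omega> + avg w3 n \<omega>) * r\<^sup>2"
        unfolding a22_def a12_def
        by (rule R[OF s0(2) has_derivative_score(2)[OF pos] w2(4) w3(4) w2(3) w3(3)])
      have hc: "\<bar>h$i * e\<bar> \<le> r * \<bar>e\<bar>" for i e
        unfolding abs_mult r_def by (intro mult_right_mono component_le_norm_cart) auto
      \<comment> \<open>Adding and subtracting the averaged Hessian splits each component into the
        deviation of the Hessian from its mean and the Taylor remainder.\<close>
      have u1: "u$1 = h$1 * (a11 + info11 \<theta>0) + h$2 * (a12 + info12 \<theta>0) - (avg (score1 \<theta>0) n \<omega> + h$1 * a11 + h$2 * a12)"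
        and u2: "u$2 = h$1 * (a12 + info12 \<theta>0) + h$2 * (a22 + info22 \<theta>0) - (avg (score2 \<theta>0) n \<omega> + h$1 * a12 + h$2 * a22)"
        by (simp_all add: u_def info_mat_def matrix_vector_mult_def sum_2 algebra_simps)
      have "norm u \<le> \<bar>u$1\<bar> + \<bar>u$2\<bar>" using norm_le_l1_cart[of u] by (simp add: sum_2)
      also have "\<bar>u$1\<bar> \<le> r * \<bar>a11 + info11 \<theta>0\<bar> + r * \<bar>a12 + info12 \<theta>0\<bar> + (avg w1 n \<omega> + avg w2 n \<omega>) * r\<^sup>2"
        unfolding u1 using R1 hc[of 1 "a11 + info11 \<theta>0"] hc[of 2 "a12 + info12 \<theta>0"] by linarith
      also have "\<bar>u$2\<bar> \<le> r * \<bar>a12 + info12 \<theta>0\<bar> + r * \<bar>a22 + info22 \<theta>0\<bar> + (avg w2 n \<omega> + avg w3 n \<omega>) * r\<^sup>2"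
        unfolding u2 using R2 hc[of 1 "a12 + info12 \<theta>0"] hc[of 2 "a22 + info22 \<theta>0"] by linarith
      finally have "norm u \<le> \<delta> n \<omega> * r"
        unfolding \<delta>_def h_def[symmetric] r_def[symmetric] a11_def[symmetric] a12_def[symmetric] a22_def[symmetric]
        by (simp add: algebra_simps power2_eq_square)
      then show ?case using n by (simp add: x u_def r_def h_def)
    qed
  qed
qed

text \<open>Formed with \<open>score1\<close> and \<open>score2\<close>, which have closed forms for
  all \<open>y\<close>; it agrees with the expression in \<open>score\<close> when the observations
  are nonnegative.\<close>

definition influence :: "nat \<Rightarrow> 'a \<Rightarrow> real^2" where
  "influence n \<omega> = matrix_inv (info_mat \<theta>0) *v
     ((1 / sqrt (real n)) *\<^sub>R (\<Sum>i<n. vector [score1 \<theta>0 (Y i \<omega>), score2 \<theta>0 (Y i \<omega>)]))"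

lemma det_info_mat: "det (info_mat \<theta>0) > 0"
  using info_det_pos(2)[OF \<theta>0] by (simp add: det_2 info_mat_nth)

lemma invertible_info_mat: "invertible (info_mat \<theta>0)"
  using det_info_mat by (simp add: invertible_det_nz)

lemma measurable_influence [measurable]: "influence n \<in> borel_measurable M"
  unfolding influence_def[abs_def] by measurable

text \<open>A bound on the operator norm of the inverse matrix reduces the claim to the two score
  components, whose sums have variance proportional to \<open>n\<close>; the normalization cancels
  this growth.\<close>

lemma influence_second_moment:
  "\<exists>C. \<forall>n. integrable M (\<lambda>\<omega>. (norm (influence n \<omega>))\<^sup>2) \<and>
    expectation (\<lambda>\<omega>. (norm (influence n \<omega>))\<^sup>2) \<le> C"
proof -
  obtain c where c: "c > 0" "\<And>v. norm (matrix_inv (info_mat \<theta>0) *v v) \<le> norm v * c"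
    using bounded_linear.pos_bounded[OF matrix_vector_mul_bounded_linear] by blast
  let ?S = "\<lambda>g n \<omega>. \<Sum>i<n. g (Y i \<omega>)"
  let ?B = "\<lambda>n \<omega>. c\<^sup>2 / real n * ((?S (score1 \<theta>0) n \<omega>)\<^sup>2 + (?S (score2 \<theta>0) n \<omega>)\<^sup>2)"
  have le: "(norm (influence n \<omega>))\<^sup>2 \<le> ?B n \<omega>" for n \<omega>
  proof -
    let ?v = "(1 / sqrt (real n)) *\<^sub>R (\<Sum>i<n. vector [score1 \<theta>0 (Y i \<omega>), score2 \<theta>0 (Y i \<omega>)]) :: real^2"
    have "(norm (influence n \<omega>))\<^sup>2 \<le> (norm ?v * c)\<^sup>2"
      unfolding influence_def by (intro power_mono c) auto
    also have "\<dots> = c\<^sup>2 * (?v \<bullet> ?v)" by (simp only: power_mult_distrib dot_square_norm mult.commute)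
    also have "\<dots> = ?B n \<omega>"
      by (simp add: inner_vec_def sum_2 power2_eq_square field_simps add_divide_distrib real_sqrt_mult_self)
    finally show ?thesis .
  qed
  have s1: "integrable (folded_normal \<theta>0) (\<lambda>y. (score1 \<theta>0 y)\<^sup>2)" "(\<integral>y. (score1 \<theta>0 y)\<^sup>2 \<partial>folded_normal \<theta>0) = info11 \<theta>0"
    "(\<integral>y. score1 \<theta>0 y \<partial>folded_normal \<theta>0) = 0"
    and s2: "integrable (folded_normal \<theta>0) (\<lambda>y. (score2 \<theta>0 y)\<^sup>2)" "(\<integral>y. (score2 \<theta>0 y)\<^sup>2 \<partial>folded_normal \<theta>0) = info22 \<theta>0"
    "(\<integral>y. score2 \<theta>0 y \<partial>folded_normal \<theta>0) = 0"
    using score_moments(1,2,6,8)[OF \<theta>0(2)] by (auto simp: has_bochner_integral_iff power2_eq_square)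
  note S1 = second_moment_sum[OF measurable_model(2) s1(1,3), unfolded s1(2)]
  note S2 = second_moment_sum[OF measurable_model(3) s2(1,3), unfolded s2(2)]
  have Bi: "integrable M (?B n)" for n using S1(1) S2(1) by simp
  have i: "integrable M (\<lambda>\<omega>. (norm (influence n \<omega>))\<^sup>2)" for n
    by (rule Bochner_Integration.integrable_bound[OF Bi[of n]]) (use le in \<open>auto intro: order_trans abs_ge_self\<close>)
  moreover have "expectation (\<lambda>\<omega>. (norm (influence n \<omega>))\<^sup>2) \<le> c\<^sup>2 * (info11 \<theta>0 + info22 \<theta>0)" for n
  proof -
    have "expectation (\<lambda>\<omega>. (norm (influence n \<omega>))\<^sup>2) \<le> expectation (?B n)"
      using i Bi le by (rule integral_mono)
    also have "\<dots> = c\<^sup>2 / real n * (real n * info11 \<theta>0 + real n * info22 \<theta>0)"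
      using S1 S2 by simp
    also have "\<dots> \<le> c\<^sup>2 * (info11 \<theta>0 + info22 \<theta>0)"
      \<comment> \<open>For \<open>n = 0\<close> the left-hand side is 0 by the convention for
        division by zero, and the right-hand side is nonnegative.\<close>
      using info_pos_def[OF \<theta>0, of 1 0] info_pos_def[OF \<theta>0, of 0 1] by (cases "n = 0") (auto simp: field_simps)
    finally show ?thesis .
  qed
  ultimately show ?thesis by blast
qed

text \<open>With D the estimation error and J S the linear term, the expansion gives |D - J S| \<le>
  c |\<delta>| |D|. Once 2 c |\<delta>| < 1 this implies |D| \<le> 2 |J S|, so the error is at most
  2 c |\<delta>| |J S|. Scaled by sqrt n, the last norm becomes that of \<open>influence\<close>,
  whose second moments are bounded.\<close>

theorem asymptotically_linear:
  "((\<lambda>(n, \<omega>). sqrt (real n) *\<^sub>R (\<theta>hat n \<omega> - \<theta>0) - influence n \<omega>) \<longlongrightarrow> 0) in_prob"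
proof -
  obtain \<delta> where \<delta>: "((\<lambda>(n, \<omega>). \<delta> n \<omega>) \<longlongrightarrow> 0) in_prob"
    "\<forall>\<^sub>F (n, \<omega>) in in_prob. n > 0 \<and>
      norm (info_mat \<theta>0 *v (\<theta>hat n \<omega> - \<theta>0) - vector [avg (score1 \<theta>0) n \<omega>, avg (score2 \<theta>0) n \<omega>])
        \<le> \<delta> n \<omega> * norm (\<theta>hat n \<omega> - \<theta>0)"
    by (rule score_expansion)
  obtain c where c: "c > 0" "\<And>v. norm (matrix_inv (info_mat \<theta>0) *v v) \<le> norm v * c"
    using bounded_linear.pos_bounded[OF matrix_vector_mul_bounded_linear] by blast
  obtain C where C: "\<And>n. integrable M (\<lambda>\<omega>. (norm (influence n \<omega>))\<^sup>2)"
    "\<And>n. expectation (\<lambda>\<omega>. (norm (influence n \<omega>))\<^sup>2) \<le> C"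
    using influence_second_moment by blast
  have R: "((\<lambda>(n, \<omega>). 2 * c * \<bar>\<delta> n \<omega>\<bar>) \<longlongrightarrow> 0) in_prob"
    using tendsto_mult_left[OF tendsto_rabs[OF \<delta>(1)], of "2 * c"] by (simp add: split_def)
  have lim: "((\<lambda>(n, \<omega>). 2 * c * \<bar>\<delta> n \<omega>\<bar> * norm (influence n \<omega>)) \<longlongrightarrow> 0) in_prob"
    by (rule tendsto_mult_bounded_second_moment[OF R measurable_influence C])
  have "\<forall>\<^sub>F (n, \<omega>) in in_prob. 2 * c * \<bar>\<delta> n \<omega>\<bar> < 1"
    using order_tendstoD(2)[OF R zero_less_one] by (simp add: split_def)
  with \<delta>(2) have "\<forall>\<^sub>F x in in_prob. norm (case x of (n, \<omega>) \<Rightarrow> sqrt (real n) *\<^sub>R (\<theta>hat n \<omega> - \<theta>0) - influence n \<omega>)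
      \<le> (case x of (n, \<omega>) \<Rightarrow> 2 * c * \<bar>\<delta> n \<omega>\<bar> * norm (influence n \<omega>))"
  proof eventually_elim
    case (elim x)
    obtain n \<omega> where x: "x = (n, \<omega>)" by (cases x)
    define D S where "D = \<theta>hat n \<omega> - \<theta>0" and "S = (vector [avg (score1 \<theta>0) n \<omega>, avg (score2 \<theta>0) n \<omega>] :: real^2)"
    define J where "J = matrix_inv (info_mat \<theta>0)"
    have n: "n > 0" and e: "norm (info_mat \<theta>0 *v D - S) \<le> \<delta> n \<omega> * norm D" and small: "2 * c * \<bar>\<delta> n \<omega>\<bar> < 1"
      using elim by (auto simp: x D_def S_def)
    have "J *v (info_mat \<theta>0 *v D) = D"
      using matrix_inv_mult(2)[OF invertible_info_mat] by (simp add: matrix_vector_mul_assoc J_def)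
    then have "D - J *v S = J *v (info_mat \<theta>0 *v D - S)"
      by (simp add: matrix_vector_mult_diff_distrib)
    then have "norm (D - J *v S) \<le> norm (info_mat \<theta>0 *v D - S) * c"
      using c(2) by (simp add: J_def)
    also have "\<dots> \<le> (\<bar>\<delta> n \<omega>\<bar> * norm D) * c"
      using e c(1) by (intro mult_right_mono order_trans[OF e]) (auto intro: mult_right_mono)
    finally have 1: "norm (D - J *v S) \<le> c * \<bar>\<delta> n \<omega>\<bar> * norm D" by (simp add: mult_ac)
    have "c * \<bar>\<delta> n \<omega>\<bar> * norm D \<le> 1 / 2 * norm D" using small by (intro mult_right_mono) auto
    then have "norm D \<le> 2 * norm (J *v S)"
      using 1 norm_triangle_ineq[of "D - J *v S" "J *v S"] by simp
    then have "c * \<bar>\<delta> n \<omega>\<bar> * norm D \<le> c * \<bar>\<delta> n \<omega>\<bar> * (2 * norm (J *v S))"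
      using c(1) by (intro mult_left_mono) auto
    with 1 have 2: "norm (D - J *v S) \<le> 2 * c * \<bar>\<delta> n \<omega>\<bar> * norm (J *v S)" by simp
    have "(1 / sqrt (real n)) *\<^sub>R (\<Sum>i<n. vector [score1 \<theta>0 (Y i \<omega>), score2 \<theta>0 (Y i \<omega>)]) = sqrt (real n) *\<^sub>R S"
      using n by (simp add: S_def vec_eq_iff forall_2 avg_def real_div_sqrt field_simps)
    then have inf: "influence n \<omega> = sqrt (real n) *\<^sub>R (J *v S)"
      by (simp add: influence_def J_def matrix_vector_mult_scaleR)
    have "norm (sqrt (real n) *\<^sub>R D - influence n \<omega>) = sqrt (real n) * norm (D - J *v S)"
      unfolding inf scaleR_diff_right[symmetric] by simp
    also have "\<dots> \<le> sqrt (real n) * (2 * c * \<bar>\<delta> n \<omega>\<bar> * norm (J *v S))"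
      by (intro mult_left_mono 2) auto
    also have "\<dots> = 2 * c * \<bar>\<delta> n \<omega>\<bar> * norm (influence n \<omega>)" by (simp add: inf)
    finally show ?case by (simp add: x D_def)
  qed
  then show ?thesis by (rule Lim_null_comparison[OF _ lim])
qed

text \<open>Cramer-Wold reduction: by symmetry of the information matrix,
  \<open>t \<bullet> influence n \<omega>\<close> is a normalized sum of the score combination with
  coefficients \<open>w\<close>, the inverse information applied to \<open>t\<close>. Its variance
  \<open>t \<bullet> w\<close> is that of the limit law in direction \<open>t\<close>.\<close>

theorem asymptotically_normal:
  "tendsto_in_distr M (\<lambda>n \<omega>. sqrt (real n) *\<^sub>R (\<theta>hat n \<omega> - \<theta>0))
     (multivariate_normal 0 (matrix_inv (info_mat \<theta>0)))"
proof -
  obtain C where C: "\<And>n. integrable M (\<lambda>\<omega>. (norm (influence n \<omega>))\<^sup>2)"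
    "\<And>n. expectation (\<lambda>\<omega>. (norm (influence n \<omega>))\<^sup>2) \<le> C"
    using influence_second_moment by blast
  let ?I = "info_mat \<theta>0"
  let ?N = "multivariate_normal 0 (matrix_inv ?I)"
  have A: "?I$2$1 = ?I$1$2" "?I$1$1 > 0" "det ?I > 0"
    using info_det_pos(1)[OF \<theta>0] det_info_mat by (simp_all add: info_mat_nth)
  show ?thesis
  proof (rule tendsto_in_distr_trigI[OF _ measurable_influence asymptotically_linear C])
    show "prob_space ?N" by (rule prob_space_multivariate_normal_2[OF A])
    show "sets ?N = sets borel" by (simp add: multivariate_normal_def)
    fix t :: "real^2" and c :: real
    define w where "w = matrix_inv ?I *v t"
    have t: "t = ?I *v w"
      using matrix_inv_mult(1)[OF invertible_info_mat] by (simp add: w_def matrix_vector_mul_assoc)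
    define g where "g = (\<lambda>y. w$1 * score1 \<theta>0 y + w$2 * score2 \<theta>0 y)"
    have [measurable]: "g \<in> borel_measurable borel" unfolding g_def by measurable
    have tJ: "t \<bullet> (matrix_inv ?I *v v) = w \<bullet> v" for v
    proof -
      have "(?I *v w) \<bullet> z = w \<bullet> (?I *v z)" for z
        by (simp add: inner_vec_def sum_2 matrix_vector_mult_def info_mat_nth algebra_simps)
      then show ?thesis
        using matrix_inv_mult(1)[OF invertible_info_mat] by (simp add: t matrix_vector_mul_assoc)
    qed
    have tg: "t \<bullet> influence n \<omega> = (\<Sum>i<n. g (Y i \<omega>)) / sqrt (real n)" for n \<omega>
      unfolding influence_def tJ
      by (simp add: inner_vec_def sum_2 g_def sum.distrib sum_distrib_left[symmetric] add_divide_distrib)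
    have "has_bochner_integral (folded_normal \<theta>0) g (w$1 * 0 + w$2 * 0)"
      unfolding g_def by (intro has_bochner_integral_add has_bochner_integral_mult_right score_moments \<theta>0)
    then have g0: "(\<integral>y. g y \<partial>folded_normal \<theta>0) = 0" by (simp add: has_bochner_integral_iff)
    have "has_bochner_integral (folded_normal \<theta>0)
        (\<lambda>y. (w$1)\<^sup>2 * (score1 \<theta>0 y * score1 \<theta>0 y) + (2 * w$1 * w$2) * (score1 \<theta>0 y * score2 \<theta>0 y) + (w$2)\<^sup>2 * (score2 \<theta>0 y * score2 \<theta>0 y))
        ((w$1)\<^sup>2 * info11 \<theta>0 + (2 * w$1 * w$2) * info12 \<theta>0 + (w$2)\<^sup>2 * info22 \<theta>0)"
      by (intro has_bochner_integral_add has_bochner_integral_mult_right score_moments \<theta>0)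
    also have "(\<lambda>y. (w$1)\<^sup>2 * (score1 \<theta>0 y * score1 \<theta>0 y) + (2 * w$1 * w$2) * (score1 \<theta>0 y * score2 \<theta>0 y) + (w$2)\<^sup>2 * (score2 \<theta>0 y * score2 \<theta>0 y))
        = (\<lambda>y. (g y)\<^sup>2)"
      by (simp add: fun_eq_iff g_def power2_eq_square algebra_simps)
    finally have g2: "integrable (folded_normal \<theta>0) (\<lambda>y. (g y)\<^sup>2)"
      "(\<integral>y. (g y)\<^sup>2 \<partial>folded_normal \<theta>0) = (w$1)\<^sup>2 * info11 \<theta>0 + 2 * w$1 * w$2 * info12 \<theta>0 + (w$2)\<^sup>2 * info22 \<theta>0"
      by (auto simp: has_bochner_integral_iff)
    have tw: "t \<bullet> w = (\<integral>y. (g y)\<^sup>2 \<partial>folded_normal \<theta>0)"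
      unfolding g2 t by (simp add: inner_vec_def sum_2 matrix_vector_mult_def info_mat_nth algebra_simps power2_eq_square)
    have lim: "(\<integral>x. cos (t \<bullet> x + c) \<partial>?N) = exp (- (t \<bullet> w) / 2) * cos c"
      unfolding w_def by (rule integral_cos_multivariate_normal_2[OF A])
    show "(\<lambda>n. expectation (\<lambda>\<omega>. cos (t \<bullet> influence n \<omega> + c))) \<longlonglongrightarrow> (\<integral>x. cos (t \<bullet> x + c) \<partial>?N)"
    \<comment> \<open>The degenerate direction is separate because the central limit theorem asks
      for a positive variance.\<close>
    proof (cases "w = 0")
      case True
      then have "t = 0" by (simp add: t)
      then show ?thesis unfolding lim by (simp add: prob_space)
    next
      case False
      then have "w$1 \<noteq> 0 \<or> w$2 \<noteq> 0" by (auto simp: vec_eq_iff forall_2)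
      then have "(\<integral>y. (g y)\<^sup>2 \<partial>folded_normal \<theta>0) > 0"
        unfolding g2 by (rule info_pos_def[OF \<theta>0])
      from tendsto_expectation_cos_sum[OF _ g2(1) g0 this, of c]
      show ?thesis unfolding tg lim tw by simp
    qed
  qed measurable
qed

end

section \<open>Transfer to the score and the Fisher information as defined\<close>

theorem theorem5p1:
  fixes M :: "'a measure"
    and Y :: "nat \<Rightarrow> 'a \<Rightarrow> real"
    and \<theta>\<^sub>0 :: "real^2"
    and \<Theta> :: "(real^2) set"
    and \<theta>hat :: "nat \<Rightarrow> 'a \<Rightarrow> real^2"
  assumes "prob_space M"
    and "prob_space.indep_vars M (\<lambda>_. borel) Y UNIV"
    and "\<And>i. distributed M lborel (Y i) (\<lambda>y. ennreal (folded_normal_density \<theta>\<^sub>0 y))"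
    and "\<theta>\<^sub>0 $ 1 > 0" and "\<theta>\<^sub>0 $ 2 > 0"
    and "compact \<Theta>" and "\<Theta> \<subseteq> {\<theta>. \<theta> $ 1 > 0 \<and> \<theta> $ 2 > 0}"
    and "\<theta>\<^sub>0 \<in> interior \<Theta>"
    and "\<And>n. \<theta>hat n \<in> borel_measurable M"
    and "\<And>n. n \<ge> 1 \<Longrightarrow> AE \<omega> in M.
           is_arg_max (log_lik (\<lambda>i. Y i \<omega>) n) (\<lambda>\<theta>. \<theta> \<in> \<Theta>) (\<theta>hat n \<omega>)"
  shows
    "tendsto_in_prob M \<theta>hat \<theta>\<^sub>0
     \<and> integrable (folded_normal \<theta>\<^sub>0) (\<lambda>y. outer_square (score \<theta>\<^sub>0 y))
     \<and> invertible (fisher_info \<theta>\<^sub>0)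
     \<and> tendsto_in_prob M
         (\<lambda>n \<omega>. sqrt (real n) *\<^sub>R (\<theta>hat n \<omega> - \<theta>\<^sub>0)
            - matrix_inv (fisher_info \<theta>\<^sub>0) *v
                ((1 / sqrt (real n)) *\<^sub>R (\<Sum>i<n. score \<theta>\<^sub>0 (Y i \<omega>)))) 0
     \<and> tendsto_in_distr M (\<lambda>n \<omega>. sqrt (real n) *\<^sub>R (\<theta>hat n \<omega> - \<theta>\<^sub>0))
         (multivariate_normal 0 (matrix_inv (fisher_info \<theta>\<^sub>0)))
     \<and> (\<forall>\<mu> \<sigma> y. \<mu> > 0 \<longrightarrow> \<sigma> > 0 \<longrightarrow> y \<ge> 0 \<longrightarrow>
          GDERIV (\<lambda>t. ln (folded_normal_density t y)) (vector [\<mu>, \<sigma>]) :> score (vector [\<mu>, \<sigma>]) y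
          \<and> score (vector [\<mu>, \<sigma>]) y = vector [score_mu \<mu> \<sigma> y, score_sigma \<mu> \<sigma> y])
     \<and> fisher_info \<theta>\<^sub>0 =
         (\<integral>y. outer_square (vector [score_mu (\<theta>\<^sub>0 $ 1) (\<theta>\<^sub>0 $ 2) y, score_sigma (\<theta>\<^sub>0 $ 1) (\<theta>\<^sub>0 $ 2) y])
            \<partial>folded_normal \<theta>\<^sub>0)"
proof -
  interpret folded_normal_mle M Y \<theta>\<^sub>0 \<Theta> \<theta>hat
    unfolding folded_normal_mle_def folded_normal_mle_axioms_def using assms by blast
  \<comment> \<open>\<open>score\<close> is given by \<open>score1\<close> and \<open>score2\<close>
    at nonnegative observations, so the linear term equals \<open>influence\<close> almost surely;
    the filter then allows one to be replaced by the other.\<close>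
  have scoreZ: "AE \<omega> in M. \<forall>n. matrix_inv (fisher_info \<theta>\<^sub>0) *v
      ((1 / sqrt (real n)) *\<^sub>R (\<Sum>i<n. score \<theta>\<^sub>0 (Y i \<omega>))) = influence n \<omega>"
    using AE_Y_nonneg
  proof eventually_elim
    case (elim \<omega>)
    then show ?case
      by (simp add: influence_def fisher_info_eq[OF \<theta>0(2)] score_eq[OF \<theta>0(2)])
  qed
  have meas: "(\<lambda>\<omega>. sqrt (real n) *\<^sub>R (\<theta>hat n \<omega> - \<theta>\<^sub>0)
            - matrix_inv (fisher_info \<theta>\<^sub>0) *v
                ((1 / sqrt (real n)) *\<^sub>R (\<Sum>i<n. score \<theta>\<^sub>0 (Y i \<omega>)))) \<in> borel_measurable M" for n
    using measurable_score[OF \<theta>0(2)] by measurable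
  have "\<forall>\<^sub>F (n, \<omega>) in in_prob. matrix_inv (fisher_info \<theta>\<^sub>0) *v
      ((1 / sqrt (real n)) *\<^sub>R (\<Sum>i<n. score \<theta>\<^sub>0 (Y i \<omega>))) = influence n \<omega>"
  proof (rule eventually_in_prob_AE, rule always_eventually, rule allI)
    fix n
    show "AE \<omega> in M. matrix_inv (fisher_info \<theta>\<^sub>0) *v
        ((1 / sqrt (real n)) *\<^sub>R (\<Sum>i<n. score \<theta>\<^sub>0 (Y i \<omega>))) = influence n \<omega>"
      using scoreZ by eventually_elim blast
  qed
  then have "\<forall>\<^sub>F x in in_prob. (case x of (n, \<omega>) \<Rightarrow> sqrt (real n) *\<^sub>R (\<theta>hat n \<omega> - \<theta>\<^sub>0) - influence n \<omega>)
      = (case x of (n, \<omega>) \<Rightarrow> sqrt (real n) *\<^sub>R (\<theta>hat n \<omega> - \<theta>\<^sub>0)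
            - matrix_inv (fisher_info \<theta>\<^sub>0) *v
                ((1 / sqrt (real n)) *\<^sub>R (\<Sum>i<n. score \<theta>\<^sub>0 (Y i \<omega>))))"
    by eventually_elim auto
  then have "((\<lambda>(n, \<omega>). sqrt (real n) *\<^sub>R (\<theta>hat n \<omega> - \<theta>\<^sub>0)
            - matrix_inv (fisher_info \<theta>\<^sub>0) *v
                ((1 / sqrt (real n)) *\<^sub>R (\<Sum>i<n. score \<theta>\<^sub>0 (Y i \<omega>)))) \<longlongrightarrow> 0) in_prob"
    using asymptotically_linear by (rule Lim_transform_eventually[rotated])
  then have linear: "tendsto_in_prob M
         (\<lambda>n \<omega>. sqrt (real n) *\<^sub>R (\<theta>hat n \<omega> - \<theta>\<^sub>0)
            - matrix_inv (fisher_info \<theta>\<^sub>0) *v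
                ((1 / sqrt (real n)) *\<^sub>R (\<Sum>i<n. score \<theta>\<^sub>0 (Y i \<omega>)))) 0"
    by (subst tendsto_in_prob_iff[OF meas])
  have formula: "GDERIV (\<lambda>t. ln (folded_normal_density t y)) (vector [\<mu>, \<sigma>]) :> score (vector [\<mu>, \<sigma>]) y
      \<and> score (vector [\<mu>, \<sigma>]) y = vector [score_mu \<mu> \<sigma> y, score_sigma \<mu> \<sigma> y]"
    if "\<sigma> > 0" "y \<ge> 0" for \<mu> \<sigma> y
  proof -
    define \<theta> :: "real^2" where "\<theta> = vector [\<mu>, \<sigma>]"
    have \<theta>: "\<theta>$1 = \<mu>" "\<theta>$2 = \<sigma>" by (simp_all add: \<theta>_def)
    then have "\<theta>$2 > 0" using that by simp
    with GDERIV_ln_folded_normal_density[OF this that(2)] score_eq[OF this that(2)] score_mu_eq[OF this]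
    show ?thesis unfolding \<theta>_def[symmetric] by (simp add: \<theta>)
  qed
  have "(\<lambda>y. outer_square (vector [score_mu (\<theta>\<^sub>0 $ 1) (\<theta>\<^sub>0 $ 2) y, score_sigma (\<theta>\<^sub>0 $ 1) (\<theta>\<^sub>0 $ 2) y] :: real^2))
      = (\<lambda>y. outer_square (vector [score1 \<theta>\<^sub>0 y, score2 \<theta>\<^sub>0 y]))"
    by (simp add: score_mu_eq[OF \<theta>0(2)])
  then have "fisher_info \<theta>\<^sub>0 =
         (\<integral>y. outer_square (vector [score_mu (\<theta>\<^sub>0 $ 1) (\<theta>\<^sub>0 $ 2) y, score_sigma (\<theta>\<^sub>0 $ 1) (\<theta>\<^sub>0 $ 2) y])
            \<partial>folded_normal \<theta>\<^sub>0)"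
    using has_bochner_integral_outer_square[OF \<theta>0(2)]
    by (simp add: fisher_info_eq[OF \<theta>0(2)] has_bochner_integral_iff)
  moreover have "tendsto_in_prob M \<theta>hat \<theta>\<^sub>0"
    using consistent by (subst tendsto_in_prob_iff) simp_all
  moreover have "invertible (fisher_info \<theta>\<^sub>0)"
    using invertible_info_mat by (simp add: fisher_info_eq[OF \<theta>0(2)])
  moreover have "tendsto_in_distr M (\<lambda>n \<omega>. sqrt (real n) *\<^sub>R (\<theta>hat n \<omega> - \<theta>\<^sub>0))
         (multivariate_normal 0 (matrix_inv (fisher_info \<theta>\<^sub>0)))"
    using asymptotically_normal by (simp add: fisher_info_eq[OF \<theta>0(2)])
  ultimately show ?thesis
    using linear formula integrable_outer_square_score[OF \<theta>0(2)] by blast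
qed

end
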